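(* Let $n\ge1$ be an integer. The following irreducible modules exhaust, up to parity change, all nontrivial finite irreducible conformal modules over $\mathfrak k(n)$: (1) if $n>1$: the modules $V^{(1)}_{\Delta,\alpha}$ and $V^{(2)}_{\Delta,\alpha}$ with $\Delta,\alpha\in\mathbb C$, $\Delta\neq0$, and the modules $V_{\Delta,\Lambda,\alpha}$ with $\Delta,\Lambda,\alpha\in\mathbb C$, $2\Delta+\Lambda\ne0$ and $2\Delta-\Lambda\neq0$; (2) if $n=1$: the modules $V^{(1)}_{\Delta,\alpha}$ and $V^{(2)}_{\Delta,\alpha}$ with $\Delta,\alpha\in\mathbb C$, $\Delta\neq0$, and the modules $V_{\Delta,\Lambda,\alpha,\beta}$ with $\Delta,\Lambda,\alpha,\beta\in\mathbb C$, $(2\Delta+\Lambda,\beta)\neq(0,0)$ and $(2\Delta-\Lambda,\beta)\ne(0,0)$.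
   Context: A Lie conformal superalgebra is a $\mathbb Z/2\mathbb Z$-graded $\mathbb C[\partial]$-module $R=R_{\bar0}\oplus R_{\bar1}$ with a (parity-preserving) $\mathbb C$-linear $\lambda$-bracket $R\otimes R\to\mathbb C[\lambda]\otimes R$, $a\otimes b\mapsto[a\,{}_\lambda\, b]$, such that $[\partial a\,{}_\lambda\, b]=-\lambda[a\,{}_\lambda\, b]$, $[a\,{}_\lambda\,\partial b]=(\partial+\lambda)[a\,{}_\lambda\, b]$, $[a\,{}_\lambda\, b]=-(-1)^{|a||b|}[b\,{}_{-\lambda-\partial}\,a]$, $[a\,{}_\lambda[b\,{}_\mu c]]=[[a\,{}_\lambda b]\,{}_{\lambda+\mu}c]+(-1)^{|a||b|}[b\,{}_\mu[a\,{}_\lambda c]]$. A conformal $R$-module is a $\mathbb Z/2\mathbb Z$-graded $\mathbb C[\partial]$-module $M=M_{\bar0}\oplus M_{\bar1}$ with a (parity-preserving) $\mathbb C$-linear $\lambda$-action $R\otimes M\to\mathbb C[\lambda]\otimes M$, $a\otimes v\mapsto a\,{}_\lambda v$, such that $(\partial a)\,{}_\lambda v=-\lambda\, a\,{}_\lambda v$, $a\,{}_\lambda(\partial v)=(\partial+\lambda)a\,{}_\lambda v$, $[a\,{}_\lambda b]\,{}_{\lambda+\mu}v=a\,{}_\lambda(b\,{}_\mu v)-(-1)^{|a||b|}b\,{}_\mu(a\,{}_\lambda v)$. It is finite if finitely generated over $\mathbb C[\partial]$, and nontrivial if the $\lambda$-action is not identically zero. "Up to parity change" means up to isomorphism and reversal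 of the parity of the module. For $n\ge1$, $\mathfrak k(n)$ is the Lie conformal superalgebra with $\mathbb C[\partial]$-basis $\{\bar L_i,\bar J_i,\bar G_i^\pm\mid0\le i\le n\}$, $\bar L_i,\bar J_i$ even and $\bar G_i^\pm$ odd, with nontrivial $\lambda$-brackets (for $i+j\le n$; brackets with $i+j>n$ vanish, the others are given by skew-symmetry or zero) $[\bar L_i\,{}_\lambda\bar L_j]=((i-n)\partial+(i+j-2n)\lambda)\bar L_{i+j}$, $[\bar L_i\,{}_\lambda\bar J_j]=((i-n)\partial+(i+j-n)\lambda)\bar J_{i+j}$, $[\bar L_i\,{}_\lambda\bar G_j^\pm]=((i-n)\partial+(i+j-\frac32n)\lambda)\bar G_{i+j}^\pm$, $[\bar J_i\,{}_\lambda\bar G_j^\pm]=\pm\bar G_{i+j}^\pm$, $[\bar G_i^+\,{}_\lambda\bar G_j^-]=((2i-n)\partial+2(i+j-n)\lambda)\bar J_{i+j}+2\bar L_{i+j}$. Fix a square root $\sqrt{-n}$. The following are conformal $\mathfrak k(n)$-modules, free over $\mathbb C[\partial]$; subscripts $\bar0,\bar1$ of basis vectors denote parity; $\Delta,\Lambda,\alpha,\beta\in\mathbb C$. $V^{(1)}_{\Delta,\alpha}=\mathbb C[\partial]v_{\bar0}\oplus\mathbb C[\partial]v_{\bar1}$: $\bar L_0\,{}_\lambda v_{\bar0}=-n(\partial+\Delta\lambda+\alpha)v_{\bar0}$, $\bar L_0\,{}_\lambda v_{\bar1}=-n(\partial+(\Delta+\frac12)\lambda+\alpha)v_{\bar1}$,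 $\bar J_0\,{}_\lambda v_{\bar0}=-2\Delta v_{\bar0}$, $\bar J_0\,{}_\lambda v_{\bar1}=(1-2\Delta)v_{\bar1}$, $\bar G_0^+\,{}_\lambda v_{\bar0}=\sqrt{-n}\,v_{\bar1}$, $\bar G_0^+\,{}_\lambda v_{\bar1}=0$, $\bar G_0^-\,{}_\lambda v_{\bar0}=0$, $\bar G_0^-\,{}_\lambda v_{\bar1}=2\sqrt{-n}(\partial+2\Delta\lambda+\alpha)v_{\bar0}$; $\bar L_i,\bar J_i,\bar G_i^\pm$ act as zero for $1\le i\le n$. $V^{(2)}_{\Delta,\alpha}=\mathbb C[\partial]v_{\bar0}\oplus\mathbb C[\partial]v_{\bar1}$: $\bar L_0\,{}_\lambda v_{\bar0}=-n(\partial+\Delta\lambda+\alpha)v_{\bar0}$, $\bar L_0\,{}_\lambda v_{\bar1}=-n(\partial+(\Delta+\frac12)\lambda+\alpha)v_{\bar1}$, $\bar J_0\,{}_\lambda v_{\bar0}=2\Delta v_{\bar0}$, $\bar J_0\,{}_\lambda v_{\bar1}=(2\Delta-1)v_{\bar1}$, $\bar G_0^+\,{}_\lambda v_{\bar0}=0$, $\bar G_0^+\,{}_\lambda v_{\bar1}=2\sqrt{-n}(\partial+2\Delta\lambda+\alpha)v_{\bar0}$, $\bar G_0^-\,{}_\lambda v_{\bar0}=\sqrt{-n}\,v_{\bar1}$, $\bar G_0^-\,{}_\lambda v_{\bar1}=0$; $\bar L_i,\bar J_i,\bar G_i^\pm$ act as zero for $1\le i\le n$. $V_{\Delta,\Lambda,\alpha}=\mathbb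 C[\partial]v_{\bar0}^{(1)}\oplus\mathbb C[\partial]v_{\bar0}^{(2)}\oplus\mathbb C[\partial]v_{\bar1}^{(1)}\oplus\mathbb C[\partial]v_{\bar1}^{(2)}$: $\bar L_0\,{}_\lambda v_{\bar0}^{(1)}=-n(\partial+\Delta\lambda+\alpha)v_{\bar0}^{(1)}$, $\bar L_0\,{}_\lambda v_{\bar0}^{(2)}=-n(\partial+(\Delta+1)\lambda+\alpha)v_{\bar0}^{(2)}-n(\Delta+\frac\Lambda2)\lambda^2v_{\bar0}^{(1)}$, $\bar L_0\,{}_\lambda v_{\bar1}^{(\ell)}=-n(\partial+(\Delta+\frac12)\lambda+\alpha)v_{\bar1}^{(\ell)}$ ($\ell=1,2$); $\bar J_0\,{}_\lambda v_{\bar0}^{(1)}=\Lambda v_{\bar0}^{(1)}$, $\bar J_0\,{}_\lambda v_{\bar0}^{(2)}=\Lambda v_{\bar0}^{(2)}+(2\Delta+\Lambda)\lambda v_{\bar0}^{(1)}$, $\bar J_0\,{}_\lambda v_{\bar1}^{(1)}=(\Lambda+1)v_{\bar1}^{(1)}$, $\bar J_0\,{}_\lambda v_{\bar1}^{(2)}=(\Lambda-1)v_{\bar1}^{(2)}$; $\bar G_0^+\,{}_\lambda v_{\bar0}^{(1)}=\sqrt{-n}\,v_{\bar1}^{(1)}$, $\bar G_0^+\,{}_\lambda v_{\bar1}^{(1)}=0$, $\bar G_0^+\,{}_\lambda v_{\bar0}^{(2)}=-\sqrt{-n}(2\Delta+\Lambda)\lambda v_{\bar1}^{(1)}$, $\bar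 G_0^+\,{}_\lambda v_{\bar1}^{(2)}=\sqrt{-n}(2\Delta+\Lambda)\lambda v_{\bar0}^{(1)}+\sqrt{-n}\,v_{\bar0}^{(2)}$; $\bar G_0^-\,{}_\lambda v_{\bar0}^{(1)}=\sqrt{-n}\,v_{\bar1}^{(2)}$, $\bar G_0^-\,{}_\lambda v_{\bar1}^{(1)}=\sqrt{-n}(2\partial+(2\Delta-\Lambda)\lambda+2\alpha)v_{\bar0}^{(1)}-\sqrt{-n}\,v_{\bar0}^{(2)}$, $\bar G_0^-\,{}_\lambda v_{\bar0}^{(2)}=\sqrt{-n}(2\partial+(2\Delta-\Lambda+2)\lambda+2\alpha)v_{\bar1}^{(2)}$, $\bar G_0^-\,{}_\lambda v_{\bar1}^{(2)}=0$; $\bar L_i,\bar J_i,\bar G_i^\pm$ act as zero for $1\le i\le n$. $V_{\Delta,\Lambda,\alpha,\beta}$ (only for $n=1$): same underlying $\mathbb C[\partial]$-module and same actions of $\bar L_0,\bar J_0,\bar G_0^\pm$ as $V_{\Delta,\Lambda,\alpha}$ with $n=1$ (and $\sqrt{-n}=\sqrt{-1}$); $\bar L_1\,{}_\lambda v=-\frac{\sqrt{-1}}2\beta v$ for $v=v_{\bar0}^{(1)},v_{\bar1}^{(1)},v_{\bar1}^{(2)}$, $\bar L_1\,{}_\lambda v_{\bar0}^{(2)}=-\frac{\sqrt{-1}}2\beta(v_{\bar0}^{(2)}+\lambda v_{\bar0}^{(1)})$; $\bar J_1\,{}_\lambda v_{\bar0}^{(2)}=\sqrt{-1}\,\beta v_{\bar0}^{(1)}$;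 $\bar G_1^+\,{}_\lambda v_{\bar0}^{(2)}=\beta v_{\bar1}^{(1)}$, $\bar G_1^+\,{}_\lambda v_{\bar1}^{(2)}=-\beta v_{\bar0}^{(1)}$; $\bar G_1^-\,{}_\lambda v_{\bar1}^{(1)}=-\beta v_{\bar0}^{(1)}$, $\bar G_1^-\,{}_\lambda v_{\bar0}^{(2)}=-\beta v_{\bar1}^{(2)}$; $\bar J_1,\bar G_1^\pm$ act as zero on the remaining basis vectors. *)

theory Defs
  imports
    Complex_Main
    "HOL-Library.Z2"
    "HOL-Library.Poly_Mapping"
    "HOL-Computational_Algebra.Polynomial"
begin

section \<open>Graded modules over the polynomial ring in the derivation\<close>

text \<open>
  The ring \<open>\<complex>[\<partial>]\<close> is \<^typ>\<open>complex poly\<close>, so \<open>\<partial>\<close> is \<open>[:0, 1:]\<close>, and parities live in \<^typ>\<open>bit\<close>.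
  The carrier is \<open>grade M 0 \<oplus> grade M 1\<close>, a submodule of an ambient module on the whole type.
\<close>

record 'm graded_pmod =
  pscale :: "complex poly \<Rightarrow> 'm \<Rightarrow> 'm"
  grade :: "bit \<Rightarrow> 'm set"

record (overloaded) 'r lie_csa = "'r graded_pmod" +
  bracket :: "'r \<Rightarrow> 'r \<Rightarrow> 'r poly"

record (overloaded) ('m, 'r) conf_mod = "'m graded_pmod" +
  act :: "'r \<Rightarrow> 'm \<Rightarrow> 'm poly"

definition carrier_of :: "('m::ab_group_add, 'z) graded_pmod_scheme \<Rightarrow> 'm set" where
  "carrier_of M = {x + y | x y. x \<in> grade M 0 \<and> y \<in> grade M 1}"

definition cscale :: "('m, 'z) graded_pmod_scheme \<Rightarrow> complex \<Rightarrow> 'm \<Rightarrow> 'm" where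
  "cscale M c = pscale M [:c:]"

definition deriv_of :: "('m, 'z) graded_pmod_scheme \<Rightarrow> 'm \<Rightarrow> 'm" where
  "deriv_of M = pscale M [:0, 1:]"

locale graded_pmodule =
  fixes M :: "('m::ab_group_add, 'z) graded_pmod_scheme"
  assumes module_pscale: "module (pscale M)"
    and subspace_grade: "module.subspace (pscale M) (grade M i)"
    and grade_Int: "grade M 0 \<inter> grade M 1 = {0}"


section \<open>Formal variables\<close>

text \<open>
  \<open>\<complex>[\<lambda>] \<otimes> M\<close> is \<^typ>\<open>'m poly\<close>, and \<open>\<complex>[\<lambda>,\<mu>] \<otimes> M\<close> is \<^typ>\<open>'m poly poly\<close> with outer variable \<open>\<mu>\<close>
  and inner variable \<open>\<lambda>\<close>. \<open>subst_op X \<iota> f\<close> puts the operator \<open>X\<close> in place of the variable of \<open>f\<close>, with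
  coefficients mapped by \<open>\<iota>\<close>: the result is \<open>\<Sum>\<^sub>k X\<^sup>k (\<iota> f\<^sub>k)\<close>.
\<close>

definition subst_op :: "('n \<Rightarrow> 'n) \<Rightarrow> ('m::zero \<Rightarrow> 'n::comm_monoid_add) \<Rightarrow> 'm poly \<Rightarrow> 'n" where
  "subst_op X \<iota> f = (\<Sum>k\<le>degree f. (X ^^ k) (\<iota> (coeff f k)))"

definition const2 :: "'m::zero \<Rightarrow> 'm poly poly" where
  "const2 v = [:[:v:]:]"

definition lam2 :: "'m::zero poly poly \<Rightarrow> 'm poly poly" where
  "lam2 F = map_poly (pCons 0) F"

definition mu2 :: "'m::zero poly poly \<Rightarrow> 'm poly poly" where
  "mu2 F = pCons 0 F"

text \<open>\<open>iterated A X a Y b v\<close> is \<open>a\<^sub>X (b\<^sub>Y v)\<close>; \<open>bracketed B A a b v\<close> is \<open>[a\<^sub>\<lambda> b]\<^sub>\<lambda>\<^sub>+\<^sub>\<mu> v\<close>.\<close>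

definition iterated ::
  "('r \<Rightarrow> 'm \<Rightarrow> 'm poly) \<Rightarrow> ('m poly poly \<Rightarrow> 'm poly poly) \<Rightarrow> 'r
    \<Rightarrow> ('m poly poly \<Rightarrow> 'm poly poly) \<Rightarrow> 'r \<Rightarrow> 'm::ab_group_add \<Rightarrow> 'm poly poly" where
  "iterated A X a Y b v = subst_op Y (\<lambda>w. subst_op X const2 (A a w)) (A b v)"

definition bracketed ::
  "('r \<Rightarrow> 'r \<Rightarrow> 'r poly) \<Rightarrow> ('r::zero \<Rightarrow> 'm \<Rightarrow> 'm poly) \<Rightarrow> 'r \<Rightarrow> 'r \<Rightarrow> 'm::ab_group_add \<Rightarrow> 'm poly poly" where
  "bracketed B A a b v =
     subst_op lam2 (\<lambda>c. subst_op (\<lambda>F. lam2 F + mu2 F) const2 (A c v)) (B a b)"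

definition koszul :: "bit \<Rightarrow> bit \<Rightarrow> 'a::ab_group_add \<Rightarrow> 'a" where
  "koszul i j x = (if i = 1 \<and> j = 1 then - x else x)"

text \<open>The axioms common to \<open>\<lambda>\<close>-brackets (with \<open>M = R\<close>) and \<open>\<lambda>\<close>-actions.\<close>

definition sesquilinear ::
  "('r::ab_group_add, 'y) graded_pmod_scheme \<Rightarrow> ('m::ab_group_add, 'z) graded_pmod_scheme
    \<Rightarrow> ('r \<Rightarrow> 'm \<Rightarrow> 'm poly) \<Rightarrow> bool" where
  "sesquilinear R M A \<longleftrightarrow>
     (\<forall>a\<in>carrier_of R. \<forall>b\<in>carrier_of R. \<forall>v\<in>carrier_of M. A (a + b) v = A a v + A b v) \<and>
     (\<forall>a\<in>carrier_of R. \<forall>v\<in>carrier_of M. \<forall>w\<in>carrier_of M. A a (v + w) = A a v + A a w) \<and>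
     (\<forall>c. \<forall>a\<in>carrier_of R. \<forall>v\<in>carrier_of M. A (cscale R c a) v = map_poly (cscale M c) (A a v)) \<and>
     (\<forall>c. \<forall>a\<in>carrier_of R. \<forall>v\<in>carrier_of M. A a (cscale M c v) = map_poly (cscale M c) (A a v)) \<and>
     (\<forall>i j k. \<forall>a\<in>grade R i. \<forall>v\<in>grade M j. coeff (A a v) k \<in> grade M (i + j)) \<and>
     (\<forall>a\<in>carrier_of R. \<forall>v\<in>carrier_of M. A (deriv_of R a) v = - pCons 0 (A a v)) \<and>
     (\<forall>a\<in>carrier_of R. \<forall>v\<in>carrier_of M.
        A a (deriv_of M v) = map_poly (deriv_of M) (A a v) + pCons 0 (A a v))"


section \<open>Lie conformal superalgebras and conformal modules\<close>

locale lie_conformal_superalgebra = graded_pmodule R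
  for R :: "'r::ab_group_add lie_csa" +
  assumes bracket_sesquilinear: "sesquilinear R R (bracket R)"
    and bracket_skew: "a \<in> grade R i \<Longrightarrow> b \<in> grade R j \<Longrightarrow>
      bracket R a b =
        - koszul i j (subst_op (\<lambda>f. - pCons 0 f - map_poly (deriv_of R) f) (\<lambda>c. [:c:]) (bracket R b a))"
    and bracket_jacobi: "a \<in> grade R i \<Longrightarrow> b \<in> grade R j \<Longrightarrow> c \<in> carrier_of R \<Longrightarrow>
      iterated (bracket R) lam2 a mu2 b c =
        bracketed (bracket R) (bracket R) a b c + koszul i j (iterated (bracket R) mu2 b lam2 a c)"

text \<open>A module is taken to be all of its type, unlike an algebra.\<close>

locale conformal_module = R: lie_conformal_superalgebra R + M: graded_pmodule M
  for R :: "'r::ab_group_add lie_csa" and M :: "('m::ab_group_add, 'r) conf_mod" +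
  assumes carrier_M: "carrier_of M = UNIV"
    and act_sesquilinear: "sesquilinear R M (act M)"
    and act_bracket: "a \<in> grade R i \<Longrightarrow> b \<in> grade R j \<Longrightarrow>
      bracketed (bracket R) (act M) a b v =
        iterated (act M) lam2 a mu2 b v - koszul i j (iterated (act M) mu2 b lam2 a v)"

definition finite_conf_module :: "('m::ab_group_add, 'r) conf_mod \<Rightarrow> bool" where
  "finite_conf_module M \<longleftrightarrow> (\<exists>B. finite B \<and> module.span (pscale M) B = UNIV)"

definition nontrivial_conf_module ::
  "'r::ab_group_add lie_csa \<Rightarrow> ('m::ab_group_add, 'r) conf_mod \<Rightarrow> bool" where
  "nontrivial_conf_module R M \<longleftrightarrow> (\<exists>a\<in>carrier_of R. \<exists>v. act M a v \<noteq> 0)"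

text \<open>Submodules are graded.\<close>

definition conf_submodule ::
  "'r::ab_group_add lie_csa \<Rightarrow> ('m::ab_group_add, 'r) conf_mod \<Rightarrow> 'm set \<Rightarrow> bool" where
  "conf_submodule R M N \<longleftrightarrow>
     module.subspace (pscale M) N \<and>
     N \<subseteq> {x + y | x y. x \<in> N \<inter> grade M 0 \<and> y \<in> N \<inter> grade M 1} \<and>
     (\<forall>a\<in>carrier_of R. \<forall>v\<in>N. \<forall>k. coeff (act M a v) k \<in> N)"

definition irreducible_conf_module ::
  "'r::ab_group_add lie_csa \<Rightarrow> ('m::ab_group_add, 'r) conf_mod \<Rightarrow> bool" where
  "irreducible_conf_module R M \<longleftrightarrow>
     (UNIV :: 'm set) \<noteq> {0} \<and> (\<forall>N. conf_submodule R M N \<longrightarrow> N = {0} \<or> N = UNIV)"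

definition nontrivial_finite_irreducible ::
  "'r::ab_group_add lie_csa \<Rightarrow> ('m::ab_group_add, 'r) conf_mod \<Rightarrow> bool" where
  "nontrivial_finite_irreducible R M \<longleftrightarrow>
     conformal_module R M \<and> nontrivial_conf_module R M \<and> finite_conf_module M
       \<and> irreducible_conf_module R M"

definition conf_isomorphic ::
  "'r::ab_group_add lie_csa \<Rightarrow> ('m::ab_group_add, 'r) conf_mod \<Rightarrow> ('n::ab_group_add, 'r) conf_mod \<Rightarrow> bool"
where
  "conf_isomorphic R M N \<longleftrightarrow>
     (\<exists>f. bij f \<and> module_hom (pscale M) (pscale N) f \<and> (\<forall>i. f ` grade M i = grade N i) \<and>
          (\<forall>a\<in>carrier_of R. \<forall>v. act N a (f v) = map_poly f (act M a v)))"

definition parity_change :: "('m, 'r) conf_mod \<Rightarrow> ('m, 'r) conf_mod" where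
  "parity_change M = M\<lparr>grade := (\<lambda>i. grade M (i + 1))\<rparr>"

definition isomorphic_up_to_parity ::
  "'r::ab_group_add lie_csa \<Rightarrow> ('m::ab_group_add, 'r) conf_mod \<Rightarrow> ('n::ab_group_add, 'r) conf_mod \<Rightarrow> bool"
where
  "isomorphic_up_to_parity R M N \<longleftrightarrow>
     conf_isomorphic R M N \<or> conf_isomorphic R M (parity_change N)"


section \<open>Free modules with an action given on a basis\<close>

text \<open>
  The free \<open>\<complex>[\<partial>]\<close>-module with basis \<open>'h\<close> is \<^typ>\<open>'h \<Rightarrow>\<^sub>0 complex poly\<close>. Elements of \<open>\<complex>[\<lambda>,\<partial>]\<close>, used to
  write down values of brackets and actions on basis elements, are of type \<^typ>\<open>complex poly poly\<close> with
  outer variable \<open>\<lambda>\<close> and inner variable \<open>\<partial>\<close>. A list of pairs \<open>(F, h)\<close> stands for \<open>\<Sum> F(\<lambda>,\<partial>) h\<close>.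
\<close>

type_synonym 'h terms = "(complex poly poly \<times> 'h) list"

abbreviation cst :: "complex \<Rightarrow> complex poly poly" where "cst c \<equiv> [:[:c:]:]"
abbreviation del :: "complex poly poly" where "del \<equiv> [:[:0, 1:]:]"
abbreviation lam :: "complex poly poly" where "lam \<equiv> [:0, 1:]"

definition eval_at :: "complex poly \<Rightarrow> complex poly poly \<Rightarrow> complex poly poly" where
  "eval_at p X = poly (map_poly (\<lambda>c. cst c) p) X"

definition free_scale :: "complex poly \<Rightarrow> ('h \<Rightarrow>\<^sub>0 complex poly) \<Rightarrow> ('h \<Rightarrow>\<^sub>0 complex poly)" where
  "free_scale p v = Poly_Mapping.map (\<lambda>q. p * q) v"

text \<open>Sesquilinearity forces \<open>(p(\<partial>) g)\<^sub>\<lambda> (q(\<partial>) h) = p(-\<lambda>) q(\<partial>+\<lambda>) (g\<^sub>\<lambda> h)\<close>.\<close>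

definition sesquilinear_extension ::
  "('g \<Rightarrow> 'h \<Rightarrow> 'h terms) \<Rightarrow> ('g \<Rightarrow>\<^sub>0 complex poly) \<Rightarrow> ('h \<Rightarrow>\<^sub>0 complex poly)
    \<Rightarrow> ('h \<Rightarrow>\<^sub>0 complex poly) poly" where
  "sesquilinear_extension tab a v =
     (\<Sum>g\<in>Poly_Mapping.keys a. \<Sum>h\<in>Poly_Mapping.keys v. \<Sum>(F, m)\<leftarrow>tab g h.
        map_poly (Poly_Mapping.single m)
          (eval_at (Poly_Mapping.lookup a g) (- lam) * eval_at (Poly_Mapping.lookup v h) (del + lam) * F))"


section \<open>The Lie conformal superalgebra k(n)\<close>

datatype kgen = L nat | J nat | Gp nat | Gm nat

fun kindex :: "kgen \<Rightarrow> nat" where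
  "kindex (L i) = i" | "kindex (J i) = i" | "kindex (Gp i) = i" | "kindex (Gm i) = i"

fun kparity :: "kgen \<Rightarrow> bit" where
  "kparity (L i) = 0" | "kparity (J i) = 0" | "kparity (Gp i) = 1" | "kparity (Gm i) = 1"

definition upto_index :: "nat \<Rightarrow> nat \<Rightarrow> 'h terms \<Rightarrow> 'h terms" where
  "upto_index n k xs = (if k \<le> n then xs else [])"

fun kgiven :: "nat \<Rightarrow> kgen \<Rightarrow> kgen \<Rightarrow> kgen terms" where
  "kgiven n (L i) (L j) = upto_index n (i + j)
     [(cst (of_nat i - of_nat n) * del + cst (of_nat i + of_nat j - 2 * of_nat n) * lam, L (i + j))]"
| "kgiven n (L i) (J j) = upto_index n (i + j)
     [(cst (of_nat i - of_nat n) * del + cst (of_nat i + of_nat j - of_nat n) * lam, J (i + j))]"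
| "kgiven n (L i) (Gp j) = upto_index n (i + j)
     [(cst (of_nat i - of_nat n) * del + cst (of_nat i + of_nat j - 3 / 2 * of_nat n) * lam, Gp (i + j))]"
| "kgiven n (L i) (Gm j) = upto_index n (i + j)
     [(cst (of_nat i - of_nat n) * del + cst (of_nat i + of_nat j - 3 / 2 * of_nat n) * lam, Gm (i + j))]"
| "kgiven n (J i) (Gp j) = upto_index n (i + j) [(cst 1, Gp (i + j))]"
| "kgiven n (J i) (Gm j) = upto_index n (i + j) [(cst (- 1), Gm (i + j))]"
| "kgiven n (Gp i) (Gm j) = upto_index n (i + j)
     [(cst (2 * of_nat i - of_nat n) * del + cst (2 * (of_nat i + of_nat j - of_nat n)) * lam, J (i + j)),
      (cst 2, L (i + j))]"
| "kgiven n _ _ = []"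

text \<open>The remaining brackets come from skew-symmetry, \<open>\<lambda>\<close> being replaced by \<open>-\<lambda>-\<partial>\<close>, or vanish.\<close>

definition kbracket_gen :: "nat \<Rightarrow> kgen \<Rightarrow> kgen \<Rightarrow> kgen terms" where
  "kbracket_gen n x y =
     (if kgiven n x y \<noteq> [] then kgiven n x y
      else map (\<lambda>(F, z). (- koszul (kparity x) (kparity y) (pcompose F (- lam - del)), z)) (kgiven n y x))"

definition k_alg :: "nat \<Rightarrow> (kgen \<Rightarrow>\<^sub>0 complex poly) lie_csa" where
  "k_alg n = \<lparr>pscale = free_scale,
     grade = (\<lambda>p. {a. \<forall>g\<in>Poly_Mapping.keys a. kindex g \<le> n \<and> kparity g = p}),
     bracket = sesquilinear_extension (kbracket_gen n)\<rparr>"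

type_synonym kelem = "kgen \<Rightarrow>\<^sub>0 complex poly"


section \<open>The modules\<close>

definition free_conf_module ::
  "('h \<Rightarrow> bit) \<Rightarrow> (kgen \<Rightarrow> 'h \<Rightarrow> 'h terms) \<Rightarrow> ('h \<Rightarrow>\<^sub>0 complex poly, kelem) conf_mod" where
  "free_conf_module par tab = \<lparr>pscale = free_scale,
     grade = (\<lambda>p. {v. \<forall>h\<in>Poly_Mapping.keys v. par h = p}),
     act = sesquilinear_extension tab\<rparr>"

text \<open>Throughout, \<open>s\<close> is the chosen square root of \<open>-n\<close>. In \<open>v01\<close>, \<open>v02\<close>, \<open>v11\<close>, \<open>v12\<close> the first digit
  is the parity and the second one the upper index.\<close>

datatype basis2 = v0 | v1

fun parity2 :: "basis2 \<Rightarrow> bit" where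
  "parity2 v0 = 0" | "parity2 v1 = 1"

fun V1_act :: "nat \<Rightarrow> complex \<Rightarrow> complex \<Rightarrow> complex \<Rightarrow> kgen \<Rightarrow> basis2 \<Rightarrow> basis2 terms" where
  "V1_act n s \<Delta> \<alpha> (L 0) v0 = [(cst (- of_nat n) * (del + cst \<Delta> * lam + cst \<alpha>), v0)]"
| "V1_act n s \<Delta> \<alpha> (L 0) v1 = [(cst (- of_nat n) * (del + cst (\<Delta> + 1 / 2) * lam + cst \<alpha>), v1)]"
| "V1_act n s \<Delta> \<alpha> (J 0) v0 = [(cst (- 2 * \<Delta>), v0)]"
| "V1_act n s \<Delta> \<alpha> (J 0) v1 = [(cst (1 - 2 * \<Delta>), v1)]"
| "V1_act n s \<Delta> \<alpha> (Gp 0) v0 = [(cst s, v1)]"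
| "V1_act n s \<Delta> \<alpha> (Gm 0) v1 = [(cst (2 * s) * (del + cst (2 * \<Delta>) * lam + cst \<alpha>), v0)]"
| "V1_act n s \<Delta> \<alpha> _ _ = []"

fun V2_act :: "nat \<Rightarrow> complex \<Rightarrow> complex \<Rightarrow> complex \<Rightarrow> kgen \<Rightarrow> basis2 \<Rightarrow> basis2 terms" where
  "V2_act n s \<Delta> \<alpha> (L 0) v0 = [(cst (- of_nat n) * (del + cst \<Delta> * lam + cst \<alpha>), v0)]"
| "V2_act n s \<Delta> \<alpha> (L 0) v1 = [(cst (- of_nat n) * (del + cst (\<Delta> + 1 / 2) * lam + cst \<alpha>), v1)]"
| "V2_act n s \<Delta> \<alpha> (J 0) v0 = [(cst (2 * \<Delta>), v0)]"
| "V2_act n s \<Delta> \<alpha> (J 0) v1 = [(cst (2 * \<Delta> - 1), v1)]"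
| "V2_act n s \<Delta> \<alpha> (Gp 0) v1 = [(cst (2 * s) * (del + cst (2 * \<Delta>) * lam + cst \<alpha>), v0)]"
| "V2_act n s \<Delta> \<alpha> (Gm 0) v0 = [(cst s, v1)]"
| "V2_act n s \<Delta> \<alpha> _ _ = []"

definition V1_mod ::
  "nat \<Rightarrow> complex \<Rightarrow> complex \<Rightarrow> complex \<Rightarrow> (basis2 \<Rightarrow>\<^sub>0 complex poly, kelem) conf_mod" where
  "V1_mod n s \<Delta> \<alpha> = free_conf_module parity2 (V1_act n s \<Delta> \<alpha>)"

definition V2_mod ::
  "nat \<Rightarrow> complex \<Rightarrow> complex \<Rightarrow> complex \<Rightarrow> (basis2 \<Rightarrow>\<^sub>0 complex poly, kelem) conf_mod" where
  "V2_mod n s \<Delta> \<alpha> = free_conf_module parity2 (V2_act n s \<Delta> \<alpha>)"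

datatype basis4 = v01 | v02 | v11 | v12

fun parity4 :: "basis4 \<Rightarrow> bit" where
  "parity4 v01 = 0" | "parity4 v02 = 0" | "parity4 v11 = 1" | "parity4 v12 = 1"

fun V_act ::
  "nat \<Rightarrow> complex \<Rightarrow> complex \<Rightarrow> complex \<Rightarrow> complex \<Rightarrow> kgen \<Rightarrow> basis4 \<Rightarrow> basis4 terms" where
  "V_act n s \<Delta> \<Lambda> \<alpha> (L 0) v01 = [(cst (- of_nat n) * (del + cst \<Delta> * lam + cst \<alpha>), v01)]"
| "V_act n s \<Delta> \<Lambda> \<alpha> (L 0) v02 = [(cst (- of_nat n) * (del + cst (\<Delta> + 1) * lam + cst \<alpha>), v02),
     (cst (- of_nat n * (\<Delta> + \<Lambda> / 2)) * lam ^ 2, v01)]"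
| "V_act n s \<Delta> \<Lambda> \<alpha> (L 0) v11 = [(cst (- of_nat n) * (del + cst (\<Delta> + 1 / 2) * lam + cst \<alpha>), v11)]"
| "V_act n s \<Delta> \<Lambda> \<alpha> (L 0) v12 = [(cst (- of_nat n) * (del + cst (\<Delta> + 1 / 2) * lam + cst \<alpha>), v12)]"
| "V_act n s \<Delta> \<Lambda> \<alpha> (J 0) v01 = [(cst \<Lambda>, v01)]"
| "V_act n s \<Delta> \<Lambda> \<alpha> (J 0) v02 = [(cst \<Lambda>, v02), (cst (2 * \<Delta> + \<Lambda>) * lam, v01)]"
| "V_act n s \<Delta> \<Lambda> \<alpha> (J 0) v11 = [(cst (\<Lambda> + 1), v11)]"
| "V_act n s \<Delta> \<Lambda> \<alpha> (J 0) v12 = [(cst (\<Lambda> - 1), v12)]"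
| "V_act n s \<Delta> \<Lambda> \<alpha> (Gp 0) v01 = [(cst s, v11)]"
| "V_act n s \<Delta> \<Lambda> \<alpha> (Gp 0) v02 = [(cst (- s * (2 * \<Delta> + \<Lambda>)) * lam, v11)]"
| "V_act n s \<Delta> \<Lambda> \<alpha> (Gp 0) v12 = [(cst (s * (2 * \<Delta> + \<Lambda>)) * lam, v01), (cst s, v02)]"
| "V_act n s \<Delta> \<Lambda> \<alpha> (Gm 0) v01 = [(cst s, v12)]"
| "V_act n s \<Delta> \<Lambda> \<alpha> (Gm 0) v02 =
     [(cst s * (cst 2 * del + cst (2 * \<Delta> - \<Lambda> + 2) * lam + cst (2 * \<alpha>)), v12)]"
| "V_act n s \<Delta> \<Lambda> \<alpha> (Gm 0) v11 =
     [(cst s * (cst 2 * del + cst (2 * \<Delta> - \<Lambda>) * lam + cst (2 * \<alpha>)), v01), (cst (- s), v02)]"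
| "V_act n s \<Delta> \<Lambda> \<alpha> _ _ = []"

definition V_mod ::
  "nat \<Rightarrow> complex \<Rightarrow> complex \<Rightarrow> complex \<Rightarrow> complex \<Rightarrow> (basis4 \<Rightarrow>\<^sub>0 complex poly, kelem) conf_mod" where
  "V_mod n s \<Delta> \<Lambda> \<alpha> = free_conf_module parity4 (V_act n s \<Delta> \<Lambda> \<alpha>)"

text \<open>The four-parameter family over \<open>k(1)\<close>; here \<open>s\<close> is the chosen square root of \<open>-1\<close>.\<close>

fun V\<beta>_act ::
  "complex \<Rightarrow> complex \<Rightarrow> complex \<Rightarrow> complex \<Rightarrow> complex \<Rightarrow> kgen \<Rightarrow> basis4 \<Rightarrow> basis4 terms" where
  "V\<beta>_act s \<Delta> \<Lambda> \<alpha> \<beta> (L (Suc 0)) v01 = [(cst (- (s / 2) * \<beta>), v01)]"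
| "V\<beta>_act s \<Delta> \<Lambda> \<alpha> \<beta> (L (Suc 0)) v02 = [(cst (- (s / 2) * \<beta>), v02), (cst (- (s / 2) * \<beta>) * lam, v01)]"
| "V\<beta>_act s \<Delta> \<Lambda> \<alpha> \<beta> (L (Suc 0)) v11 = [(cst (- (s / 2) * \<beta>), v11)]"
| "V\<beta>_act s \<Delta> \<Lambda> \<alpha> \<beta> (L (Suc 0)) v12 = [(cst (- (s / 2) * \<beta>), v12)]"
| "V\<beta>_act s \<Delta> \<Lambda> \<alpha> \<beta> (J (Suc 0)) v02 = [(cst (s * \<beta>), v01)]"
| "V\<beta>_act s \<Delta> \<Lambda> \<alpha> \<beta> (Gp (Suc 0)) v02 = [(cst \<beta>, v11)]"
| "V\<beta>_act s \<Delta> \<Lambda> \<alpha> \<beta> (Gp (Suc 0)) v12 = [(cst (- \<beta>), v01)]"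
| "V\<beta>_act s \<Delta> \<Lambda> \<alpha> \<beta> (Gm (Suc 0)) v11 = [(cst (- \<beta>), v01)]"
| "V\<beta>_act s \<Delta> \<Lambda> \<alpha> \<beta> (Gm (Suc 0)) v02 = [(cst (- \<beta>), v12)]"
| "V\<beta>_act s \<Delta> \<Lambda> \<alpha> \<beta> g v = V_act 1 s \<Delta> \<Lambda> \<alpha> g v"

definition V\<beta>_mod ::
  "complex \<Rightarrow> complex \<Rightarrow> complex \<Rightarrow> complex \<Rightarrow> complex \<Rightarrow> (basis4 \<Rightarrow>\<^sub>0 complex poly, kelem) conf_mod" where
  "V\<beta>_mod s \<Delta> \<Lambda> \<alpha> \<beta> = free_conf_module parity4 (V\<beta>_act s \<Delta> \<Lambda> \<alpha> \<beta>)"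

end

theory Submission
  imports Defs "HOL-Computational_Algebra.Fundamental_Theorem_Algebra"
begin

text \<open>
  Write \<open>a\<^sub>\<lambda> v\<close> as the sum of \<open>(\<lambda>\<^sup>k / k!) a\<^sub>(\<^sub>k\<^sub>) v\<close>. The operators \<open>a\<^sub>(\<^sub>k\<^sub>)\<close> are graded by the eigenvalues of the
  commutator with \<open>L\<^sub>0\<^sub>(\<^sub>1\<^sub>)\<close>. On a finite irreducible nontrivial module, the vectors killed by all operators
  of large degree form a finite-dimensional space, and an extremal eigenvector of \<open>L\<^sub>0\<^sub>(\<^sub>1\<^sub>)\<close> in it is a highest
  vector \<open>v\<close>: it is killed by all operators of positive degree. The operators \<open>L\<^sub>0\<^sub>(\<^sub>0\<^sub>) + n \<partial>\<close> and \<open>L\<^sub>n\<^sub>(\<^sub>0\<^sub>)\<close> are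
  central, hence scalars. Since the module has finite rank, the powers of \<open>L\<^sub>i\<^sub>(\<^sub>0\<^sub>)\<close> applied to \<open>v\<close> satisfy a
  relation over \<open>\<complex>[\<partial>]\<close>; its top coefficients in \<open>\<lambda>\<close> show that, for \<open>n > 1\<close>, everything of index \<open>i \<ge> 1\<close>
  acts by zero. What is left is the \<open>N = 2\<close> algebra: \<open>v\<close>, \<open>G\<^sup>+v\<close>, \<open>G\<^sup>-v\<close> and \<open>G\<^sup>+G\<^sup>-v\<close> generate the module, which
  is therefore a quotient of a module of rank four. That one is irreducible unless \<open>2 \<Delta> \<plusminus> \<Lambda> = 0\<close> and \<open>\<beta> = 0\<close>,
  in which case \<open>G\<^sup>-v\<close> or \<open>G\<^sup>+v\<close> would be a second highest vector, hence vanishes, and the rank drops to two.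

  The axioms for \<open>k(n)\<close> and for the modules of the list become polynomial identities on substituting complex
  numbers for \<open>\<lambda>\<close>, \<open>\<mu>\<close> and \<open>\<partial>\<close>.
\<close>

text \<open>The obstacle is that the module is infinite-dimensional over \<complex>, so that neither
  eigenvectors nor Schur's lemma come for free. Both are recovered from one observation: applying
  p(\<partial>) to a vector raises the degree in \<lambda> of the action by deg p and only scales
  the top coefficient. A relation over \<complex>[\<partial>], which exists for every family longer
  than the number of generators, thus descends to a relation over \<complex> between top
  coefficients. The finite-dimensional space, the nilpotency of \<open>mode (L i) 0\<close> and the
  absence of torsion all rest on this.

  The two halves of the theorem are linked: the map from a listed free module to the given module is
  surjective because the given module is irreducible, and injective because the listed one is.
  Surjectivity alone is what settles the degenerate parameters.

  The parameters are read off from the highest vector: \<Delta> = -\<theta>/n, where \<theta> is the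
  eigenvalue of \<open>mode (L 0) 1\<close>; \<Lambda> is the eigenvalue of
  \<open>mode (J 0) 0\<close>; and \<beta> = 2 s c, where c is the scalar by which
  \<open>mode (L n) 0\<close> acts.\<close>

abbreviation (input) "keys \<equiv> Poly_Mapping.keys"
abbreviation (input) "lookup \<equiv> Poly_Mapping.lookup"
abbreviation (input) "single \<equiv> Poly_Mapping.single"

abbreviation gen :: "'h \<Rightarrow> ('h \<Rightarrow>\<^sub>0 complex poly)" where "gen h \<equiv> single h 1"

section \<open>Evaluation of polynomials over a free module\<close>

lemma map_poly_additive:
  fixes f :: "'a::ab_group_add \<Rightarrow> 'b::ab_group_add"
  assumes "additive f"
  shows "map_poly f (p + q) = map_poly f p + map_poly f q"
  by (intro poly_eqI) (simp add: coeff_map_poly additive.add[OF assms] additive.zero[OF assms])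

text \<open>A family of additive functionals \<phi> that separates vectors turns an identity between
  polynomials with vector coefficients into identities between complex numbers. Nesting the
  construction handles two formal variables.\<close>

definition eval_poly :: "('a::zero \<Rightarrow> complex) \<Rightarrow> complex \<Rightarrow> 'a poly \<Rightarrow> complex" where
  "eval_poly \<phi> l f = poly (map_poly \<phi> f) l"

lemma additive_eval_poly [intro]:
  fixes \<phi> :: "'a::ab_group_add \<Rightarrow> complex"
  assumes "additive \<phi>"
  shows "additive (eval_poly \<phi> l)"
  by unfold_locales (simp add: eval_poly_def map_poly_additive assms)

lemma eval_poly_altdef:
  assumes "\<phi> 0 = 0"
  shows "eval_poly \<phi> l f = (\<Sum>k\<le>degree f. \<phi> (coeff f k) * l ^ k)"
proof -
  have "degree (map_poly \<phi> f) \<le> degree f"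
    by (simp add: degree_le coeff_map_poly assms coeff_eq_0)
  then show ?thesis
    unfolding eval_poly_def poly_altdef
    by (subst sum.mono_neutral_left[of "{..degree f}"])
       (auto simp: coeff_map_poly assms coeff_eq_0 intro!: sum.cong)
qed

lemma eval_poly_pCons [simp]:
  "\<phi> 0 = 0 \<Longrightarrow> eval_poly \<phi> l (pCons c f) = \<phi> c + l * eval_poly \<phi> l f"
  by (simp add: eval_poly_def map_poly_pCons)

lemma eval_poly_0 [simp]: "eval_poly \<phi> l 0 = 0"
  by (simp add: eval_poly_def)

lemma eval_poly_map_poly:
  "\<phi> 0 = 0 \<Longrightarrow> g 0 = 0 \<Longrightarrow> eval_poly \<phi> l (map_poly g f) = eval_poly (\<lambda>v. \<phi> (g v)) l f"
  by (simp add: eval_poly_def map_poly_map_poly o_def)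

lemma eval_poly_scale: "\<phi> 0 = 0 \<Longrightarrow> eval_poly (\<lambda>v. c * \<phi> v) l f = c * eval_poly \<phi> l f"
  by (simp add: eval_poly_altdef sum_distrib_left algebra_simps)

lemma eval_poly_sum:
  "(\<And>i. i \<in> I \<Longrightarrow> \<phi> i 0 = 0) \<Longrightarrow> eval_poly (\<lambda>v. \<Sum>i\<in>I. \<phi> i v) l f = (\<Sum>i\<in>I. eval_poly (\<phi> i) l f)"
  by (simp add: eval_poly_altdef sum_distrib_right sum.swap[of _ I])

lemma eval_poly_cong:
  assumes "\<And>k. \<phi> (coeff f k) = \<psi> (coeff f k)" "\<phi> 0 = 0" "\<psi> 0 = 0"
  shows "eval_poly \<phi> l f = eval_poly \<psi> l f"
  by (simp add: eval_poly_altdef assms)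

text \<open>An evaluation under which the operator \<open>X\<close> becomes multiplication by the
  number \<open>z\<close> turns substitution of \<open>X\<close> into evaluation at
  \<open>z\<close>. In this way the operators for \<lambda>, \<mu>, \<lambda> + \<mu> and -\<lambda>
  - \<partial> in the axioms are replaced by numbers.\<close>

lemma subst_op_eval:
  fixes \<psi> :: "'n::ab_group_add \<Rightarrow> complex"
  assumes "additive \<psi>" "\<And>F. \<psi> (X F) = z * \<psi> F" "\<iota> 0 = 0"
  shows "\<psi> (subst_op X \<iota> f) = eval_poly (\<lambda>v. \<psi> (\<iota> v)) z f"
proof -
  have "\<psi> ((X ^^ k) F) = z ^ k * \<psi> F" for k F
    by (induction k) (simp_all add: assms)
  then show ?thesis
    by (simp add: subst_op_def additive.sum[OF assms(1)] eval_poly_altdef assms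
        additive.zero[OF assms(1)] mult.commute)
qed

definition point_eval :: "complex \<Rightarrow> 'h \<Rightarrow> ('h \<Rightarrow>\<^sub>0 complex poly) \<Rightarrow> complex" where
  "point_eval x h v = poly (lookup v h) x"

abbreviation eval1 :: "complex \<Rightarrow> complex \<Rightarrow> 'h \<Rightarrow> ('h \<Rightarrow>\<^sub>0 complex poly) poly \<Rightarrow> complex" where
  "eval1 l x h \<equiv> eval_poly (point_eval x h) l"

abbreviation eval2 ::
  "complex \<Rightarrow> complex \<Rightarrow> complex \<Rightarrow> 'h \<Rightarrow> ('h \<Rightarrow>\<^sub>0 complex poly) poly poly \<Rightarrow> complex" where
  "eval2 l m x h \<equiv> eval_poly (eval1 l x h) m"

lemma additive_point_eval [intro]: "additive (point_eval x h)"
  by unfold_locales (simp add: point_eval_def lookup_add)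

lemma point_eval_0 [simp]: "point_eval x h 0 = 0"
  by (simp add: point_eval_def)

lemma poly_eqI_eval: "(\<And>x. poly p x = poly q x) \<Longrightarrow> p = (q :: complex poly)"
  by (metis ext poly_eq_poly_eq_iff)

text \<open>\<complex>[\<partial>] is an integral domain, and a nonzero polynomial over it cannot
  have all of the infinitely many constants \<open>[:l:]\<close> as roots.\<close>

lemma poly_poly_eqI:
  fixes F G :: "complex poly poly"
  assumes "\<And>l x. poly (poly F [:l:]) x = poly (poly G [:l:]) x"
  shows "F = G"
proof (rule ccontr)
  assume "F \<noteq> G"
  then have "finite {y. poly (F - G) y = 0}" by (intro poly_roots_finite) simp
  moreover have "poly F [:l:] = poly G [:l:]" for l by (rule poly_eqI_eval) (rule assms)
  then have "range (\<lambda>l::complex. [:l:]) \<subseteq> {y. poly (F - G) y = 0}" by auto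
  moreover have "infinite (range (\<lambda>l::complex. [:l:]))"
    using finite_imageD[of "\<lambda>l::complex. [:l:]" UNIV] infinite_UNIV_char_0[where 'a=complex]
    by (auto simp: inj_on_def)
  ultimately show False using finite_subset by blast
qed

lemma eval_poly_inject:
  fixes \<phi> :: "'i \<Rightarrow> 'a::ab_group_add \<Rightarrow> complex"
  assumes "\<And>i. additive (\<phi> i)" "\<And>a b. (\<And>i. \<phi> i a = \<phi> i b) \<Longrightarrow> a = b"
    "\<And>i l. eval_poly (\<phi> i) l f = eval_poly (\<phi> i) l g"
  shows "f = g"
proof (intro poly_eqI assms(2))
  fix n i
  have "map_poly (\<phi> i) f = map_poly (\<phi> i) g"
    by (rule poly_eqI_eval) (use assms(3) in \<open>simp add: eval_poly_def\<close>)
  then have "coeff (map_poly (\<phi> i) f) n = coeff (map_poly (\<phi> i) g) n" by simp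
  then show "\<phi> i (coeff f n) = \<phi> i (coeff g n)"
    by (simp add: coeff_map_poly additive.zero[OF assms(1)])
qed

lemma point_eval_inject: "(\<And>x h. point_eval x h v = point_eval x h w) \<Longrightarrow> v = w"
  by (rule poly_mapping_eqI, rule poly_eqI_eval) (simp add: point_eval_def)

lemma eval1_inject:
  assumes "\<And>l x h. eval1 l x h f = eval1 l x h g"
  shows "f = g"
  by (rule eval_poly_inject[of "\<lambda>(x, h). point_eval x h"])
     (use assms in \<open>auto intro!: point_eval_inject\<close>)

lemma eval2_inject:
  assumes "\<And>l m x h. eval2 l m x h f = eval2 l m x h g"
  shows "f = g"
  by (rule eval_poly_inject[of "\<lambda>(l, x, h). eval1 l x h"])
     (use assms in \<open>auto intro!: eval1_inject\<close>)

lemma eval1_coord_0: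
  assumes "\<And>l x. eval1 l x h f = 0"
  shows "lookup (coeff f k) h = 0"
proof (rule poly_eqI_eval)
  fix x
  have "map_poly (point_eval x h) f = 0"
    by (rule poly_eqI_eval) (use assms in \<open>simp add: eval_poly_def\<close>)
  then have "coeff (map_poly (point_eval x h) f) k = 0" by simp
  then show "poly (lookup (coeff f k) h) x = poly 0 x"
    by (simp add: coeff_map_poly point_eval_def)
qed

lemma eval2_lam2: "eval2 l m x h (lam2 F) = l * eval2 l m x h F"
  unfolding lam2_def by (subst eval_poly_map_poly) (simp_all add: eval_poly_scale)

lemma eval2_mu2: "eval2 l m x h (mu2 F) = m * eval2 l m x h F"
  by (simp add: mu2_def)

lemma eval2_const2: "eval2 l m x h (const2 v) = point_eval x h v"
  by (simp add: const2_def)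

lemma additive_eval1: "additive (eval1 l x h)" and additive_eval2: "additive (eval2 l m x h)"
  by blast+

lemmas eval1_add = additive.add[OF additive_eval1]
lemmas eval2_add = additive.add[OF additive_eval2]
lemmas eval1_minus = additive.minus[OF additive_eval1]
lemmas eval1_diff = additive.diff[OF additive_eval1]
lemmas eval2_diff = additive.diff[OF additive_eval2]
lemmas eval1_sum = additive.sum[OF additive_eval1]

lemma eval2_iterated:
  fixes A :: "'r \<Rightarrow> ('h \<Rightarrow>\<^sub>0 complex poly) \<Rightarrow> ('h \<Rightarrow>\<^sub>0 complex poly) poly"
  assumes "\<And>F. eval2 l m x h (X F) = s * eval2 l m x h F"
    and "\<And>F. eval2 l m x h (Y F) = t * eval2 l m x h F" and "A a 0 = 0"
  shows "eval2 l m x h (iterated A X a Y b v) = eval_poly (\<lambda>w. eval1 s x h (A a w)) t (A b v)"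
proof -
  have *: "eval2 l m x h (subst_op X const2 f) = eval1 s x h f" for f
    by (subst subst_op_eval[OF additive_eval2 assms(1)]) (simp_all add: eval2_const2, simp add: const2_def)
  show ?thesis
    unfolding iterated_def
    by (subst subst_op_eval[OF additive_eval2 assms(2)]) (simp_all add: * assms(3), simp add: subst_op_def const2_def)
qed

lemma eval2_bracketed:
  fixes A :: "'r::zero \<Rightarrow> ('h \<Rightarrow>\<^sub>0 complex poly) \<Rightarrow> ('h \<Rightarrow>\<^sub>0 complex poly) poly"
  assumes "A 0 v = 0"
  shows "eval2 l m x h (bracketed B A a b v) = eval_poly (\<lambda>c. eval1 (l + m) x h (A c v)) l (B a b)"
proof -
  have *: "eval2 l m x h (subst_op (\<lambda>F. lam2 F + mu2 F) const2 f) = eval1 (l + m) x h f" for f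
    by (subst subst_op_eval[OF additive_eval2, where z="l+m"])
       (simp_all add: eval2_const2 eval2_add eval2_lam2 eval2_mu2 algebra_simps, simp add: const2_def)
  show ?thesis
    unfolding bracketed_def
    by (subst subst_op_eval[OF additive_eval2 eval2_lam2]) (simp_all add: * assms, simp add: subst_op_def const2_def)
qed

section \<open>Free modules\<close>

lemma lookup_free_scale: "lookup (free_scale p v) h = p * lookup v h"
  unfolding free_scale_def by (simp add: map.rep_eq when_def)

lemma module_free_scale: "module (free_scale :: complex poly \<Rightarrow> ('h \<Rightarrow>\<^sub>0 complex poly) \<Rightarrow> _)"
  by unfold_locales (auto intro!: poly_mapping_eqI simp: lookup_free_scale lookup_add algebra_simps)

lemma point_eval_free_scale: "point_eval x h (free_scale p v) = poly p x * point_eval x h v"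
  by (simp add: point_eval_def lookup_free_scale)

definition term_eval :: "('g \<Rightarrow> 'h \<Rightarrow> 'k terms) \<Rightarrow> 'g \<Rightarrow> 'h \<Rightarrow> complex \<Rightarrow> complex \<Rightarrow> 'k \<Rightarrow> complex" where
  "term_eval tab g h l x k = (\<Sum>(F, w)\<leftarrow>tab g h. if w = k then poly (poly F [:l:]) x else 0)"

lemma poly_poly_eval_at: "poly (poly (eval_at p X) [:l:]) x = poly p (poly (poly X [:l:]) x)"
  unfolding eval_at_def
  by (induction p) (auto simp: map_poly_pCons algebra_simps)

lemma eval1_single:
  "eval1 l x k (map_poly (single w) F) = (if w = k then poly (poly F [:l:]) x else 0)"
proof -
  have "eval1 l x k (map_poly (single w) F) = eval_poly (\<lambda>p. if w = k then poly p x else 0) l F"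
    by (subst eval_poly_map_poly) (auto simp: point_eval_def lookup_single when_def intro!: eval_poly_cong)
  also have "\<dots> = (if w = k then poly (poly F [:l:]) x else 0)"
    by (induction F) auto
  finally show ?thesis .
qed

lemma additive_sum_list:
  "additive f \<Longrightarrow> f (\<Sum>(a, b)\<leftarrow>xs. g a b) = (\<Sum>(a, b)\<leftarrow>xs. f (g a b))"
  by (induction xs) (auto simp: additive.add additive.zero)

text \<open>Arbitrary finite supersets of the supports are allowed, so that the sums for
  \<open>a\<close>, \<open>b\<close> and \<open>a + b\<close> can be compared over one index
  set.\<close>

lemma eval1_ext:
  assumes "finite G" "keys a \<subseteq> G" "finite H" "keys v \<subseteq> H"
  shows "eval1 l x k (sesquilinear_extension tab a v) =
    (\<Sum>g\<in>G. \<Sum>h\<in>H. point_eval (- l) g a * point_eval (x + l) h v * term_eval tab g h l x k)"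
proof -
  have "eval1 l x k (sesquilinear_extension tab a v) = (\<Sum>g\<in>keys a. \<Sum>h\<in>keys v.
      point_eval (- l) g a * point_eval (x + l) h v * term_eval tab g h l x k)"
    unfolding sesquilinear_extension_def eval1_sum additive_sum_list[OF additive_eval1] term_eval_def
    by (auto simp: eval1_single poly_poly_eval_at point_eval_def sum_list_const_mult[symmetric]
        add.commute[of x] if_distrib cong: if_cong intro!: sum.cong arg_cong[where f=sum_list])
  also have "\<dots> = (\<Sum>g\<in>keys a. \<Sum>h\<in>H.
      point_eval (- l) g a * point_eval (x + l) h v * term_eval tab g h l x k)"
    by (intro sum.cong refl sum.mono_neutral_left assms) (auto simp: point_eval_def in_keys_iff)
  also have "\<dots> = (\<Sum>g\<in>G. \<Sum>h\<in>H.
      point_eval (- l) g a * point_eval (x + l) h v * term_eval tab g h l x k)"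
    by (intro sum.mono_neutral_left assms) (auto simp: point_eval_def in_keys_iff)
  finally show ?thesis .
qed

section \<open>Reduction of the axioms to basis elements\<close>

lemma ext_zero_left [simp]: "sesquilinear_extension tab 0 v = 0"
  and ext_zero_right [simp]: "sesquilinear_extension tab a 0 = 0"
  by (simp_all add: sesquilinear_extension_def)

text \<open>The value of \<open>g\<^sub>\<lambda> (g'\<^sub>\<mu> h)\<close> at \<lambda> = l, \<mu>
  = m, \<partial> = x. Moving the outer action past the coefficients of
  \<open>g'\<^sub>\<mu> h\<close> replaces \<partial> by \<partial> + \<lambda>, whence the argument
  \<open>x + l\<close>.\<close>

definition iter_eval ::
  "('g \<Rightarrow> 'h \<Rightarrow> 'h terms) \<Rightarrow> 'g \<Rightarrow> 'g \<Rightarrow> 'h \<Rightarrow> complex \<Rightarrow> complex \<Rightarrow> complex \<Rightarrow> 'h \<Rightarrow> complex" where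
  "iter_eval tab g g' h l m x k = (\<Sum>(F, w)\<leftarrow>tab g' h. poly (poly F [:m:]) (x + l) * term_eval tab g w l x k)"

text \<open>The value of
  \<open>[g\<^sub>\<lambda> g']\<^sub>\<lambda>\<^sub>+\<^sub>\<mu> h\<close>. Inside the bracket
  \<partial> acts as -(\<lambda> + \<mu>), whence the argument \<open>- l - m\<close>.\<close>

definition bracket_eval ::
  "('g \<Rightarrow> 'g \<Rightarrow> 'g terms) \<Rightarrow> ('g \<Rightarrow> 'h \<Rightarrow> 'h terms)
    \<Rightarrow> 'g \<Rightarrow> 'g \<Rightarrow> 'h \<Rightarrow> complex \<Rightarrow> complex \<Rightarrow> complex \<Rightarrow> 'h \<Rightarrow> complex" where
  "bracket_eval B tab g g' h l m x k =
     (\<Sum>(F, c)\<leftarrow>B g g'. poly (poly F [:l:]) (- l - m) * term_eval tab c h (l + m) x k)"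

lemma term_eval_contract:
  assumes "finite H" "snd ` set (tab g h) \<subseteq> H"
  shows "(\<Sum>w\<in>H. term_eval tab g h l x w * f w) = (\<Sum>(F, w)\<leftarrow>tab g h. poly (poly F [:l:]) x * f w)"
proof -
  have "(\<Sum>w\<in>H. (\<Sum>(F, w')\<leftarrow>xs. if w' = w then poly (poly F [:l:]) x else 0) * f w)
      = (\<Sum>(F, w)\<leftarrow>xs. poly (poly F [:l:]) x * f w)" if "snd ` set xs \<subseteq> H" for xs
    using that
    by (induction xs) (auto simp: assms(1) sum.distrib distrib_right if_distrib if_distribR cong: if_cong)
  from this[OF assms(2)] show ?thesis unfolding term_eval_def .
qed

lemma sum_rotate:
  "(\<Sum>h\<in>H. \<Sum>a\<in>A. \<Sum>b\<in>B. f h a b) = (\<Sum>a\<in>A. \<Sum>b\<in>B. \<Sum>h\<in>H. f h a b)"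
  by (rule trans[OF sum.swap]) (rule sum.cong[OF refl sum.swap])

lemma finite_coeff_keys: "finite (\<Union>k. keys (coeff f k))"
proof -
  have "(\<Union>k. keys (coeff f k)) \<subseteq> (\<Union>k\<le>degree f. keys (coeff f k))"
    by (auto simp: in_keys_iff) (metis atMost_iff coeff_eq_0 lookup_zero not_le)
  then show ?thesis by (rule finite_subset) simp
qed

lemma eval_iterated_ext:
  fixes tab :: "'g \<Rightarrow> 'h \<Rightarrow> 'h terms"
  defines "S \<equiv> sesquilinear_extension tab"
  shows "eval_poly (\<lambda>w. eval1 l x k (S a w)) m (S b v) =
    (\<Sum>g\<in>keys a. \<Sum>g'\<in>keys b. \<Sum>h\<in>keys v.
       point_eval (- l) g a * point_eval (- m) g' b * point_eval (x + l + m) h v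
         * iter_eval tab g g' h l m x k)"
proof -
  \<comment> \<open>The supports of the coefficients of \<open>S b v\<close> are needed to expand
    the inner vector, the entries of the table to contract the resulting sum.\<close>
  define H where "H = (\<Union>k. keys (coeff (S b v) k))
    \<union> (\<Union>g\<in>keys b. \<Union>h\<in>keys v. snd ` set (tab g h))"
  have H: "finite H" unfolding H_def by (intro finite_UnI finite_coeff_keys) simp
  have "eval_poly (\<lambda>w. eval1 l x k (S a w)) m (S b v)
      = eval_poly (\<lambda>w. \<Sum>g\<in>keys a. \<Sum>h\<in>H.
          (point_eval (- l) g a * term_eval tab g h l x k) * point_eval (x + l) h w) m (S b v)"
  proof (rule eval_poly_cong)
    fix i
    have "keys (coeff (S b v) i) \<subseteq> H" by (auto simp: H_def)
    then show "eval1 l x k (S a (coeff (S b v) i)) = (\<Sum>g\<in>keys a. \<Sum>h\<in>H.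
          (point_eval (- l) g a * term_eval tab g h l x k) * point_eval (x + l) h (coeff (S b v) i))"
      unfolding S_def by (subst eval1_ext[where G="keys a" and H=H]) (auto simp: H mult_ac)
  qed (simp_all add: S_def)
  also have "\<dots> = (\<Sum>g\<in>keys a. \<Sum>h\<in>H.
          (point_eval (- l) g a * term_eval tab g h l x k) * eval1 m (x + l) h (S b v))"
    by (simp add: eval_poly_sum eval_poly_scale)
  also have "\<dots> = (\<Sum>g\<in>keys a. \<Sum>h\<in>H. \<Sum>g'\<in>keys b. \<Sum>h'\<in>keys v.
          point_eval (- l) g a * point_eval (- m) g' b * point_eval (x + l + m) h' v *
           (term_eval tab g' h' m (x + l) h * term_eval tab g h l x k))"
    unfolding S_def
    by (subst eval1_ext[where G="keys b" and H="keys v"])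
       (auto simp: sum_distrib_left mult_ac intro!: sum.cong)
  also have "\<dots> = (\<Sum>g\<in>keys a. \<Sum>g'\<in>keys b. \<Sum>h'\<in>keys v. \<Sum>h\<in>H.
          point_eval (- l) g a * point_eval (- m) g' b * point_eval (x + l + m) h' v *
           (term_eval tab g' h' m (x + l) h * term_eval tab g h l x k))"
    by (rule sum.cong[OF refl sum_rotate])
  also have "\<dots> = (\<Sum>g\<in>keys a. \<Sum>g'\<in>keys b. \<Sum>h\<in>keys v.
       point_eval (- l) g a * point_eval (- m) g' b * point_eval (x + l + m) h v
         * iter_eval tab g g' h l m x k)"
    unfolding iter_eval_def
    by (intro sum.cong refl, subst sum_distrib_left[symmetric], subst term_eval_contract[OF H])
       (auto simp: H_def)
  finally show ?thesis .
qed

lemma eval_bracketed_ext: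
  fixes tab :: "'g \<Rightarrow> 'h \<Rightarrow> 'h terms" and B :: "'g \<Rightarrow> 'g \<Rightarrow> 'g terms"
  defines "S \<equiv> sesquilinear_extension tab" and "S' \<equiv> sesquilinear_extension B"
  shows "eval_poly (\<lambda>c. eval1 (l + m) x k (S c v)) l (S' a b) =
    (\<Sum>g\<in>keys a. \<Sum>g'\<in>keys b. \<Sum>h\<in>keys v.
       point_eval (- l) g a * point_eval (- m) g' b * point_eval (x + l + m) h v
         * bracket_eval B tab g g' h l m x k)"
proof -
  define H where "H = (\<Union>k. keys (coeff (S' a b) k))
    \<union> (\<Union>g\<in>keys a. \<Union>h\<in>keys b. snd ` set (B g h))"
  have H: "finite H" unfolding H_def by (intro finite_UnI finite_coeff_keys) simp
  have "eval_poly (\<lambda>c. eval1 (l + m) x k (S c v)) l (S' a b)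
      = eval_poly (\<lambda>w. \<Sum>c\<in>H. \<Sum>h\<in>keys v.
          (point_eval (x + l + m) h v * term_eval tab c h (l + m) x k) * point_eval (- l - m) c w) l (S' a b)"
  proof (rule eval_poly_cong)
    fix i
    have "keys (coeff (S' a b) i) \<subseteq> H" by (auto simp: H_def)
    then show "eval1 (l + m) x k (S (coeff (S' a b) i) v) = (\<Sum>c\<in>H. \<Sum>h\<in>keys v.
          (point_eval (x + l + m) h v * term_eval tab c h (l + m) x k) * point_eval (- l - m) c (coeff (S' a b) i))"
      unfolding S_def
      by (subst eval1_ext[where H="keys v" and G=H]) (auto simp: H mult_ac add_ac)
  qed (simp_all add: S_def)
  also have "\<dots> = (\<Sum>c\<in>H. \<Sum>h\<in>keys v.
          (point_eval (x + l + m) h v * term_eval tab c h (l + m) x k) * eval1 l (- l - m) c (S' a b))"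
    by (simp add: eval_poly_sum eval_poly_scale)
  also have "\<dots> = (\<Sum>c\<in>H. \<Sum>h\<in>keys v. \<Sum>g\<in>keys a. \<Sum>g'\<in>keys b.
          point_eval (- l) g a * point_eval (- m) g' b * point_eval (x + l + m) h v *
           (term_eval B g g' l (- l - m) c * term_eval tab c h (l + m) x k))"
    unfolding S'_def
    by (subst eval1_ext[where G="keys a" and H="keys b"])
       (auto simp: sum_distrib_left mult_ac intro!: sum.cong)
  also have "\<dots> = (\<Sum>g\<in>keys a. \<Sum>g'\<in>keys b. \<Sum>h\<in>keys v. \<Sum>c\<in>H.
          point_eval (- l) g a * point_eval (- m) g' b * point_eval (x + l + m) h v *
           (term_eval B g g' l (- l - m) c * term_eval tab c h (l + m) x k))"
    by (rule trans[OF sum.swap trans[OF sum.cong[OF refl sum_rotate] sum_rotate]])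
  also have "\<dots> = (\<Sum>g\<in>keys a. \<Sum>g'\<in>keys b. \<Sum>h\<in>keys v.
       point_eval (- l) g a * point_eval (- m) g' b * point_eval (x + l + m) h v
         * bracket_eval B tab g g' h l m x k)"
    unfolding bracket_eval_def
    by (intro sum.cong refl, subst sum_distrib_left[symmetric], subst term_eval_contract[OF H])
       (auto simp: H_def)
  finally show ?thesis .
qed

text \<open>After evaluation each of the three terms is a sum over the supports of \<open>a\<close>,
  \<open>b\<close> and \<open>v\<close> with the same factor p(-\<lambda>) q(-\<mu>) r(\<partial> +
  \<lambda> + \<mu>), so the identity on triples of basis elements suffices. The Jacobi identity of
  the algebra itself is the case \<open>tab\<close> = \<open>B\<close>.\<close>

lemma ext_jacobi:
  fixes tab :: "'g \<Rightarrow> 'h \<Rightarrow> 'h terms" and B :: "'g \<Rightarrow> 'g \<Rightarrow> 'g terms"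
  assumes jac: "\<And>g g' h l m x k. bracket_eval B tab g g' h l m x k =
      iter_eval tab g g' h l m x k - koszul (par g) (par g') (iter_eval tab g' g h m l x k)"
    and a: "\<And>g. g \<in> keys a \<Longrightarrow> par g = i" and b: "\<And>g. g \<in> keys b \<Longrightarrow> par g = j"
  shows "bracketed (sesquilinear_extension B) (sesquilinear_extension tab) a b v =
      iterated (sesquilinear_extension tab) lam2 a mu2 b v
        - koszul i j (iterated (sesquilinear_extension tab) mu2 b lam2 a v)"
proof (rule eval2_inject)
  fix l m x and k :: 'h
  define it where "it = (\<lambda>g g' h. iter_eval tab g g' h l m x k)"
  define it' where "it' = (\<lambda>g g' h. iter_eval tab g' g h m l x k)"
  define c where "c = (\<lambda>g g' h. point_eval (- l) g a * point_eval (- m) g' b * point_eval (x + l + m) h v)"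
  have 1: "eval2 l m x k (iterated (sesquilinear_extension tab) lam2 a mu2 b v) =
    (\<Sum>g\<in>keys a. \<Sum>g'\<in>keys b. \<Sum>h\<in>keys v. c g g' h * it g g' h)"
    by (subst eval2_iterated[OF eval2_lam2 eval2_mu2]) (simp_all add: eval_iterated_ext c_def it_def)
  have 2: "eval2 l m x k (iterated (sesquilinear_extension tab) mu2 b lam2 a v) =
    (\<Sum>g\<in>keys a. \<Sum>g'\<in>keys b. \<Sum>h\<in>keys v. c g g' h * it' g g' h)"
    by (subst eval2_iterated[OF eval2_mu2 eval2_lam2], simp, subst eval_iterated_ext, subst sum.swap)
       (simp add: c_def it'_def mult_ac add_ac)
  have 3: "eval2 l m x k (koszul i j F) = koszul i j (eval2 l m x k F)" for F
    by (simp add: koszul_def additive.minus[OF additive_eval2])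
  have 4: "koszul i j (sum f A) = (\<Sum>x\<in>A. koszul i j (f x))" for A and f :: "'x \<Rightarrow> complex"
    by (simp add: koszul_def sum_negf)
  have 5: "eval2 l m x k (bracketed (sesquilinear_extension B) (sesquilinear_extension tab) a b v) =
    (\<Sum>g\<in>keys a. \<Sum>g'\<in>keys b. \<Sum>h\<in>keys v.
       c g g' h * bracket_eval B tab g g' h l m x k)"
    unfolding eval2_bracketed[where A="sesquilinear_extension tab", OF ext_zero_left] eval_bracketed_ext c_def ..
  show "eval2 l m x k (bracketed (sesquilinear_extension B) (sesquilinear_extension tab) a b v) =
    eval2 l m x k (iterated (sesquilinear_extension tab) lam2 a mu2 b v
        - koszul i j (iterated (sesquilinear_extension tab) mu2 b lam2 a v))"
    unfolding eval2_diff 1 2 3 4 sum_subtractf[symmetric]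
    unfolding 5
  proof (intro sum.cong refl)
    fix g g' h assume "g \<in> keys a" "g' \<in> keys b"
    then show "c g g' h * bracket_eval B tab g g' h l m x k
      = c g g' h * it g g' h - koszul i j (c g g' h * it' g g' h)"
      unfolding jac it_def it'_def by (simp only: a b koszul_def if_distrib right_diff_distrib mult_minus_right split: if_split) simp
  qed
qed

text \<open>Evaluation turns the substitution of -\<lambda> - \<partial> for \<lambda> into the
  replacement of l by -l - x. This exchanges the two arguments -l and x + l of the coefficient
  polynomials, so that the axiom for basis elements carries over to all elements.\<close>

lemma ext_skew:
  fixes tab :: "'g \<Rightarrow> 'g \<Rightarrow> 'g terms"
  assumes skew: "\<And>g g' l x k. term_eval tab g g' l x k =
      - koszul (par g) (par g') (term_eval tab g' g (- l - x) x k)"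
    and a: "\<And>g. g \<in> keys a \<Longrightarrow> par g = i" and b: "\<And>g. g \<in> keys b \<Longrightarrow> par g = j"
  shows "sesquilinear_extension tab a b =
    - koszul i j (subst_op (\<lambda>f. - pCons 0 f - map_poly (free_scale [:0, 1:]) f) (\<lambda>c. [:c:])
        (sesquilinear_extension tab b a))"
proof (rule eval1_inject)
  fix l x and k :: 'g
  have fs0: "free_scale p 0 = 0" for p by (simp add: poly_mapping_eqI lookup_free_scale)
  have X: "eval1 l x k (- pCons 0 f - map_poly (free_scale [:0, 1:]) f) = (- l - x) * eval1 l x k f" for f
    by (simp add: eval1_diff eval1_minus eval_poly_map_poly fs0 point_eval_free_scale eval_poly_scale algebra_simps)
  have 1: "eval1 l x k (subst_op (\<lambda>f. - pCons 0 f - map_poly (free_scale [:0, 1:]) f) (\<lambda>c. [:c:]) f)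
     = eval1 (- l - x) x k f" for f
  proof -
    have "eval1 l x k (subst_op (\<lambda>f. - pCons 0 f - map_poly (free_scale [:0, 1:]) f) (\<lambda>c. [:c:]) f)
      = eval_poly (\<lambda>v. eval1 l x k [:v:]) (- l - x) f"
    proof (rule subst_op_eval)
      show "additive (eval1 l x k)" by (rule additive_eval1)
    qed (rule X pCons_0_0)+
    also have "(\<lambda>v. eval1 l x k [:v:]) = point_eval x k"
      by (simp add: fun_eq_iff)
    finally show ?thesis .
  qed
  have 2: "eval1 l x k (- koszul i j F) = - koszul i j (eval1 l x k F)" for F
    by (simp add: koszul_def eval1_minus)
  show "eval1 l x k (sesquilinear_extension tab a b) = eval1 l x k (- koszul i j
     (subst_op (\<lambda>f. - pCons 0 f - map_poly (free_scale [:0, 1:]) f) (\<lambda>c. [:c:]) (sesquilinear_extension tab b a)))"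
    unfolding 2 1 eval1_ext[OF finite_keys subset_refl finite_keys subset_refl]
  proof -
    have "- koszul i j (sum f A) = (\<Sum>x\<in>A. - koszul i j (f x))" for A and f :: "'g \<Rightarrow> complex"
      by (simp add: koszul_def sum_negf)
    note neg = this
    have "point_eval (- l) g a * point_eval (x + l) g' b * term_eval tab g g' l x k =
      - koszul i j (point_eval (- (- l - x)) g' b * point_eval (x + (- l - x)) g a * term_eval tab g' g (- l - x) x k)"
      if "g \<in> keys a" "g' \<in> keys b" for g g'
      by (subst skew) (simp add: a b that koszul_def add.commute)
    then show "(\<Sum>g\<in>keys a. \<Sum>h\<in>keys b.
          point_eval (- l) g a * point_eval (x + l) h b * term_eval tab g h l x k) =
      - koszul i j (\<Sum>g\<in>keys b. \<Sum>h\<in>keys a.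
          point_eval (- (- l - x)) g b * point_eval (x + (- l - x)) h a * term_eval tab g h (- l - x) x k)"
      unfolding neg by (subst sum.swap) (simp cong: sum.cong)
  qed
qed

lemma free_scale_zero [simp]: "free_scale p 0 = 0"
  by (simp add: poly_mapping_eqI lookup_free_scale)

lemma keys_free_scale: "keys (free_scale p v) \<subseteq> keys v"
  by (auto simp: in_keys_iff lookup_free_scale)

lemma sum_list_pair_0:
  "(\<And>a b. (a, b) \<in> set xs \<Longrightarrow> f a b = (0::complex)) \<Longrightarrow> (\<Sum>(a, b)\<leftarrow>xs. f a b) = 0"
  by (induction xs) auto

lemma term_eval_eq_0:
  assumes "\<And>F. (F, k) \<notin> set (tab g h)"
  shows "term_eval tab g h l x k = 0"
  unfolding term_eval_def by (rule sum_list_pair_0) (use assms in auto)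

text \<open>The gradings are given by predicates \<open>P\<close> and \<open>Q\<close>, so that the
  bound on indices in \<open>k_alg\<close> and plain parity in the modules are covered
  together.\<close>

lemma ext_sesquilinear:
  fixes R :: "('g \<Rightarrow>\<^sub>0 complex poly, 'y) graded_pmod_scheme"
    and M :: "('h \<Rightarrow>\<^sub>0 complex poly, 'z) graded_pmod_scheme"
  assumes R: "pscale R = free_scale" "grade R = (\<lambda>p. {a. \<forall>g\<in>keys a. P g p})"
    and M: "pscale M = free_scale" "grade M = (\<lambda>p. {v. \<forall>h\<in>keys v. Q h p})"
    and par: "\<And>g h i j F w. P g i \<Longrightarrow> Q h j \<Longrightarrow> (F, w) \<in> set (tab g h) \<Longrightarrow> Q w (i + j)"
  shows "sesquilinear R M (sesquilinear_extension tab)"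
proof -
  let ?S = "sesquilinear_extension tab"
  have ev: "eval1 l x k (?S a v) = (\<Sum>g\<in>G. \<Sum>h\<in>H. point_eval (- l) g a * point_eval (x + l) h v * term_eval tab g h l x k)"
    if "finite G" "keys a \<subseteq> G" "finite H" "keys v \<subseteq> H" for G H l x k a v
    by (rule eval1_ext[OF that])
  have scale: "eval1 l x k (?S (free_scale p a) (free_scale q v)) = poly p (- l) * poly q (x + l) * eval1 l x k (?S a v)"
    for p q a v l x k
  proof -
    show ?thesis
      using keys_free_scale[of p a] keys_free_scale[of q v]
      by (subst (1 2) ev[of "keys a" _ "keys v"])
         (auto simp: point_eval_free_scale sum_distrib_left mult_ac intro!: sum.cong dest: subsetD)
  qed
  have fs1: "free_scale 1 w = w" for w :: "'j \<Rightarrow>\<^sub>0 complex poly"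
    by (simp add: poly_mapping_eqI lookup_free_scale)
  have scaleL: "eval1 l x k (?S (free_scale p a) v) = poly p (- l) * eval1 l x k (?S a v)" for p a v l x k
    using scale[where p=p and q=1] by (simp add: fs1)
  have scaleR: "eval1 l x k (?S a (free_scale q v)) = poly q (x + l) * eval1 l x k (?S a v)" for q a v l x k
    using scale[where p=1 and q=q] by (simp add: fs1)
  have emap: "eval1 l x k (map_poly (free_scale p) f) = poly p x * eval1 l x k f"
    for p l x k and f :: "('h \<Rightarrow>\<^sub>0 complex poly) poly"
    by (simp add: eval_poly_map_poly point_eval_free_scale eval_poly_scale)
  have addL: "?S (a + b) v = ?S a v + ?S b v" for a b v
  proof (rule eval1_inject)
    fix l x k
    let ?G = "keys a \<union> keys b \<union> keys (a + b)"
    show "eval1 l x k (?S (a + b) v) = eval1 l x k (?S a v + ?S b v)"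
      unfolding eval1_add
      by (subst (1 2 3) ev[of ?G _ "keys v"])
         (auto simp: additive.add[OF additive_point_eval] sum.distrib[symmetric] algebra_simps)
  qed
  have addR: "?S a (v + w) = ?S a v + ?S a w" for a v w
  proof (rule eval1_inject)
    fix l x k
    let ?H = "keys v \<union> keys w \<union> keys (v + w)"
    show "eval1 l x k (?S a (v + w)) = eval1 l x k (?S a v + ?S a w)"
      unfolding eval1_add
      by (subst (1 2 3) ev[of "keys a" _ ?H])
         (auto simp: additive.add[OF additive_point_eval] sum.distrib[symmetric] algebra_simps)
  qed
  have c1: "?S (cscale R c a) v = map_poly (cscale M c) (?S a v)"
    and c2: "?S a (cscale M c v) = map_poly (cscale M c) (?S a v)" for a v c
    unfolding cscale_def R M by (rule eval1_inject; simp add: scaleL scaleR emap)+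
  have d1: "?S (deriv_of R a) v = - pCons 0 (?S a v)" for a v
    unfolding deriv_of_def R by (rule eval1_inject) (simp add: scaleL eval1_minus)
  have d2: "?S a (deriv_of M v) = map_poly (deriv_of M) (?S a v) + pCons 0 (?S a v)" for a v
    unfolding deriv_of_def M
    by (rule eval1_inject) (simp add: scaleR emap eval1_add distrib_right)
  have g: "coeff (?S a v) k \<in> grade M (i + j)" if a: "a \<in> grade R i" and v: "v \<in> grade M j" for a v i j k
  proof -
    have "Q w (i + j)" if w: "w \<in> keys (coeff (?S a v) k)" for w
    proof (rule ccontr)
      assume nQ: "\<not> Q w (i + j)"
      have "eval1 l x w (?S a v) = 0" for l x
      proof -
        have "term_eval tab g h l x w = 0" if "g \<in> keys a" "h \<in> keys v" for g h
          using par[of g i h j _ w] that a v nQ R M by (intro term_eval_eq_0) auto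
        then show ?thesis
          by (subst ev[of "keys a" _ "keys v"]) auto
      qed
      then show False using eval1_coord_0[of w "?S a v" k] w by (simp add: in_keys_iff)
    qed
    then show ?thesis by (simp add: M)
  qed
  show ?thesis
    unfolding sesquilinear_def using addL addR c1 c2 d1 d2 g by simp
qed

lemma free_graded:
  fixes M :: "('h \<Rightarrow>\<^sub>0 complex poly, 'z) graded_pmod_scheme"
  assumes M: "pscale M = free_scale" "grade M = (\<lambda>p. {v. \<forall>h\<in>keys v. Q h p})"
    and Q: "\<And>h. \<not> (Q h 0 \<and> Q h 1)"
  shows "graded_pmodule M"
proof (rule graded_pmodule.intro)
  show "module (pscale M)" by (simp add: M module_free_scale)
  show "module.subspace (pscale M) (grade M i)" for i
    unfolding M module.subspace_def[OF module_free_scale]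
    using keys_add by (auto simp: in_keys_iff lookup_free_scale lookup_add)
  show "grade M 0 \<inter> grade M 1 = {0}"
    using Q by (auto simp: M)
qed

definition restrict_keys :: "('h \<Rightarrow> bool) \<Rightarrow> ('h \<Rightarrow>\<^sub>0 complex poly) \<Rightarrow> ('h \<Rightarrow>\<^sub>0 complex poly)" where
  "restrict_keys P v = (\<Sum>h\<in>{h \<in> keys v. P h}. single h (lookup v h))"

lemma lookup_restrict_keys:
  "lookup (restrict_keys P v) h = (if P h then lookup v h else 0)"
proof -
  have "lookup (restrict_keys P v) h =
    (\<Sum>h'\<in>{h \<in> keys v. P h}. if h' = h then lookup v h else 0)"
    unfolding restrict_keys_def lookup_sum
    by (intro sum.cong refl) (simp add: lookup_single when_def)
  then show ?thesis by (auto simp: in_keys_iff)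
qed

lemma carrier_free_conf_module: "carrier_of (free_conf_module par tab) = UNIV"
proof -
  have "\<exists>x y. v = x + y \<and> x \<in> grade (free_conf_module par tab) 0 \<and> y \<in> grade (free_conf_module par tab) 1" for v
  proof (intro exI conjI)
    show "v = restrict_keys (\<lambda>h. par h = 0) v + restrict_keys (\<lambda>h. par h = 1) v"
      by (rule poly_mapping_eqI) (auto simp: lookup_add lookup_restrict_keys)
  qed (auto simp: free_conf_module_def in_keys_iff lookup_restrict_keys split: if_splits)
  then show ?thesis unfolding carrier_of_def by blast
qed

section \<open>The Lie conformal superalgebra \<open>k(n)\<close>\<close>

abbreviation (input) cn :: "nat \<Rightarrow> complex" where "cn \<equiv> of_nat"

text \<open>Coefficients are written in terms of \<open>n / 2\<close> so that no fractions occur in the identities to be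
  checked.\<close>

definition half :: "nat \<Rightarrow> complex" where "half n = of_nat n / 2"

text \<open>In a pair \<open>(\<phi>, w)\<close>, the number \<open>\<phi> l x\<close> is the coefficient of \<open>w\<close> at \<open>\<lambda> = l\<close> and \<open>\<partial> = x\<close>. Unlike the
  bracket itself, these lists are not cut off at index \<open>n\<close>.\<close>

fun kbracket_values :: "nat \<Rightarrow> kgen \<Rightarrow> kgen \<Rightarrow> ((complex \<Rightarrow> complex \<Rightarrow> complex) \<times> kgen) list" where
  "kbracket_values n (L i) (L j) = [(\<lambda>l x. (cn i - 2 * half n) * x + (cn i + cn j - 4 * half n) * l, L (i + j))]"
| "kbracket_values n (L i) (J j) = [(\<lambda>l x. (cn i - 2 * half n) * x + (cn i + cn j - 2 * half n) * l, J (i + j))]"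
| "kbracket_values n (J i) (L j) = [(\<lambda>l x. cn i * x + (cn i + cn j - 2 * half n) * l, J (i + j))]"
| "kbracket_values n (L i) (Gp j) = [(\<lambda>l x. (cn i - 2 * half n) * x + (cn i + cn j - 3 * half n) * l, Gp (i + j))]"
| "kbracket_values n (L i) (Gm j) = [(\<lambda>l x. (cn i - 2 * half n) * x + (cn i + cn j - 3 * half n) * l, Gm (i + j))]"
| "kbracket_values n (Gp i) (L j) = [(\<lambda>l x. (cn i - half n) * x + (cn i + cn j - 3 * half n) * l, Gp (i + j))]"
| "kbracket_values n (Gm i) (L j) = [(\<lambda>l x. (cn i - half n) * x + (cn i + cn j - 3 * half n) * l, Gm (i + j))]"
| "kbracket_values n (J i) (Gp j) = [(\<lambda>l x. 1, Gp (i + j))]"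
| "kbracket_values n (J i) (Gm j) = [(\<lambda>l x. - 1, Gm (i + j))]"
| "kbracket_values n (Gp i) (J j) = [(\<lambda>l x. - 1, Gp (i + j))]"
| "kbracket_values n (Gm i) (J j) = [(\<lambda>l x. 1, Gm (i + j))]"
| "kbracket_values n (Gp i) (Gm j) = [(\<lambda>l x. (2 * cn i - 2 * half n) * x + 2 * (cn i + cn j - 2 * half n) * l, J (i + j)),
     (\<lambda>l x. 2, L (i + j))]"
| "kbracket_values n (Gm i) (Gp j) = [(\<lambda>l x. - ((2 * cn i - 2 * half n) * x + 2 * (cn i + cn j - 2 * half n) * l), J (i + j)),
     (\<lambda>l x. 2, L (i + j))]"
| "kbracket_values n _ _ = []"

lemma kbracket_kbracket_values:
  "map (\<lambda>(F, w). (\<lambda>l x. poly (poly F [:l:]) x, w)) (kbracket_gen n g h) =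
    (if kindex g + kindex h \<le> n then kbracket_values n g h else [])"
  by (cases g; cases h)
     (auto simp: kbracket_gen_def upto_index_def koszul_def poly_pcompose fun_eq_iff half_def add.commute field_simps)

lemma sum_list_kbracket:
  "(\<Sum>(F, w)\<leftarrow>kbracket_gen n g h. f (\<lambda>l x. poly (poly F [:l:]) x) w) =
    (if kindex g + kindex h \<le> n then \<Sum>(\<phi>, w)\<leftarrow>kbracket_values n g h. f \<phi> w else (0 :: complex))"
proof -
  have "(\<Sum>(F, w)\<leftarrow>kbracket_gen n g h. f (\<lambda>l x. poly (poly F [:l:]) x) w) =
    (\<Sum>(\<phi>, w)\<leftarrow>map (\<lambda>(F, w). (\<lambda>l x. poly (poly F [:l:]) x, w)) (kbracket_gen n g h). f \<phi> w)"
    by (simp add: case_prod_unfold comp_def)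
  then show ?thesis unfolding kbracket_kbracket_values by simp
qed

lemma term_eval_k: "term_eval (kbracket_gen n) g h l x k =
   (if kindex g + kindex h \<le> n then \<Sum>(\<phi>, w)\<leftarrow>kbracket_values n g h. if w = k then \<phi> l x else 0 else 0)"
  unfolding term_eval_def using sum_list_kbracket[where f="\<lambda>\<phi> w. if w = k then \<phi> l x else 0"] .

lemma iter_eval_k: "iter_eval (kbracket_gen n) g g' h l m x k =
   (if kindex g' + kindex h \<le> n then \<Sum>(\<phi>, w)\<leftarrow>kbracket_values n g' h. \<phi> m (x + l) * term_eval (kbracket_gen n) g w l x k else 0)"
  unfolding iter_eval_def
  using sum_list_kbracket[where f="\<lambda>\<phi> w. \<phi> m (x + l) * term_eval (kbracket_gen n) g w l x k"] .

lemma bracket_eval_k: "bracket_eval (kbracket_gen n) tab g g' h l m x k =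
   (if kindex g + kindex g' \<le> n then \<Sum>(\<phi>, w)\<leftarrow>kbracket_values n g g'. \<phi> l (- l - m) * term_eval tab w h (l + m) x k else 0)"
  unfolding bracket_eval_def
  using sum_list_kbracket[where f="\<lambda>\<phi> w. \<phi> l (- l - m) * term_eval tab w h (l + m) x k"] .

lemma kbracket_gen_parity:
  "(F, w) \<in> set (kbracket_gen n g h) \<Longrightarrow> kindex w \<le> n \<and> kparity w = kparity g + kparity h"
  by (cases g; cases h) (auto simp: kbracket_gen_def upto_index_def split: if_splits)

lemma k_skew:
  "term_eval (kbracket_gen n) g h l x k = - koszul (kparity g) (kparity h) (term_eval (kbracket_gen n) h g (- l - x) x k)"
  by (cases g; cases h) (auto simp: term_eval_k koszul_def algebra_simps)

text \<open>The cut-off at index n is compatible with the identity because indices add. If the total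
  index is at most n, no term is truncated and a polynomial identity remains; otherwise each of the
  three terms vanishes.\<close>

lemma k_jacobi:
  "bracket_eval (kbracket_gen n) (kbracket_gen n) g g' h l m x k =
     iter_eval (kbracket_gen n) g g' h l m x k
       - koszul (kparity g) (kparity g') (iter_eval (kbracket_gen n) g' g h m l x k)"
proof (cases "kindex g + kindex g' + kindex h \<le> n")
  case True
  then have *: "kindex g + kindex g' \<le> n" "kindex g + kindex h \<le> n" "kindex g' + kindex h \<le> n" by simp_all
  show ?thesis
    unfolding bracket_eval_k iter_eval_k term_eval_k using True *
    by (cases g; cases g'; cases h; auto simp: koszul_def algebra_simps)
next
  case False
  have ind: "kindex w = kindex g + kindex h" if "(\<phi>, w) \<in> set (kbracket_values n g h)" for \<phi> w g h
    using that by (cases g; cases h) auto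
  have 1: "(\<Sum>(\<phi>, w)\<leftarrow>kbracket_values n g g'. \<phi> l (- l - m) * term_eval (kbracket_gen n) w h (l + m) x k) = 0"
    by (rule sum_list_pair_0) (use False ind in \<open>simp add: term_eval_k\<close>)
  have 2: "(\<Sum>(\<phi>, w)\<leftarrow>kbracket_values n b h. \<phi> m (x + l) * term_eval (kbracket_gen n) a w l x k) = 0"
    if "\<not> kindex a + (kindex b + kindex h) \<le> n" for a b l m
    by (rule sum_list_pair_0) (use that ind in \<open>simp add: term_eval_k\<close>)
  have c1: "\<not> kindex g + (kindex g' + kindex h) \<le> n" and c2: "\<not> kindex g' + (kindex g + kindex h) \<le> n"
    using False by simp_all
  show ?thesis
    unfolding bracket_eval_k iter_eval_k 1 2[OF c1] 2[OF c2] by (simp add: koszul_def)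
qed

lemma k_alg_simps: "pscale (k_alg n) = free_scale"
  "grade (k_alg n) = (\<lambda>p. {a. \<forall>g\<in>keys a. kindex g \<le> n \<and> kparity g = p})"
  "bracket (k_alg n) = sesquilinear_extension (kbracket_gen n)"
  by (simp_all add: k_alg_def)

lemma grade_carrier:
  assumes a: "a \<in> grade (k_alg n) i"
  shows "a \<in> carrier_of (k_alg n)"
proof -
  have z: "0 \<in> grade (k_alg n) j" for j by (simp add: k_alg_simps)
  show ?thesis
  proof (cases "i = 0")
    case True
    then have "a = a + 0 \<and> a \<in> grade (k_alg n) 0 \<and> 0 \<in> grade (k_alg n) 1" using a z by simp
    then show ?thesis unfolding carrier_of_def by blast
  next
    case False
    then have "a = 0 + a \<and> 0 \<in> grade (k_alg n) 0 \<and> a \<in> grade (k_alg n) 1" using a z by simp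
    then show ?thesis unfolding carrier_of_def by blast
  qed
qed

lemma gen_grade: "kindex g \<le> n \<Longrightarrow> gen g \<in> grade (k_alg n) (kparity g)"
  by (simp add: k_alg_simps)

lemma gen_carrier: "kindex g \<le> n \<Longrightarrow> gen g \<in> carrier_of (k_alg n)"
  using gen_grade grade_carrier by blast

lemma k_alg_lie: "lie_conformal_superalgebra (k_alg n)"
proof -
  interpret graded_pmodule "k_alg n"
    by (rule free_graded[OF k_alg_simps(1,2)]) auto
  show ?thesis
  proof (intro lie_conformal_superalgebra.intro lie_conformal_superalgebra_axioms.intro)
    show "graded_pmodule (k_alg n)" by (rule graded_pmodule_axioms)
    show "sesquilinear (k_alg n) (k_alg n) (bracket (k_alg n))"
      unfolding k_alg_simps(3)
      by (rule ext_sesquilinear[OF k_alg_simps(1,2) k_alg_simps(1,2)]) (use kbracket_gen_parity in blast)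
    fix a b i j assume *: "a \<in> grade (k_alg n) i" "b \<in> grade (k_alg n) j"
    show "bracket (k_alg n) a b = - koszul i j (subst_op
       (\<lambda>f. - pCons 0 f - map_poly (deriv_of (k_alg n)) f) (\<lambda>c. [:c:]) (bracket (k_alg n) b a))"
      unfolding k_alg_simps deriv_of_def
      by (rule ext_skew[where par=kparity, OF k_skew]) (use * in \<open>auto simp: k_alg_simps\<close>)
    fix c :: kelem
    have "bracketed (bracket (k_alg n)) (bracket (k_alg n)) a b c =
      iterated (bracket (k_alg n)) lam2 a mu2 b c - koszul i j (iterated (bracket (k_alg n)) mu2 b lam2 a c)"
      unfolding k_alg_simps
      by (rule ext_jacobi[where par=kparity, OF k_jacobi]) (use * in \<open>auto simp: k_alg_simps\<close>)
    then show "iterated (bracket (k_alg n)) lam2 a mu2 b c =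
        bracketed (bracket (k_alg n)) (bracket (k_alg n)) a b c
          + koszul i j (iterated (bracket (k_alg n)) mu2 b lam2 a c)" by simp
  qed
qed

section \<open>Free conformal modules over \<open>k(n)\<close>\<close>

lemma free_conf_module_simps: "pscale (free_conf_module par tab) = free_scale"
  "grade (free_conf_module par tab) = (\<lambda>p. {v. \<forall>h\<in>keys v. par h = p})"
  "act (free_conf_module par tab) = sesquilinear_extension tab"
  by (simp_all add: free_conf_module_def)

lemma free_conformal_module:
  assumes par: "\<And>g h F w. (F, w) \<in> set (tab g h) \<Longrightarrow> par w = kparity g + par h"
    and jac: "\<And>g g' h l m x k. bracket_eval (kbracket_gen n) tab g g' h l m x k =
      iter_eval tab g g' h l m x k - koszul (kparity g) (kparity g') (iter_eval tab g' g h m l x k)"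
  shows "conformal_module (k_alg n) (free_conf_module par tab)"
proof (intro conformal_module.intro conformal_module_axioms.intro k_alg_lie)
  let ?M = "free_conf_module par tab"
  show "graded_pmodule ?M" by (rule free_graded[OF free_conf_module_simps(1,2)]) auto
  show "carrier_of ?M = UNIV" by (rule carrier_free_conf_module)
  show "sesquilinear (k_alg n) ?M (act ?M)"
    unfolding free_conf_module_simps(3)
    by (rule ext_sesquilinear[OF k_alg_simps(1,2) free_conf_module_simps(1,2)]) (use par in blast)
  fix a b i j v assume *: "a \<in> grade (k_alg n) i" "b \<in> grade (k_alg n) j"
  show "bracketed (bracket (k_alg n)) (act ?M) a b v =
    iterated (act ?M) lam2 a mu2 b v - koszul i j (iterated (act ?M) mu2 b lam2 a v)"
    unfolding free_conf_module_simps k_alg_simps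
    by (rule ext_jacobi[where par=kparity, OF jac]) (use * in \<open>auto simp: k_alg_simps\<close>)
qed

lemma free_expand:
  "(\<Sum>h\<in>keys v. free_scale (lookup v h) (gen h)) = v"
proof (rule poly_mapping_eqI)
  fix k
  show "lookup (\<Sum>h\<in>keys v. free_scale (lookup v h) (gen h)) k
    = lookup v k"
    by (auto simp: lookup_sum lookup_free_scale lookup_single when_def in_keys_iff if_distrib cong: if_cong)
qed

lemma free_finite_conf_module:
  assumes "finite (UNIV :: 'h set)"
  shows "finite_conf_module (free_conf_module (par :: 'h \<Rightarrow> bit) tab)"
proof -
  interpret F: module "free_scale :: complex poly \<Rightarrow> ('h \<Rightarrow>\<^sub>0 complex poly) \<Rightarrow> _" by (rule module_free_scale)
  let ?B = "range (\<lambda>h :: 'h. single h (1 :: complex poly))"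
  have "v \<in> F.span ?B" for v
    by (subst free_expand[symmetric]) (intro F.span_sum F.span_scale F.span_base, auto)
  then show ?thesis unfolding finite_conf_module_def free_conf_module_simps
    using assms by (intro exI[of _ ?B]) auto
qed

text \<open>As a polynomial in \<lambda> over \<complex>[\<partial>], p(\<partial> + \<lambda>) has
  degree deg \<open>p\<close> and the constant \<open>lead_coeff p\<close> on top. Of the affine
  factor only the term \<open>A * l\<close> reaches one degree further, so the coefficient found
  there does not involve \<partial>.\<close>

lemma top_coeff:
  assumes "\<And>l x. eval1 l x k f = poly p (x + l) * (A * l + B * x + C)"
  shows "lookup (coeff f (Suc (degree p))) k = [:A * lead_coeff p:]"
proof -
  define P where "P = map_poly (\<lambda>v. lookup v k) f"
  define X where "X = eval_at p (del + lam)"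
  define Q where "Q = X * (cst A * lam + cst B * del + cst C)"
  have "poly (poly P [:l:]) x = eval1 l x k f" for l x
    unfolding P_def by (induction f) (auto simp: map_poly_pCons point_eval_def)
  moreover have "poly (poly Q [:l:]) x = poly p (x + l) * (A * l + B * x + C)" for l x
    by (simp add: Q_def X_def poly_poly_eval_at algebra_simps)
  ultimately have "P = Q"
    by (intro poly_poly_eqI) (simp add: assms)
  have dl: "del + lam = [:[:0, 1:], 1:]" by simp
  have X: "(\<forall>k>degree p. coeff X k = 0) \<and> coeff X (degree p) = [:lead_coeff p:]"
    unfolding X_def dl
  proof (induction p)
    case 0
    then show ?case by (simp add: eval_at_def)
  next
    case (pCons a p)
    have e: "eval_at (pCons a p) [:[:0, 1:], 1:] = cst a + [:[:0, 1:], 1:] * eval_at p [:[:0, 1:], 1:]"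
      by (simp add: eval_at_def map_poly_pCons)
    show ?case
    proof (cases "p = 0")
      case True
      then show ?thesis by (auto simp: eval_at_def map_poly_pCons coeff_pCons split: nat.splits)
    next
      case False
      then show ?thesis using pCons
        unfolding e by (auto simp: coeff_pCons split: nat.splits)
    qed
  qed
  have "coeff Q (Suc (degree p)) = [:A * lead_coeff p:]"
  proof -
    have "Q = smult [:A:] (pCons 0 X) + smult ([:B:] * [:0, 1:] + [:C:]) X"
      by (simp add: Q_def algebra_simps)
    moreover have "coeff X (Suc (degree p)) = 0" using X by simp
    ultimately show ?thesis using X by simp
  qed
  moreover have "coeff P (Suc (degree p)) = lookup (coeff f (Suc (degree p))) k"
    by (simp add: P_def coeff_map_poly)
  ultimately show ?thesis using \<open>P = Q\<close> by simp
qed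

lemma conf_submodule_free:
  assumes "conf_submodule (k_alg n) (free_conf_module par tab) N"
  shows "0 \<in> N" and "v \<in> N \<Longrightarrow> w \<in> N \<Longrightarrow> v + w \<in> N" and "v \<in> N \<Longrightarrow> free_scale p v \<in> N"
    and "kindex g \<le> n \<Longrightarrow> v \<in> N \<Longrightarrow> coeff (sesquilinear_extension tab (gen g) v) k \<in> N"
    and "N \<noteq> {0} \<Longrightarrow> \<exists>i. \<exists>v\<in>N. v \<noteq> 0 \<and> (\<forall>h\<in>keys v. par h = i)"
proof -
  have N: "module.subspace free_scale N"
    and g: "N \<subseteq> {x + y | x y. x \<in> N \<inter> grade (free_conf_module par tab) 0 \<and> y \<in> N \<inter> grade (free_conf_module par tab) 1}"
    and s: "a \<in> carrier_of (k_alg n) \<Longrightarrow> v \<in> N \<Longrightarrow> coeff (sesquilinear_extension tab a v) k \<in> N" for a v k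
    using assms unfolding conf_submodule_def free_conf_module_simps by auto
  show "0 \<in> N" and "v \<in> N \<Longrightarrow> w \<in> N \<Longrightarrow> v + w \<in> N" and "v \<in> N \<Longrightarrow> free_scale p v \<in> N"
    using N unfolding module.subspace_def[OF module_free_scale] by auto
  show "kindex g \<le> n \<Longrightarrow> v \<in> N \<Longrightarrow> coeff (sesquilinear_extension tab (gen g) v) k \<in> N"
    using s gen_carrier by blast
  assume "N \<noteq> {0}"
  with \<open>0 \<in> N\<close> obtain v where v: "v \<in> N" "v \<noteq> 0" by blast
  with g obtain x y where "v = x + y" "x \<in> N" "y \<in> N" "x \<in> grade (free_conf_module par tab) 0" "y \<in> grade (free_conf_module par tab) 1"
    by blast
  then show "\<exists>i. \<exists>v\<in>N. v \<noteq> 0 \<and> (\<forall>h\<in>keys v. par h = i)"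
    using v(2) unfolding free_conf_module_simps by (cases "x = 0") auto
qed

lemma free_submodule_UNIV:
  assumes N: "conf_submodule (k_alg n) (free_conf_module par tab) N"
    and "\<And>h. gen h \<in> N"
  shows "N = UNIV"
proof -
  have "(\<Sum>h\<in>H. free_scale (lookup v h) (gen h)) \<in> N" for v H
    by (induction H rule: infinite_finite_induct) (auto intro: conf_submodule_free[OF N] assms(2))
  then show ?thesis by (metis UNIV_eq_I free_expand)
qed

lemma eval1_act:
  assumes "finite H" "keys v \<subseteq> H"
  shows "eval1 l x k (sesquilinear_extension tab (gen g) v) =
    (\<Sum>h\<in>H. poly (lookup v h) (x + l) * term_eval tab g h l x k)"
  by (subst eval1_ext[of "{g}" _ H]) (auto simp: assms point_eval_def)

text \<open>The coefficient of highest degree in \<lambda> is a nonzero scalar multiple of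
  \<open>gen h\<close>, whatever the polynomial \<open>p\<close> is. This is how a basis vector is
  extracted from an arbitrary nonzero element of a submodule.\<close>

lemma single_top_coeff:
  assumes N: "conf_submodule (k_alg n) (free_conf_module par tab) N" and "kindex g \<le> n" "u \<in> N"
    and ev: "\<And>l x k. eval1 l x k (sesquilinear_extension tab (gen g) u) =
      poly p (x + l) * (A k * l + B k * x + C k)"
    and A: "\<And>k. k \<noteq> h \<Longrightarrow> A k = 0" "A h \<noteq> 0" and "p \<noteq> 0"
  shows "gen h \<in> N"
proof -
  let ?f = "sesquilinear_extension tab (gen g) u" and ?d = "Suc (degree p)"
  have "coeff ?f ?d = single h [:A h * lead_coeff p:]"
    by (rule poly_mapping_eqI) (auto simp: top_coeff[OF ev] lookup_single when_def A)
  then have "free_scale [:inverse (A h * lead_coeff p):] (single h [:A h * lead_coeff p:]) \<in> N"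
    using conf_submodule_free(3,4)[OF N] assms(2,3) by metis
  moreover have "free_scale [:inverse (A h * lead_coeff p):] (single h [:A h * lead_coeff p:])
     = gen h"
    by (rule poly_mapping_eqI) (use A(2) \<open>p \<noteq> 0\<close> in \<open>auto simp: lookup_free_scale lookup_single when_def one_pCons field_simps\<close>)
  ultimately show ?thesis by simp
qed

section \<open>The families of rank two\<close>

lemma UNIV_basis2: "UNIV = {v0, v1}" by (auto, metis basis2.exhaust)
lemma UNIV_basis4: "UNIV = {v01, v02, v11, v12}" by (auto, metis basis4.exhaust)

lemma keys2: "keys v \<subseteq> {v0, v1}" by (metis UNIV_basis2 subset_UNIV)
lemma keys4: "keys v \<subseteq> {v01, v02, v11, v12}" by (metis UNIV_basis4 subset_UNIV)

lemmas eval1_act2 = eval1_act[OF _ keys2, simplified]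
lemmas eval1_act4 = eval1_act[OF _ keys4, simplified]

lemma V1_parity: "(F, w) \<in> set (V1_act n s \<Delta> \<alpha> g h) \<Longrightarrow> parity2 w = kparity g + parity2 h"
  by (cases g; cases h; cases "kindex g") auto

lemma V2_parity: "(F, w) \<in> set (V2_act n s \<Delta> \<alpha> g h) \<Longrightarrow> parity2 w = kparity g + parity2 h"
  by (cases g; cases h; cases "kindex g") auto

lemma V1_nonzero_index: "kindex g \<noteq> 0 \<Longrightarrow> V1_act n s \<Delta> \<alpha> g h = []"
  by (cases g; cases h; cases "kindex g") auto

lemma V2_nonzero_index: "kindex g \<noteq> 0 \<Longrightarrow> V2_act n s \<Delta> \<alpha> g h = []"
  by (cases g; cases h; cases "kindex g") auto

lemma kbracket_values_index: "(\<phi>, w) \<in> set (kbracket_values n g h) \<Longrightarrow> kindex w = kindex g + kindex h"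
  by (cases g; cases h) auto

text \<open>Indices add under the bracket, so once a positive index is involved all three terms of
  the identity vanish.\<close>

lemma module_identity_index_0:
  assumes tab: "\<And>g h. kindex g \<noteq> 0 \<Longrightarrow> tab g h = []"
    and idx: "\<not> (kindex g = 0 \<and> kindex g' = 0)"
  shows "bracket_eval (kbracket_gen n) tab g g' h l m x k =
      iter_eval tab g g' h l m x k - koszul (kparity g) (kparity g') (iter_eval tab g' g h m l x k)"
proof -
  have t: "term_eval tab g h l x k = 0" if "kindex g \<noteq> 0" for g h l x k
    using that by (simp add: term_eval_def tab)
  have i: "iter_eval tab a b h l m x k = 0" if "\<not> (kindex a = 0 \<and> kindex b = 0)" for a b l m
    using that by (auto simp: iter_eval_def tab t intro!: sum_list_pair_0)
  have b: "(\<Sum>(\<phi>, w)\<leftarrow>kbracket_values n g g'. \<phi> l (- l - m) * term_eval tab w h (l + m) x k) = 0"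
  proof (rule sum_list_pair_0)
    fix \<phi> w assume "(\<phi>, w) \<in> set (kbracket_values n g g')"
    then have "kindex w \<noteq> 0" using kbracket_values_index idx by fastforce
    then show "\<phi> l (- l - m) * term_eval tab w h (l + m) x k = 0" by (simp add: t)
  qed
  show ?thesis
    using idx i[of g g'] i[of g' g] by (auto simp: bracket_eval_k b koszul_def)
qed

text \<open>Two forms, so that the square of \<open>s\<close> is also reduced inside the
  right-nested products produced by normalisation.\<close>

lemma square_root_rewrite:
  fixes s :: complex
  assumes "s\<^sup>2 = - of_nat n"
  shows "s * s = - (2 * half n)" "s * (s * y) = - (2 * half n * y)"
  using assms by (auto simp: half_def power2_eq_square mult.assoc[symmetric])

lemma V1_identity:
  assumes "s\<^sup>2 = - of_nat n"
  shows "bracket_eval (kbracket_gen n) (V1_act n s \<Delta> \<alpha>) g g' h l m x k =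
      iter_eval (V1_act n s \<Delta> \<alpha>) g g' h l m x k
        - koszul (kparity g) (kparity g') (iter_eval (V1_act n s \<Delta> \<alpha>) g' g h m l x k)"
proof (cases "kindex g = 0 \<and> kindex g' = 0")
  case True
  have n: "of_nat n = 2 * half n" by (simp add: half_def)
  from True show ?thesis
    by (cases g; cases g'; cases h; cases k)
       (simp_all add: bracket_eval_k iter_eval_def term_eval_def koszul_def n
         algebra_simps square_root_rewrite[OF assms])
qed (rule module_identity_index_0[OF V1_nonzero_index])

lemma V2_identity:
  assumes "s\<^sup>2 = - of_nat n"
  shows "bracket_eval (kbracket_gen n) (V2_act n s \<Delta> \<alpha>) g g' h l m x k =
      iter_eval (V2_act n s \<Delta> \<alpha>) g g' h l m x k
        - koszul (kparity g) (kparity g') (iter_eval (V2_act n s \<Delta> \<alpha>) g' g h m l x k)"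
proof (cases "kindex g = 0 \<and> kindex g' = 0")
  case True
  have n: "of_nat n = 2 * half n" by (simp add: half_def)
  from True show ?thesis
    by (cases g; cases g'; cases h; cases k)
       (simp_all add: bracket_eval_k iter_eval_def term_eval_def koszul_def n
         algebra_simps square_root_rewrite[OF assms])
qed (rule module_identity_index_0[OF V2_nonzero_index])

lemma s_nonzero: "s\<^sup>2 = - of_nat n \<Longrightarrow> n \<ge> 1 \<Longrightarrow> s \<noteq> (0::complex)"
  by auto

lemma act_nontrivial:
  assumes "kindex g \<le> n" "term_eval tab g h l x k \<noteq> 0"
  shows "nontrivial_conf_module (k_alg n) (free_conf_module par tab)"
proof -
  let ?g = "gen g :: kelem" and ?h = "gen h"
  have "?g \<in> carrier_of (k_alg n)" using assms(1) by (rule gen_carrier)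
  moreover have "eval1 l x k (sesquilinear_extension tab ?g ?h) \<noteq> 0"
    by (subst eval1_act[of "{h}"]) (use assms in auto)
  then have "sesquilinear_extension tab ?g ?h \<noteq> 0" by auto
  ultimately show ?thesis unfolding nontrivial_conf_module_def free_conf_module_simps by blast
qed

lemma free_nontrivial_finite_irreducible:
  assumes "conformal_module (k_alg n) (free_conf_module par tab)"
    and "finite (UNIV :: 'h set)"
    and "kindex g \<le> n" "term_eval tab g (h :: 'h) l x k \<noteq> 0"
    and "\<And>N. conf_submodule (k_alg n) (free_conf_module par tab) N \<Longrightarrow> N \<noteq> {0} \<Longrightarrow> gen h \<in> N"
    and "\<And>N h'. conf_submodule (k_alg n) (free_conf_module par tab) N \<Longrightarrow> gen h \<in> N \<Longrightarrow>
      gen h' \<in> N"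
  shows "nontrivial_finite_irreducible (k_alg n) (free_conf_module par tab)"
proof -
  have "(UNIV :: ('h \<Rightarrow>\<^sub>0 complex poly) set) \<noteq> {0}"
    using UNIV_I[of "single h (1 :: complex poly)"]
    by (metis singletonD lookup_single_eq lookup_zero one_neq_zero)
  then show ?thesis
    unfolding nontrivial_finite_irreducible_def irreducible_conf_module_def
    using assms act_nontrivial free_finite_conf_module free_submodule_UNIV by metis
qed

lemma all_basis2: "(\<forall>h. P h) \<longleftrightarrow> P v0 \<and> P v1"
  by (metis basis2.exhaust)

lemma all_basis4: "(\<forall>h. P h) \<longleftrightarrow> P v01 \<and> P v02 \<and> P v11 \<and> P v12"
  by (metis basis4.exhaust)

lemma eq_0_lookup: "v = 0 \<longleftrightarrow> (\<forall>h. lookup v h = 0)"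
  by (auto intro: poly_mapping_eqI)

lemma ball_keys: "(\<forall>h\<in>keys v. P h) \<longleftrightarrow> (\<forall>h. lookup v h \<noteq> 0 \<longrightarrow> P h)"
  by (auto simp: in_keys_iff)

lemmas basis2_simps = eq_0_lookup[of v for v :: "basis2 \<Rightarrow>\<^sub>0 complex poly"] ball_keys all_basis2
lemmas basis4_simps = eq_0_lookup[of v for v :: "basis4 \<Rightarrow>\<^sub>0 complex poly"] ball_keys all_basis4

text \<open>The families \<open>V1_mod\<close> and \<open>V2_mod\<close> differ by the exchange of
  \<open>Gp 0\<close> and \<open>Gm 0\<close>, whose roles are played by \<open>a\<close> and
  \<open>b\<close>. A nonzero odd element is sent by \<open>b\<close> to a vector whose top
  coefficient in \<lambda> is a nonzero multiple of \<open>v0\<close>, thanks to \<open>A\<close>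
  \<noteq> 0; an even element is made odd by \<open>a\<close>. In both families \<open>A\<close> is
  4 s \<Delta>, which is where \<Delta> \<noteq> 0 enters.\<close>

lemma rank_two_irreducible:
  assumes conf: "conformal_module (k_alg n) (free_conf_module parity2 tab)"
    and idx: "kindex a \<le> n" "kindex b \<le> n"
    and a: "\<And>l x k. term_eval tab a v0 l x k = (if k = v1 then s else 0)" "\<And>l x k. term_eval tab a v1 l x k = 0"
    and b: "\<And>l x k. term_eval tab b v0 l x k = 0"
      "\<And>l x k. term_eval tab b v1 l x k = (if k = v0 then A * l + B * x + C else 0)"
    and s: "s \<noteq> 0" and A: "A \<noteq> 0"
  shows "nontrivial_finite_irreducible (k_alg n) (free_conf_module parity2 tab)"
proof (rule free_nontrivial_finite_irreducible)
  show "conformal_module (k_alg n) (free_conf_module parity2 tab)" by (rule conf)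
  show "finite (UNIV :: basis2 set)" by (simp add: UNIV_basis2)
  show "kindex a \<le> n" by (rule idx)
  show "term_eval tab a v0 0 0 v1 \<noteq> 0" using s by (simp add: a)
  fix N assume N: "conf_submodule (k_alg n) (free_conf_module parity2 tab) N"
  show "gen h' \<in> N" if v: "gen v0 \<in> N" for h'
  proof (cases h')
    case v0
    then show ?thesis using v by simp
  next
    case v1
    have "coeff (sesquilinear_extension tab (gen a) (gen v0)) 0 \<in> N"
      using v idx by (intro conf_submodule_free(4)[OF N]) auto
    also have "sesquilinear_extension tab (gen a) (gen v0)
      = [:single v1 [:s:]:]"
      by (rule eval1_inject) (auto simp: eval1_act2 a lookup_single point_eval_def when_def)
    finally have "free_scale [:inverse s:] (single v1 [:s:]) \<in> N"
      by (intro conf_submodule_free(3)[OF N]) simp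
    also have "free_scale [:inverse s:] (single v1 [:s:]) = gen v1"
      by (rule poly_mapping_eqI) (use s in \<open>auto simp: lookup_free_scale lookup_single when_def one_pCons\<close>)
    finally show ?thesis using v1 by simp
  qed
  have odd: "gen v0 \<in> N" if "v \<in> N" "v \<noteq> 0" "\<forall>h\<in>keys v. parity2 h = 1" for v
  proof (rule single_top_coeff[OF N, of b v "lookup v v1"])
    show "eval1 l x k (sesquilinear_extension tab (gen b) v) = poly (lookup v v1) (x + l) *
      ((if k = v0 then A else 0) * l + (if k = v0 then B else 0) * x + (if k = v0 then C else 0))" for l x k
      by (cases k) (auto simp: eval1_act2 b algebra_simps)
    show "lookup v v1 \<noteq> 0"
      using that by (auto simp: basis2_simps)
  qed (use that A idx in auto)
  assume "N \<noteq> {0}"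
  then obtain i v where v: "v \<in> N" "v \<noteq> 0" "\<forall>h\<in>keys v. parity2 h = i"
    using conf_submodule_free(5)[OF N] by blast
  show "gen v0 \<in> N"
  proof (cases "i = 1")
    case True
    with v odd show ?thesis by blast
  next
    case False
    then have p1: "lookup v v1 = 0" using v(3) by (auto simp: basis2_simps)
    have p0: "lookup v v0 \<noteq> 0"
      using v(2) p1 by (auto simp: basis2_simps)
    define f where "f = sesquilinear_extension tab (gen a) v"
    have ev: "eval1 l x k f = (if k = v1 then s * poly (lookup v v0) (x + l) else 0)" for l x k
      unfolding f_def by (cases k) (auto simp: eval1_act2 a p1)
    have "f \<noteq> 0"
    proof
      assume "f = 0"
      then have "poly (lookup v v0) x = 0" for x using ev[of x v1 0] s by simp
      then show False using p0 poly_eqI_eval[of "lookup v v0" 0] by simp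
    qed
    then obtain j where "coeff f j \<noteq> 0" by (metis leading_coeff_0_iff)
    moreover have "coeff f j \<in> N" unfolding f_def using v idx by (intro conf_submodule_free(4)[OF N]) auto
    moreover have "\<forall>h\<in>keys (coeff f j). parity2 h = 1"
      using eval1_coord_0[of v0 f j] ev by (auto simp: basis2_simps)
    ultimately show ?thesis using odd by blast
  qed
qed

lemma V1_irreducible:
  assumes "n \<ge> 1" "s\<^sup>2 = - of_nat n" "\<Delta> \<noteq> 0"
  shows "nontrivial_finite_irreducible (k_alg n) (V1_mod n s \<Delta> \<alpha>)"
  unfolding V1_mod_def
proof (rule rank_two_irreducible[where a="Gp 0" and b="Gm 0" and s=s and A="4 * s * \<Delta>" and B="2 * s" and C="2 * s * \<alpha>"])
  show "conformal_module (k_alg n) (free_conf_module parity2 (V1_act n s \<Delta> \<alpha>))"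
    using V1_parity V1_identity[OF assms(2)] by (rule free_conformal_module)
qed (use s_nonzero[OF assms(2,1)] assms(3) in \<open>auto simp: term_eval_def algebra_simps\<close>)

lemma V2_irreducible:
  assumes "n \<ge> 1" "s\<^sup>2 = - of_nat n" "\<Delta> \<noteq> 0"
  shows "nontrivial_finite_irreducible (k_alg n) (V2_mod n s \<Delta> \<alpha>)"
  unfolding V2_mod_def
proof (rule rank_two_irreducible[where a="Gm 0" and b="Gp 0" and s=s and A="4 * s * \<Delta>" and B="2 * s" and C="2 * s * \<alpha>"])
  show "conformal_module (k_alg n) (free_conf_module parity2 (V2_act n s \<Delta> \<alpha>))"
    using V2_parity V2_identity[OF assms(2)] by (rule free_conformal_module)
qed (use s_nonzero[OF assms(2,1)] assms(3) in \<open>auto simp: term_eval_def algebra_simps\<close>)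

section \<open>The families of rank four\<close>

text \<open>The actions of index one from the four-parameter family, written for every index;
  \<open>W_act\<close> consults them at index one only.\<close>

fun W1_act :: "complex \<Rightarrow> complex \<Rightarrow> kgen \<Rightarrow> basis4 \<Rightarrow> basis4 terms" where
  "W1_act s \<beta> (L _) v02 = [(cst (- (s / 2) * \<beta>), v02), (cst (- (s / 2) * \<beta>) * lam, v01)]"
| "W1_act s \<beta> (L _) v = [(cst (- (s / 2) * \<beta>), v)]"
| "W1_act s \<beta> (J _) v02 = [(cst (s * \<beta>), v01)]"
| "W1_act s \<beta> (Gp _) v02 = [(cst \<beta>, v11)]"
| "W1_act s \<beta> (Gp _) v12 = [(cst (- \<beta>), v01)]"
| "W1_act s \<beta> (Gm _) v11 = [(cst (- \<beta>), v01)]"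
| "W1_act s \<beta> (Gm _) v02 = [(cst (- \<beta>), v12)]"
| "W1_act s \<beta> _ _ = []"

text \<open>The two families of rank four at once: \<open>\<beta> = 0\<close> gives the three-parameter one and \<open>n = 1\<close>
  the four-parameter one.\<close>

definition W_act ::
  "nat \<Rightarrow> complex \<Rightarrow> complex \<Rightarrow> complex \<Rightarrow> complex \<Rightarrow> complex \<Rightarrow> kgen \<Rightarrow> basis4 \<Rightarrow> basis4 terms" where
  "W_act n s \<Delta> \<Lambda> \<alpha> \<beta> g h = (if kindex g = 0 then V_act n s \<Delta> \<Lambda> \<alpha> g h
     else if kindex g = 1 then W1_act s \<beta> g h else [])"

text \<open>Tables are compared by their values, since an entry with coefficient 0 and a missing
  entry are different lists: at \<beta> = 0 the table \<open>W1_act\<close> has such zero entries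
  where \<open>V_act\<close> is empty.\<close>

lemma free_conf_module_cong:
  assumes "\<And>g h l x k. term_eval tab g h l x k = term_eval tab' g h l x k"
  shows "free_conf_module par tab = free_conf_module par tab'"
proof -
  have "sesquilinear_extension tab = sesquilinear_extension tab'"
    by (intro ext eval1_inject)
       (simp add: eval1_ext[OF finite_keys subset_refl finite_keys subset_refl] assms)
  then show ?thesis by (simp add: free_conf_module_def)
qed

lemma V_mod_W: "V_mod n s \<Delta> \<Lambda> \<alpha> = free_conf_module parity4 (W_act n s \<Delta> \<Lambda> \<alpha> 0)"
proof -
  have "term_eval (V_act n s \<Delta> \<Lambda> \<alpha>) g h l x k = term_eval (W_act n s \<Delta> \<Lambda> \<alpha> 0) g h l x k" for g h l x k
    by (cases g; cases h; cases "kindex g") (auto simp: term_eval_def W_act_def)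
  then show ?thesis unfolding V_mod_def by (rule free_conf_module_cong)
qed

lemma V\<beta>_mod_W: "V\<beta>_mod s \<Delta> \<Lambda> \<alpha> \<beta> = free_conf_module parity4 (W_act 1 s \<Delta> \<Lambda> \<alpha> \<beta>)"
proof -
  have *: "V\<beta>_act s \<Delta> \<Lambda> \<alpha> \<beta> g h = W_act 1 s \<Delta> \<Lambda> \<alpha> \<beta> g h" if "kindex g = i" for g h i
  proof (cases i)
    case 0
    then show ?thesis using that by (cases g; cases h) (auto simp: W_act_def)
  next
    case (Suc j)
    then show ?thesis using that by (cases g; cases h; cases j) (auto simp: W_act_def)
  qed
  then have "V\<beta>_act s \<Delta> \<Lambda> \<alpha> \<beta> = W_act 1 s \<Delta> \<Lambda> \<alpha> \<beta>" by (intro ext) blast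
  then show ?thesis by (simp add: V\<beta>_mod_def)
qed

lemma W_parity: "(F, w) \<in> set (W_act n s \<Delta> \<Lambda> \<alpha> \<beta> g h) \<Longrightarrow> parity4 w = kparity g + parity4 h"
  by (cases g; cases h; cases "kindex g") (auto simp: W_act_def split: if_splits)

text \<open>Generators of index above 1 act by zero. If \<beta> = 0, those of index 1 do so too; if
  \<beta> \<noteq> 0, then n = 1, and besides (0, 0) the index pairs (1, 0), (0, 1) and (1, 1) are
  left to compute, the last one with zero bracket.\<close>

lemma W_identity:
  assumes s: "s\<^sup>2 = - of_nat n" and n: "n \<ge> 1" and \<beta>: "n = 1 \<or> \<beta> = 0"
  shows "bracket_eval (kbracket_gen n) (W_act n s \<Delta> \<Lambda> \<alpha> \<beta>) g g' h l m x k =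
      iter_eval (W_act n s \<Delta> \<Lambda> \<alpha> \<beta>) g g' h l m x k
        - koszul (kparity g) (kparity g') (iter_eval (W_act n s \<Delta> \<Lambda> \<alpha> \<beta>) g' g h m l x k)"
proof -
  \<comment> \<open>The action of \<open>L 1\<close> carries the factor s / 2 in front of \<beta>;
    in terms of \<gamma> this fraction disappears.\<close>
  define \<gamma> where "\<gamma> = \<beta> / 2"
  have b: "\<beta> = 2 * \<gamma>" by (simp add: \<gamma>_def)
  define \<eta> where "\<eta> = half n"
  have n2: "of_nat n = 2 * \<eta>" by (simp add: half_def \<eta>_def)
  note sq = square_root_rewrite[OF s, folded \<eta>_def]
  have t: "term_eval (W_act n s \<Delta> \<Lambda> \<alpha> \<beta>) g h l x k = 0" if "kindex g > 1" for g h l x k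
    using that by (simp add: term_eval_def W_act_def)
  consider "kindex g = 0 \<and> kindex g' = 0" | "kindex g > 1 \<or> kindex g' > 1"
    | "kindex g \<le> 1" "kindex g' \<le> 1" "\<not> (kindex g = 0 \<and> kindex g' = 0)"
    by linarith
  then show ?thesis
  proof cases
    case 1
    then show ?thesis
      by (cases g; cases g'; cases h; cases k)
         (simp_all add: bracket_eval_k iter_eval_def term_eval_def koszul_def W_act_def \<eta>_def[symmetric] n2
           algebra_simps sq power2_eq_square)
  next
    case 2
    have i: "iter_eval (W_act n s \<Delta> \<Lambda> \<alpha> \<beta>) a b h l m x k = 0" if "kindex a > 1 \<or> kindex b > 1" for a b l m
      using that by (auto simp: iter_eval_def t intro!: sum_list_pair_0) (simp add: W_act_def)
    have "(\<Sum>(\<phi>, w)\<leftarrow>kbracket_values n g g'. \<phi> l (- l - m) * term_eval (W_act n s \<Delta> \<Lambda> \<alpha> \<beta>) w h (l + m) x k) = 0"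
    proof (rule sum_list_pair_0)
      fix \<phi> w assume "(\<phi>, w) \<in> set (kbracket_values n g g')"
      then have "kindex w > 1" using kbracket_values_index 2 by fastforce
      then show "\<phi> l (- l - m) * term_eval (W_act n s \<Delta> \<Lambda> \<alpha> \<beta>) w h (l + m) x k = 0" by (simp add: t)
    qed
    then show ?thesis using i[of g g'] i[of g' g] 2 by (auto simp: bracket_eval_k koszul_def)
  next
    case 3
    show ?thesis
    proof (cases "\<beta> = 0")
      case True
      have z: "term_eval (W_act n s \<Delta> \<Lambda> \<alpha> \<beta>) g h l x k = 0" if "kindex g \<noteq> 0" for g h l x k
        using that True by (cases g; cases h) (auto simp: term_eval_def W_act_def)
      define U where "U = W_act n s \<Delta> \<Lambda> \<alpha> \<beta>"
      have i: "iter_eval U a b h l m x k = 0" if "kindex a > 0" for a b l m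
        using that by (auto simp: iter_eval_def U_def z intro!: sum_list_pair_0)
      have i': "iter_eval U a b h l m x k = 0" if "kindex b > 0" for a b l m
        using that True by (cases b; cases h) (auto simp: iter_eval_def U_def W_act_def)
      have "(\<Sum>(\<phi>, w)\<leftarrow>kbracket_values n g g'. \<phi> l (- l - m) * term_eval U w h (l + m) x k) = 0"
      proof (rule sum_list_pair_0)
        fix \<phi> w assume "(\<phi>, w) \<in> set (kbracket_values n g g')"
        then have "kindex w \<noteq> 0" using kbracket_values_index 3 by fastforce
        then show "\<phi> l (- l - m) * term_eval U w h (l + m) x k = 0" by (simp add: z U_def)
      qed
      then show ?thesis using i[of g g'] i[of g' g] i'[of g' g] i'[of g g'] 3(3)
        unfolding U_def[symmetric] by (auto simp: bracket_eval_k koszul_def)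
    next
      case False
      then have n1: "n = 1" using \<beta> by blast
      have sq': "s * s = - 1" "s * (s * y) = - y" for y
        using s by (auto simp: n1 power2_eq_square mult.assoc[symmetric])
      have h1: "half (Suc 0) = 1 / 2" by (simp add: half_def)
      consider "kindex g = 1 \<and> kindex g' = 0" | "kindex g = 0 \<and> kindex g' = 1" | "kindex g = 1 \<and> kindex g' = 1"
        using 3 by linarith
      then show ?thesis
      proof cases
        case 1
        then show ?thesis unfolding n1
          by (cases g; cases g'; cases h; cases k)
             (simp_all add: bracket_eval_k iter_eval_def term_eval_def koszul_def W_act_def b h1
               field_simps sq' power2_eq_square)
      next
        case 2
        then show ?thesis unfolding n1
          by (cases g; cases g'; cases h; cases k)
             (simp_all add: bracket_eval_k iter_eval_def term_eval_def koszul_def W_act_def b h1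
               field_simps sq' power2_eq_square)
      next
        case 3
        then show ?thesis unfolding n1
          by (cases g; cases g'; cases h; cases k)
             (simp_all add: bracket_eval_k iter_eval_def term_eval_def koszul_def W_act_def b h1
               field_simps sq' power2_eq_square)
      qed
    qed
  qed
qed

lemma single_top_coeff_const:
  assumes N: "conf_submodule (k_alg n) (free_conf_module par tab) N" and "kindex g \<le> n" "u \<in> N"
    and ev: "\<And>l x k. eval1 l x k (sesquilinear_extension tab (gen g) u) =
      poly p (x + l) * C k"
    and C: "\<And>k. k \<noteq> h \<Longrightarrow> C k = 0" "C h \<noteq> 0" and "p \<noteq> 0"
  shows "gen h \<in> N"
proof -
  let ?f = "sesquilinear_extension tab (gen g) u"
  \<comment> \<open>Multiplying by \<lambda> brings the constant \<open>C k\<close> into the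
    position of the leading constant in \<open>top_coeff\<close>.\<close>
  have "lookup (coeff (pCons 0 ?f) (Suc (degree p))) k = [:C k * lead_coeff p:]" for k
    by (rule top_coeff[where B=0 and C=0]) (simp add: ev)
  then have "coeff ?f (degree p) = single h [:C h * lead_coeff p:]"
    by (intro poly_mapping_eqI) (auto simp: lookup_single when_def C)
  then have "free_scale [:inverse (C h * lead_coeff p):] (single h [:C h * lead_coeff p:]) \<in> N"
    using conf_submodule_free(3,4)[OF N] assms(2,3) by metis
  moreover have "free_scale [:inverse (C h * lead_coeff p):] (single h [:C h * lead_coeff p:])
     = gen h"
    by (rule poly_mapping_eqI) (use C(2) \<open>p \<noteq> 0\<close> in \<open>auto simp: lookup_free_scale lookup_single when_def one_pCons field_simps\<close>)
  ultimately show ?thesis by simp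
qed

text \<open>\<open>v01\<close> generates everything through \<open>Gp 0\<close> and
  \<open>Gm 0\<close>. Conversely an odd element leads back to \<open>v01\<close>: for \<beta> = 0
  the relevant coefficients of \<lambda> are s (2 \<Delta> + \<Lambda>), in \<open>Gp 0\<close> on
  \<open>v12\<close>, and s (2 \<Delta> - \<Lambda>), in \<open>Gm 0\<close> on \<open>v11\<close>,
  which is where the two conditions enter; for \<beta> \<noteq> 0 the odd generators of index one
  produce -\<beta> times \<open>v01\<close>. An even element yields a nonzero odd one under
  \<open>Gp 0\<close> or \<open>Gp 1\<close>.\<close>

lemma W_irreducible:
  assumes n: "n \<ge> 1" and s2: "s\<^sup>2 = - of_nat n" and \<beta>: "n = 1 \<or> \<beta> = 0"
    and ab: "2 * \<Delta> + \<Lambda> \<noteq> 0 \<or> \<beta> \<noteq> 0" "2 * \<Delta> - \<Lambda> \<noteq> 0 \<or> \<beta> \<noteq> 0"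
  shows "nontrivial_finite_irreducible (k_alg n) (free_conf_module parity4 (W_act n s \<Delta> \<Lambda> \<alpha> \<beta>))"
proof (rule free_nontrivial_finite_irreducible)
  let ?t = "W_act n s \<Delta> \<Lambda> \<alpha> \<beta>"
  note te = eval1_act4 term_eval_def W_act_def
  have s: "s \<noteq> 0" by (rule s_nonzero) fact+
  show "conformal_module (k_alg n) (free_conf_module parity4 ?t)"
    using W_parity W_identity[OF s2 n \<beta>] by (rule free_conformal_module)
  show "finite (UNIV :: basis4 set)" by (simp add: UNIV_basis4)
  show "kindex (Gp 0) \<le> n" by simp
  show "term_eval ?t (Gp 0) v01 0 0 v11 \<noteq> 0" using s by (simp add: term_eval_def W_act_def)
  fix N assume N: "conf_submodule (k_alg n) (free_conf_module parity4 ?t) N"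
  show "gen h' \<in> N" if v: "gen v01 \<in> N" for h'
  proof -
    have step: "gen h \<in> N"
      if h: "gen h0 \<in> N" and g: "kindex g = 0"
        and f: "sesquilinear_extension ?t (gen g) (gen h0)
          = [:single h [:s:], w:]" for h h0 g w
    proof -
      have "coeff (sesquilinear_extension ?t (gen g) (gen h0)) 0 \<in> N"
        using h g by (intro conf_submodule_free(4)[OF N]) auto
      then have "free_scale [:inverse s:] (single h [:s:]) \<in> N"
        unfolding f by (intro conf_submodule_free(3)[OF N]) simp
      also have "free_scale [:inverse s:] (single h [:s:]) = gen h"
        by (rule poly_mapping_eqI) (use s in \<open>auto simp: lookup_free_scale lookup_single when_def one_pCons\<close>)
      finally show ?thesis .
    qed
    note ls = lookup_single point_eval_def when_def
    have 11: "gen v11 \<in> N"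
    proof (rule step[OF v])
      show "sesquilinear_extension ?t (gen (Gp 0)) (gen v01)
          = [:single v11 [:s:], 0:]"
        by (rule eval1_inject) (auto simp: te ls)
    qed simp
    have 12: "gen v12 \<in> N"
    proof (rule step[OF v])
      show "sesquilinear_extension ?t (gen (Gm 0)) (gen v01)
          = [:single v12 [:s:], 0:]"
        by (rule eval1_inject) (auto simp: te ls)
    qed simp
    \<comment> \<open>Only the constant coefficient in \<lambda> is used; the term in
      \<open>v01\<close> sits in the coefficient of \<lambda>.\<close>
    have 02: "gen v02 \<in> N"
    proof (rule step[OF 12])
      show "sesquilinear_extension ?t (gen (Gp 0)) (gen v12)
          = [:single v02 [:s:], single v01 [:s * (2 * \<Delta> + \<Lambda>):]:]"
        by (rule eval1_inject) (auto simp: te ls)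
    qed simp
    show ?thesis using v 11 12 02 by (cases h') auto
  qed
  have odd: "gen v01 \<in> N" if v: "v \<in> N" "v \<noteq> 0" "\<forall>h\<in>keys v. parity4 h = 1" for v
  proof -
    let ?p = "lookup v v11" and ?q = "lookup v v12"
    have 0: "lookup v v01 = 0" "lookup v v02 = 0" and pq: "?p \<noteq> 0 \<or> ?q \<noteq> 0"
      using v by (auto simp: basis4_simps)
    show ?thesis
    proof (cases "\<beta> = 0")
      case True
      show ?thesis
      proof (cases "?q = 0")
        case False
        show ?thesis
        \<comment> \<open>The component along \<open>v02\<close> has no factor \<lambda> besides
          those in \<open>?q\<close>, so it drops out of the top coefficient.\<close>
        proof (rule single_top_coeff[OF N, of "Gp 0" v ?q])
          show "eval1 l x k (sesquilinear_extension ?t (gen (Gp 0)) v) = poly ?q (x + l) *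
            ((if k = v01 then s * (2 * \<Delta> + \<Lambda>) else 0) * l + 0 * x + (if k = v02 then s else 0))" for l x k
            by (cases k) (auto simp: te 0 algebra_simps)
        qed (use v s ab True False in auto)
      next
        case q: True
        with pq have "?p \<noteq> 0" by blast
        show ?thesis
        proof (rule single_top_coeff[OF N, of "Gm 0" v ?p])
          show "eval1 l x k (sesquilinear_extension ?t (gen (Gm 0)) v) = poly ?p (x + l) *
            ((if k = v01 then s * (2 * \<Delta> - \<Lambda>) else 0) * l + (if k = v01 then 2 * s else 0) * x
              + (if k = v01 then 2 * s * \<alpha> else if k = v02 then - s else 0))" for l x k
            by (cases k) (auto simp: te 0 algebra_simps)
        qed (use v s ab True \<open>?p \<noteq> 0\<close> in auto)
      qed
    next
      case False
      then have "n = 1" using \<beta> by blast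
      show ?thesis
      proof (cases "?q = 0")
        case q: False
        show ?thesis
        proof (rule single_top_coeff_const[OF N, of "Gp 1" v ?q])
          show "eval1 l x k (sesquilinear_extension ?t (gen (Gp 1)) v) = poly ?q (x + l) *
            (if k = v01 then - \<beta> else 0)" for l x k
            by (cases k) (auto simp: te 0 algebra_simps)
        qed (use v False q \<open>n = 1\<close> in auto)
      next
        case q: True
        with pq have "?p \<noteq> 0" by blast
        show ?thesis
        proof (rule single_top_coeff_const[OF N, of "Gm 1" v ?p])
          show "eval1 l x k (sesquilinear_extension ?t (gen (Gm 1)) v) = poly ?p (x + l) *
            (if k = v01 then - \<beta> else 0)" for l x k
            by (cases k) (auto simp: te 0 algebra_simps)
        qed (use v False \<open>?p \<noteq> 0\<close> \<open>n = 1\<close> in auto)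
      qed
    qed
  qed
  assume "N \<noteq> {0}"
  then obtain i v where v: "v \<in> N" "v \<noteq> 0" "\<forall>h\<in>keys v. parity4 h = i"
    using conf_submodule_free(5)[OF N] by blast
  show "gen v01 \<in> N"
  proof (cases "i = 1")
    case True
    with v odd show ?thesis by blast
  next
    case False
    let ?p = "lookup v v01" and ?q = "lookup v v02"
    have 0: "lookup v v11 = 0" "lookup v v12 = 0" and pq: "?p \<noteq> 0 \<or> ?q \<noteq> 0"
      using v False by (auto simp: basis4_simps)
    have fin: ?thesis if g: "g = Gp 0 \<or> g = Gp 1" "kindex g \<le> n"
      and ne: "eval1 l x v11 (sesquilinear_extension ?t (gen g) v) \<noteq> 0" for g l x
    proof -
      define f where "f = sesquilinear_extension ?t (gen g) v"
      have "f \<noteq> 0" using ne by (auto simp: f_def)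
      then obtain j where "coeff f j \<noteq> 0" by (metis leading_coeff_0_iff)
      moreover have "coeff f j \<in> N" unfolding f_def using v g by (intro conf_submodule_free(4)[OF N]) auto
      moreover have "eval1 l x v01 f = 0" "eval1 l x v02 f = 0" for l x
        unfolding f_def using g(1) by (auto simp: te 0)
      then have "\<forall>h\<in>keys (coeff f j). parity4 h = 1"
        using eval1_coord_0[of v01 f j] eval1_coord_0[of v02 f j] by (simp add: basis4_simps)
      ultimately show ?thesis using odd by blast
    qed
    have e0: "eval1 l x v11 (sesquilinear_extension ?t (gen (Gp 0)) v) =
      s * (poly ?p (x + l) - (2 * \<Delta> + \<Lambda>) * l * poly ?q (x + l))" for l x
      by (auto simp: te 0 algebra_simps)
    have e1: "eval1 l x v11 (sesquilinear_extension ?t (gen (Gp 1)) v) = \<beta> * poly ?q (x + l)" for l x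
      by (auto simp: te 0 algebra_simps)
    have nz: "\<exists>x. poly p x \<noteq> 0" if "p \<noteq> 0" for p :: "complex poly"
      using that poly_eqI_eval[of p 0] by auto
    show ?thesis
    proof (cases "?p = 0")
      case False
      then obtain x where "poly ?p x \<noteq> 0" using nz by blast
      then show ?thesis using fin[of "Gp 0" x 0] e0[of x 0] s by simp
    next
      case True
      then obtain x where x: "poly ?q x \<noteq> 0" using nz pq by blast
      show ?thesis
      proof (cases "\<beta> = 0")
        case True
        \<comment> \<open>With \<open>?p = 0\<close> the value is proportional to (2 \<Delta> +
          \<Lambda>) l and vanishes at l = 0. Taking l = 1 and shifting the other argument to x - 1
          keeps \<open>?q\<close> evaluated at x.\<close>
        then show ?thesis using fin[of "Gp 0" "x - 1" 1] e0[of "x - 1" 1] s x \<open>?p = 0\<close> ab by simp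
      next
        case False
        then show ?thesis using fin[of "Gp 1" x 0] e1[of x 0] x \<beta> by simp
      qed
    qed
  qed
qed

section \<open>Linear algebra\<close>

text \<open>Gaussian elimination by induction on the equations, without division: equation
  \<open>c\<close> with pivot \<open>a j c\<close> eliminates the unknown \<open>j\<close> from the
  others after these are multiplied by the pivot.\<close>

lemma nontrivial_kernel:
  fixes a :: "'i \<Rightarrow> 'b \<Rightarrow> 'r::idom"
  assumes "finite B" "finite I" "card B < card I"
  shows "\<exists>p. (\<exists>i\<in>I. p i \<noteq> 0) \<and> (\<forall>b\<in>B. (\<Sum>i\<in>I. p i * a i b) = 0)"
  using assms
proof (induction B arbitrary: I a rule: finite_induct)
  case empty
  then obtain i where "i \<in> I" by (metis card.empty less_irrefl ex_in_conv)
  then show ?case by (intro exI[of _ "\<lambda>_. 1"]) auto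
next
  case (insert c B)
  show ?case
  proof (cases "\<forall>i\<in>I. a i c = 0")
    case True
    have "card B < card I" using insert by simp
    with insert obtain p where "\<exists>i\<in>I. p i \<noteq> 0" "\<forall>b\<in>B. (\<Sum>i\<in>I. p i * a i b) = 0" by blast
    then show ?thesis using True by (intro exI[of _ p]) auto
  next
    case False
    then obtain j where j: "j \<in> I" "a j c \<noteq> 0" by blast
    let ?I = "I - {j}"
    have "card B < card ?I" using insert j by simp
    with insert.IH[of ?I "\<lambda>i b. a j c * a i b - a i c * a j b"] insert.prems
    obtain p where p: "\<exists>i\<in>?I. p i \<noteq> 0" "\<forall>b\<in>B. (\<Sum>i\<in>?I. p i * (a j c * a i b - a i c * a j b)) = 0"
      by auto
    \<comment> \<open>Back-substitution: the solution of the smaller system scaled by the pivot,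
      with the value at \<open>j\<close> chosen to satisfy equation \<open>c\<close>.\<close>
    define q where "q = (\<lambda>i. if i = j then - (\<Sum>i\<in>?I. p i * a i c) else a j c * p i)"
    have q: "(\<Sum>i\<in>I. q i * a i b) = (\<Sum>i\<in>?I. p i * (a j c * a i b - a i c * a j b))" for b
    proof -
      have "(\<Sum>i\<in>I. q i * a i b) = q j * a j b + (\<Sum>i\<in>?I. q i * a i b)"
        using j insert.prems by (simp add: sum.remove)
      also have "(\<Sum>i\<in>?I. q i * a i b) = (\<Sum>i\<in>?I. a j c * p i * a i b)"
        by (intro sum.cong) (auto simp: q_def)
      also have "q j * a j b = (\<Sum>i\<in>?I. - (p i * a i c * a j b))"
        by (simp add: q_def sum_distrib_right sum_negf)
      finally show ?thesis by (simp add: sum.distrib[symmetric] algebra_simps)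
    qed
    have "\<forall>b\<in>insert c B. (\<Sum>i\<in>I. q i * a i b) = 0"
      using p(2) by (auto simp: q mult.commute)
    moreover have "\<exists>i\<in>I. q i \<noteq> 0" using p(1) j by (auto simp: q_def)
    ultimately show ?thesis by blast
  qed
qed

section \<open>Eigenvectors and finite-dimensionality without a basis\<close>

locale complex_vector_space = vector_space scale for scale :: "complex \<Rightarrow> 'b::ab_group_add \<Rightarrow> 'b"
begin

definition poly_apply :: "('b \<Rightarrow> 'b) \<Rightarrow> complex poly \<Rightarrow> 'b \<Rightarrow> 'b" where
  "poly_apply T p v = (\<Sum>k\<le>degree p. scale (coeff p k) ((T ^^ k) v))"

lemma poly_apply_bound:
  assumes "degree p \<le> N"
  shows "poly_apply T p v = (\<Sum>k\<le>N. scale (coeff p k) ((T ^^ k) v))"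
  unfolding poly_apply_def
  by (rule sum.mono_neutral_left) (use assms in \<open>auto simp: coeff_eq_0\<close>)

text \<open>Apply \<open>T\<close> minus its eigenvalue at \<open>j\<close> to the relation: the
  term \<open>x j\<close> disappears and the others are scaled by nonzero numbers, so the induction
  hypothesis applies.\<close>

lemma sum_eigenvectors_zero:
  assumes T: "\<And>v w. T (v + w) = T v + T w" "\<And>c v. T (scale c v) = scale c (T v)"
    and "finite I" "inj_on \<theta> I" "\<And>i. i \<in> I \<Longrightarrow> T (x i) = scale (\<theta> i) (x i)" "(\<Sum>i\<in>I. x i) = 0" "i \<in> I"
  shows "x i = 0"
  using assms(3-)
proof (induction I arbitrary: x i rule: finite_induct)
  case empty
  then show ?case by simp
next
  case (insert j I)
  have T0: "T 0 = 0" using T(2)[of 0 0] by simp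
  have Ts: "T (sum f A) = (\<Sum>a\<in>A. T (f a))" for f :: "'c \<Rightarrow> 'b" and A
    by (induction A rule: infinite_finite_induct) (auto simp: T0 T)
  have sum: "x j + (\<Sum>i\<in>I. x i) = 0" using insert by simp
  have "0 = T (x j + (\<Sum>i\<in>I. x i)) - scale (\<theta> j) (x j + (\<Sum>i\<in>I. x i))"
    unfolding sum T0 by simp
  also have "\<dots> = (\<Sum>i\<in>I. scale (\<theta> i - \<theta> j) (x i))"
    using insert.prems by (simp add: T(1) Ts scale_right_distrib scale_sum_right scale_left_diff_distrib sum_subtractf)
  finally have 0: "(\<Sum>i\<in>I. scale (\<theta> i - \<theta> j) (x i)) = 0" by simp
  have "scale (\<theta> i - \<theta> j) (x i) = 0" if "i \<in> I" for i
  proof (rule insert.IH[OF _ _ 0 that])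
    show "inj_on \<theta> I" using insert.prems by simp
    show "T (scale (\<theta> i - \<theta> j) (x i)) = scale (\<theta> i) (scale (\<theta> i - \<theta> j) (x i))" if "i \<in> I" for i
      using insert.prems that by (simp add: T(2) mult.commute)
  qed
  moreover have "\<theta> i \<noteq> \<theta> j" if "i \<in> I" for i
    using insert that by (auto simp: inj_on_def)
  ultimately have z: "x i = 0" if "i \<in> I" for i using that by simp
  then have "x j = 0" using sum by simp
  with z show ?case using insert.prems by auto
qed

text \<open>Finite-dimensionality in the form that a bound on the rank supplies. Indexed families
  rather than sets make a repeated vector count as a dependence.\<close>

definition fin_dep :: "'b set \<Rightarrow> bool" where
  "fin_dep W \<longleftrightarrow> (\<exists>r. \<forall>f::nat \<Rightarrow> 'b. (\<forall>j\<le>r. f j \<in> W) \<longrightarrow>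
     (\<exists>c. (\<exists>j\<le>r. c j \<noteq> 0) \<and> (\<Sum>j\<le>r. scale (c j) (f j)) = 0))"

lemma fin_dep_subset: "fin_dep W \<Longrightarrow> W' \<subseteq> W \<Longrightarrow> fin_dep W'"
  unfolding fin_dep_def by (meson subset_iff)

text \<open>Eigenvectors for distinct eigenvalues are independent, so infinitely many eigenvalues
  would give independent families of every length.\<close>

lemma finite_eigenvalues:
  assumes T: "\<And>v w. T (v + w) = T v + T w" "\<And>c v. T (scale c v) = scale c (T v)"
    and "fin_dep W"
  shows "finite {\<theta>. \<exists>w\<in>W. w \<noteq> 0 \<and> T w = scale \<theta> w}" (is "finite ?E")
proof (rule ccontr)
  assume "infinite ?E"
  obtain r where r: "\<And>f::nat \<Rightarrow> 'b. (\<forall>j\<le>r. f j \<in> W) \<Longrightarrow>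
     (\<exists>c. (\<exists>j\<le>r. c j \<noteq> 0) \<and> (\<Sum>j\<le>r. scale (c j) (f j)) = 0)"
    using \<open>fin_dep W\<close> unfolding fin_dep_def by blast
  obtain \<theta> :: "nat \<Rightarrow> complex" where \<theta>: "inj \<theta>" "range \<theta> \<subseteq> ?E"
    using \<open>infinite ?E\<close> infinite_countable_subset by blast
  then have "\<forall>j. \<exists>w\<in>W. w \<noteq> 0 \<and> T w = scale (\<theta> j) w" by blast
  then obtain f where f: "\<And>j. f j \<in> W" "\<And>j. f j \<noteq> 0" "\<And>j. T (f j) = scale (\<theta> j) (f j)" by metis
  from r[of f] f(1) obtain c j where c: "j \<le> r" "c j \<noteq> 0" "(\<Sum>j\<le>r. scale (c j) (f j)) = 0" by blast
  have "scale (c j) (f j) = 0"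
  proof (rule sum_eigenvectors_zero[OF T _ _ _ c(3)])
    show "inj_on \<theta> {..r}" using \<theta>(1) by (auto simp: inj_on_def)
    show "T (scale (c i) (f i)) = scale (\<theta> i) (scale (c i) (f i))" for i
      by (simp add: T f mult.commute)
  qed (use c in auto)
  then show False using c f(2) by simp
qed

end

lemma (in complex_vector_space) poly_apply_root:
  assumes T: "\<And>v w. T (v + w) = T v + T w" "\<And>c v. T (scale c v) = scale c (T v)"
  shows "poly_apply T ([:- \<theta>, 1:] * q) v = T (poly_apply T q v) - scale \<theta> (poly_apply T q v)"
proof -
  have T0: "T 0 = 0" using T(2)[of 0 0] by simp
  have Ts: "T (sum f A) = (\<Sum>a\<in>A. T (f a))" for f :: "nat \<Rightarrow> 'b" and A
    by (induction A rule: infinite_finite_induct) (auto simp: T0 T)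
  have eq: "[:- \<theta>, 1:] * q = pCons 0 q - smult \<theta> q" by simp
  let ?N = "Suc (degree q)"
  have "degree ([:- \<theta>, 1:] * q) \<le> ?N"
    by (rule order_trans[OF degree_mult_le]) simp
  then have "poly_apply T ([:- \<theta>, 1:] * q) v
    = (\<Sum>k\<le>?N. scale (coeff (pCons 0 q) k) ((T ^^ k) v)) - scale \<theta> (\<Sum>k\<le>?N. scale (coeff q k) ((T ^^ k) v))"
    by (simp add: poly_apply_bound eq scale_left_diff_distrib sum_subtractf scale_sum_right
        scale_right_diff_distrib del: sum.atMost_Suc)
  also have "(\<Sum>k\<le>?N. scale (coeff q k) ((T ^^ k) v)) = poly_apply T q v"
    by (rule poly_apply_bound[symmetric]) simp
  also have "(\<Sum>k\<le>?N. scale (coeff (pCons 0 q) k) ((T ^^ k) v)) = T (poly_apply T q v)"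
    by (simp add: sum.atMost_Suc_shift poly_apply_def Ts T del: sum.atMost_Suc)
  finally show ?thesis .
qed

text \<open>The iterates of \<open>T\<close> on \<open>w\<close> are dependent, so p(T) w = 0 for
  some p \<noteq> 0. Roots of p are split off one at a time; as soon as the remaining factor q
  satisfies q(T) w \<noteq> 0, this vector is an eigenvector for the root just removed.\<close>

lemma eigenvector_exists:
  fixes scale :: "complex \<Rightarrow> 'b::ab_group_add \<Rightarrow> 'b"
  assumes vs: "complex_vector_space scale"
    and T: "\<And>v w. T (v + w) = T v + T w" "\<And>c v. T (scale c v) = scale c (T v)"
    and W: "0 \<in> W" "\<And>v w. v \<in> W \<Longrightarrow> w \<in> W \<Longrightarrow> v + w \<in> W" "\<And>c v. v \<in> W \<Longrightarrow> scale c v \<in> W"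
      "\<And>v. v \<in> W \<Longrightarrow> T v \<in> W"
    and fd: "complex_vector_space.fin_dep scale W" and w: "w \<in> W" "w \<noteq> 0"
  shows "\<exists>\<theta>. \<exists>v\<in>W. v \<noteq> 0 \<and> T v = scale \<theta> v"
proof -
  interpret complex_vector_space scale by fact
  have pw: "(T ^^ k) v \<in> W" if "v \<in> W" for k v by (induction k) (use that W in auto)
  have sumW: "sum f A \<in> W" if "\<And>a. a \<in> A \<Longrightarrow> f a \<in> W" for f :: "nat \<Rightarrow> 'b" and A
    using that by (induction A rule: infinite_finite_induct) (auto simp: W)
  have *: "\<exists>\<theta>. \<exists>v\<in>W. v \<noteq> 0 \<and> T v = scale \<theta> v"
    if "p \<noteq> 0" "poly_apply T p w = 0" for p
    using that
  proof (induction "degree p" arbitrary: p rule: less_induct)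
    case less
    show ?case
    proof (cases "degree p = 0")
      case True
      then obtain a where "p = [:a:]" by (metis degree_eq_zeroE)
      with less w show ?thesis by (simp add: poly_apply_def)
    next
      case False
      then obtain \<theta> where "poly p \<theta> = 0"
        using fundamental_theorem_of_algebra[of p] constant_degree[of p] by auto
      then obtain q where q: "p = [:- \<theta>, 1:] * q" by (auto simp: poly_eq_0_iff_dvd dvd_def)
      with less.prems have "q \<noteq> 0" by auto
      then have "degree p = Suc (degree q)" unfolding q by (subst degree_mult_eq) auto
      show ?thesis
      proof (cases "poly_apply T q w = 0")
        case True
        then show ?thesis using less.hyps[of q] \<open>q \<noteq> 0\<close> \<open>degree p = Suc (degree q)\<close> by simp
      next
        case False
        moreover have "T (poly_apply T q w) = scale \<theta> (poly_apply T q w)"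
          using less.prems(2) unfolding q poly_apply_root[OF T] by simp
        moreover have "poly_apply T q w \<in> W"
          unfolding poly_apply_def by (intro sumW W pw w)
        ultimately show ?thesis by blast
      qed
    qed
  qed
  obtain r where r: "\<And>f::nat \<Rightarrow> 'b. (\<forall>j\<le>r. f j \<in> W) \<Longrightarrow>
     (\<exists>c. (\<exists>j\<le>r. c j \<noteq> 0) \<and> (\<Sum>j\<le>r. scale (c j) (f j)) = 0)"
    using fd unfolding fin_dep_def by blast
  from r[of "\<lambda>j. (T ^^ j) w"] obtain c where c: "\<exists>j\<le>r. c j \<noteq> 0" "(\<Sum>j\<le>r. scale (c j) ((T ^^ j) w)) = 0"
    using pw w by blast
  define p where "p = (\<Sum>j\<le>r. monom (c j) j)"
  have cp: "coeff p k = (if k \<le> r then c k else 0)" for k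
    by (simp add: p_def coeff_sum)
  have "degree p \<le> r" by (rule degree_le) (simp add: cp)
  then have "poly_apply T p w = 0" using c(2) by (simp add: poly_apply_bound cp)
  moreover have "p \<noteq> 0" using c(1) cp by (metis coeff_0)
  ultimately show ?thesis using * by blast
qed

text \<open>Expressing the \<open>f i\<close> through the generators \<open>B\<close> turns the
  search for a relation into a linear system with more unknowns than equations.\<close>

lemma rank_bound:
  fixes s :: "'r::idom \<Rightarrow> 'm::ab_group_add \<Rightarrow> 'm"
  assumes "module s" and B: "finite B" "module.span s B = UNIV" and I: "finite I" "card B < card I"
  shows "\<exists>p. (\<exists>i\<in>I. p i \<noteq> 0) \<and> (\<Sum>i\<in>I. s (p i) (f i)) = 0"
proof -
  interpret module s by fact
  have "\<exists>u. f i = (\<Sum>b\<in>B. s (u b) b)" for i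
  proof -
    have "f i \<in> span B" using B by simp
    then show ?thesis using B(1) by (auto simp: span_finite)
  qed
  then obtain a where a: "\<And>i. f i = (\<Sum>b\<in>B. s (a i b) b)" by metis
  obtain p where p: "\<exists>i\<in>I. p i \<noteq> 0" "\<forall>b\<in>B. (\<Sum>i\<in>I. p i * a i b) = 0"
    using nontrivial_kernel[OF B(1) I, of a] by blast
  have "(\<Sum>i\<in>I. s (p i) (f i)) = (\<Sum>i\<in>I. \<Sum>b\<in>B. s (p i * a i b) b)"
    by (simp add: a scale_sum_right)
  also have "\<dots> = (\<Sum>b\<in>B. s (\<Sum>i\<in>I. p i * a i b) b)"
    by (subst sum.swap) (simp add: scale_sum_left)
  also have "\<dots> = 0" using p(2) by simp
  finally show ?thesis using p(1) by blast
qed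

section \<open>Coefficients of the axioms\<close>

text \<open>In \<open>coeff (coeff F j) i\<close> the exponent \<open>j\<close> belongs to the outer
  variable \<mu> and \<open>i\<close> to the inner variable \<lambda>.\<close>

lemma coeff2_lam2_funpow:
  "coeff (coeff ((lam2 ^^ m) F) j) i = (if i < m then 0 else coeff (coeff F j) (i - m))"
proof (induction m arbitrary: i)
  case (Suc m)
  show ?case by (cases i) (simp_all add: lam2_def[of "(lam2 ^^ m) F"] coeff_map_poly Suc)
qed simp

lemma coeff2_mu2_funpow:
  "coeff (coeff ((mu2 ^^ m) F) j) i = (if j < m then 0 else coeff (coeff F (j - m)) i)"
proof (induction m arbitrary: j)
  case (Suc m)
  show ?case by (cases j) (simp_all add: mu2_def[of "(mu2 ^^ m) F"] Suc)
qed simp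

lemma coeff2_const2: "coeff (coeff (const2 v) j) i = (if i = 0 \<and> j = 0 then v else 0)"
  by (auto simp: const2_def coeff_pCons split: nat.splits)

lemma coeff2_subst_lam2:
  fixes f :: "'m::ab_group_add poly" and \<iota> :: "'m \<Rightarrow> 'a::ab_group_add poly poly"
  shows "coeff (coeff (subst_op lam2 \<iota> f) j) i =
    (\<Sum>k\<le>degree f. if i < k then 0 else coeff (coeff (\<iota> (coeff f k)) j) (i - k))"
  by (simp add: subst_op_def coeff_sum coeff2_lam2_funpow)

lemma coeff2_subst_mu2:
  fixes f :: "'m::ab_group_add poly" and \<iota> :: "'m \<Rightarrow> 'a::ab_group_add poly poly"
  shows "coeff (coeff (subst_op mu2 \<iota> f) j) i =
    (\<Sum>k\<le>degree f. if j < k then 0 else coeff (coeff (\<iota> (coeff f k)) (j - k)) i)"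
  by (simp add: subst_op_def coeff_sum coeff2_mu2_funpow)

lemma coeff2_subst_lam2_const2:
  fixes f :: "'m::ab_group_add poly"
  shows "coeff (coeff (subst_op lam2 const2 f) j) i = (if j = 0 then coeff f i else 0)"
proof -
  have "coeff (coeff (subst_op lam2 const2 f) j) i = (\<Sum>k\<le>degree f. if k = i then (if j = 0 then coeff f i else 0) else 0)"
    unfolding coeff2_subst_lam2 by (intro sum.cong refl) (auto simp: coeff2_const2)
  then show ?thesis by (auto simp: coeff_eq_0)
qed

lemma coeff2_subst_mu2_const2:
  fixes f :: "'m::ab_group_add poly"
  shows "coeff (coeff (subst_op mu2 const2 f) j) i = (if i = 0 then coeff f j else 0)"
proof -
  have "coeff (coeff (subst_op mu2 const2 f) j) i = (\<Sum>k\<le>degree f. if k = j then (if i = 0 then coeff f j else 0) else 0)"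
    unfolding coeff2_subst_mu2 by (intro sum.cong refl) (auto simp: coeff2_const2)
  then show ?thesis by (auto simp: coeff_eq_0)
qed

lemma coeff2_iterated:
  fixes A :: "'r \<Rightarrow> 'm::ab_group_add \<Rightarrow> 'm poly"
  assumes "A a 0 = 0"
  shows "coeff (coeff (iterated A lam2 a mu2 b v) j) i = coeff (A a (coeff (A b v) j)) i"
    and "coeff (coeff (iterated A mu2 a lam2 b v) j) i = coeff (A a (coeff (A b v) i)) j"
proof -
  have "coeff (coeff (iterated A lam2 a mu2 b v) j) i =
    (\<Sum>k\<le>degree (A b v). if k = j then coeff (A a (coeff (A b v) j)) i else 0)"
    unfolding iterated_def coeff2_subst_mu2
    by (intro sum.cong refl) (auto simp: coeff2_subst_lam2_const2)
  then show "coeff (coeff (iterated A lam2 a mu2 b v) j) i = coeff (A a (coeff (A b v) j)) i"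
    by (auto simp: coeff_eq_0 assms)
  have "coeff (coeff (iterated A mu2 a lam2 b v) j) i =
    (\<Sum>k\<le>degree (A b v). if k = i then coeff (A a (coeff (A b v) i)) j else 0)"
    unfolding iterated_def coeff2_subst_lam2
    by (intro sum.cong refl) (auto simp: coeff2_subst_mu2_const2)
  then show "coeff (coeff (iterated A mu2 a lam2 b v) j) i = coeff (A a (coeff (A b v) i)) j"
    by (auto simp: coeff_eq_0 assms)
qed

section \<open>Modes of a conformal module over \<open>k(n)\<close>\<close>

text \<open>An entry \<open>(A, B, C, w)\<close> stands for the term \<open>(A \<partial> + B \<lambda> + C) w\<close>.\<close>

definition kbracket_coeffs :: "nat \<Rightarrow> kgen \<Rightarrow> kgen \<Rightarrow> (complex \<times> complex \<times> complex \<times> kgen) list" where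
  "kbracket_coeffs n g h = map (\<lambda>(\<phi>, w). (\<phi> 0 1 - \<phi> 0 0, \<phi> 1 0 - \<phi> 0 0, \<phi> 0 0, w)) (kbracket_values n g h)"

lemma kbracket_values_affine: "(\<phi>, w) \<in> set (kbracket_values n g h) \<Longrightarrow> \<phi> l x = (\<phi> 0 1 - \<phi> 0 0) * x + (\<phi> 1 0 - \<phi> 0 0) * l + \<phi> 0 0"
  by (cases g; cases h) (auto simp: algebra_simps)

text \<open>A table entry is determined by its values, and these are affine in \<lambda> and
  \<partial>, so the three evaluations in \<open>kbracket_coeffs\<close> recover the
  polynomial.\<close>

lemma kbracket_gen_kbracket_coeffs:
  "kbracket_gen n g h = (if kindex g + kindex h \<le> n
     then map (\<lambda>(A, B, C, w). ([:[:C, A:], [:B:]:], w)) (kbracket_coeffs n g h) else [])"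
proof -
  have inj: "inj (\<lambda>(F :: complex poly poly, w :: kgen). (\<lambda>l x. poly (poly F [:l:]) x, w))"
    by (rule injI) (auto simp: fun_eq_iff intro: poly_poly_eqI)
  have "map (\<lambda>(F, w). (\<lambda>l x. poly (poly F [:l:]) x, w)) (map (\<lambda>(A, B, C, w). ([:[:C, A:], [:B:]:], w)) (kbracket_coeffs n g h))
     = kbracket_values n g h"
    unfolding kbracket_coeffs_def map_map
  proof (rule map_idI)
    fix p assume "p \<in> set (kbracket_values n g h)"
    obtain \<phi> w where p: "p = (\<phi>, w)" by (cases p)
    have "\<phi> l x = (\<phi> 0 1 - \<phi> 0 0) * x + (\<phi> 1 0 - \<phi> 0 0) * l + \<phi> 0 0" for l x
      using kbracket_values_affine \<open>p \<in> set (kbracket_values n g h)\<close> p by blast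
    then have "\<phi> = (\<lambda>l x. (\<phi> 0 1 - \<phi> 0 0) * x + (\<phi> 1 0 - \<phi> 0 0) * l + \<phi> 0 0)" by blast
    then show "((\<lambda>(F, w). (\<lambda>l x. poly (poly F [:l:]) x, w)) \<circ> ((\<lambda>(A, B, C, w). ([:[:C, A:], [:B:]:], w)) \<circ>
      (\<lambda>(\<phi>, w). (\<phi> 0 1 - \<phi> 0 0, \<phi> 1 0 - \<phi> 0 0, \<phi> 0 0, w)))) p = p"
      unfolding p by (simp add: algebra_simps fun_eq_iff)
  qed
  then have "map (\<lambda>(F, w). (\<lambda>l x. poly (poly F [:l:]) x, w)) (kbracket_gen n g h) =
    map (\<lambda>(F, w). (\<lambda>l x. poly (poly F [:l:]) x, w)) (if kindex g + kindex h \<le> n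
     then map (\<lambda>(A, B, C, w). ([:[:C, A:], [:B:]:], w)) (kbracket_coeffs n g h) else [])"
    by (simp add: kbracket_kbracket_values)
  then show ?thesis using map_injective[OF _ inj] by blast
qed

locale kmodule = conformal_module "k_alg n" M for n :: nat and M :: "('m::ab_group_add, kelem) conf_mod"
begin

sublocale PM: module "pscale M" by (rule M.module_pscale)

abbreviation "psc \<equiv> pscale M"
abbreviation "csc \<equiv> cscale M"
abbreviation "D \<equiv> deriv_of M"

sublocale CV: complex_vector_space csc
  by unfold_locales
     (simp_all add: cscale_def PM.scale_right_distrib PM.scale_left_distrib[symmetric] mult.commute one_pCons[symmetric])

lemma D_add: "D (v + w) = D v + D w" and D_csc: "D (csc c v) = csc c (D v)"
  and D_0 [simp]: "D 0 = 0"
  by (simp_all add: deriv_of_def cscale_def PM.scale_right_distrib mult.commute)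

lemma psc_pCons: "psc (pCons c p) v = csc c v + D (psc p v)"
proof -
  have "pCons c p = [:c:] + [:0, 1:] * p" by simp
  then show ?thesis unfolding deriv_of_def cscale_def by (metis PM.scale_left_distrib PM.scale_scale)
qed

lemma act_sesq:
  assumes a: "a \<in> carrier_of (k_alg n)"
  shows "b \<in> carrier_of (k_alg n) \<Longrightarrow> act M (a + b) v = act M a v + act M b v"
    and "act M a (v + w) = act M a v + act M a w"
    and "act M (cscale (k_alg n) c a) v = map_poly (csc c) (act M a v)"
    and "act M a (csc c v) = map_poly (csc c) (act M a v)"
    and "act M (deriv_of (k_alg n) a) v = - pCons 0 (act M a v)"
    and "act M a (D v) = map_poly D (act M a v) + pCons 0 (act M a v)"
  using act_sesquilinear a carrier_M unfolding sesquilinear_def by auto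

lemma act_grade: "a \<in> grade (k_alg n) i \<Longrightarrow> v \<in> grade M j \<Longrightarrow> coeff (act M a v) k \<in> grade M (i + j)"
  using act_sesquilinear unfolding sesquilinear_def by blast

lemma act_0: "a \<in> carrier_of (k_alg n) \<Longrightarrow> act M a 0 = 0" and act_0_left: "act M 0 v = 0"
proof -
  show "a \<in> carrier_of (k_alg n) \<Longrightarrow> act M a 0 = 0" using act_sesq(2)[of a 0 0] by simp
  have "0 \<in> carrier_of (k_alg n)" by (rule grade_carrier[where i=0]) (simp add: k_alg_simps)
  then show "act M 0 v = 0" using act_sesq(1)[of 0 0 v] by simp
qed

text \<open>Divided-power modes \<open>g\<^sub>[\<^sub>k\<^sub>]\<close> and ordinary modes \<open>g\<^sub>(\<^sub>k\<^sub>)\<close>; both vanish when the index exceeds \<open>n\<close>.\<close>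

definition dmode :: "kgen \<Rightarrow> nat \<Rightarrow> 'm \<Rightarrow> 'm" where
  "dmode g k v = (if kindex g \<le> n then coeff (act M (gen g) v) k else 0)"

definition mode :: "kgen \<Rightarrow> nat \<Rightarrow> 'm \<Rightarrow> 'm" where
  "mode g k v = csc (fact k) (dmode g k v)"

lemma dmode_add: "dmode g k (v + w) = dmode g k v + dmode g k w"
  by (simp add: dmode_def act_sesq(2) gen_carrier)

lemma csc_0 [simp]: "csc c 0 = 0"
  by (rule CV.scale_zero_right)

lemma dmode_csc: "dmode g k (csc c v) = csc c (dmode g k v)"
  by (simp add: dmode_def act_sesq(4) gen_carrier coeff_map_poly)

lemma dmode_D: "dmode g k (D v) = D (dmode g k v) + (if k = 0 then 0 else dmode g (k - 1) v)"
  by (auto simp: dmode_def act_sesq(6) gen_carrier coeff_map_poly coeff_pCons split: nat.splits)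

lemma dmode_grade: "v \<in> grade M j \<Longrightarrow> dmode g k v \<in> grade M (kparity g + j)"
  using act_grade[OF gen_grade] PM.subspace_0[OF M.subspace_grade] by (auto simp: dmode_def)

lemma dmode_finite: "\<exists>K. \<forall>k\<ge>K. dmode g k v = 0"
  by (rule exI[of _ "Suc (degree (act M (gen g) v))"]) (auto simp: dmode_def coeff_eq_0)

lemma mode_add: "mode g k (v + w) = mode g k v + mode g k w"
  by (simp add: mode_def dmode_add CV.scale_right_distrib)

lemma mode_csc: "mode g k (csc c v) = csc c (mode g k v)"
  by (simp add: mode_def dmode_csc mult.commute)

lemma mode_0 [simp]: "mode g k 0 = 0"
  using mode_csc[of g k 0 0] by simp

lemma mode_eq_0_iff: "mode g k v = 0 \<longleftrightarrow> dmode g k v = 0"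
  by (simp add: mode_def)

text \<open>The factorials in \<open>mode\<close> are there to make the commutator with \<partial>
  this simple. At k = 0 the truncated number \<open>k - 1\<close> comes with the factor 0.\<close>

lemma mode_D: "mode g k (D v) = D (mode g k v) + csc (of_nat k) (mode g (k - 1) v)"
  by (cases k) (simp_all add: mode_def dmode_D D_csc CV.scale_right_distrib D_0)

lemma mode_grade: "v \<in> grade M j \<Longrightarrow> mode g k v \<in> grade M (kparity g + j)"
  unfolding mode_def cscale_def by (intro PM.subspace_scale[OF M.subspace_grade] dmode_grade)

lemma mode_index: "kindex g > n \<Longrightarrow> mode g k v = 0"
  by (simp add: mode_def dmode_def)

lemma coeff2_plus_funpow:
  "coeff (coeff (((\<lambda>F. lam2 F + mu2 F) ^^ m) (const2 (w :: 'm))) j) i =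
    (if i + j = m then csc (of_nat (m choose i)) w else 0)"
proof (induction m arbitrary: i j)
  case 0
  then show ?case by (auto simp: coeff2_const2)
next
  case (Suc m)
  have "coeff (coeff (lam2 F + mu2 F) j) i =
     (case i of 0 \<Rightarrow> 0 | Suc i' \<Rightarrow> coeff (coeff F j) i') + (case j of 0 \<Rightarrow> 0 | Suc j' \<Rightarrow> coeff (coeff F j') i)"
    for F :: "'m poly poly" and i j
    by (simp add: lam2_def mu2_def coeff_map_poly coeff_pCons split: nat.splits)
  note step = this[of "((\<lambda>F. lam2 F + mu2 F) ^^ m) (const2 w)"]
  show ?case
    unfolding funpow.simps comp_def step Suc
    by (cases i; cases j) (auto simp: CV.scale_left_distrib add.commute)
qed

lemma coeff2_bracketed:
  fixes f :: "kelem poly"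
  shows "coeff (coeff (subst_op lam2 (\<lambda>c. subst_op (\<lambda>F. lam2 F + mu2 F) const2 (act M c v)) f) j) i =
    (\<Sum>k\<le>degree f. if i < k then 0
       else csc (of_nat ((i - k + j) choose j)) (coeff (act M (coeff f k) v) (i - k + j)))"
proof -
  have "coeff (coeff (subst_op (\<lambda>F. lam2 F + mu2 F) const2 g) j) i = csc (of_nat ((i + j) choose j)) (coeff g (i + j))"
    for g :: "'m poly" and i j
  proof -
    have "coeff (coeff (subst_op (\<lambda>F. lam2 F + mu2 F) const2 g) j) i =
      (\<Sum>k\<le>degree g. if k = i + j then csc (of_nat ((i + j) choose j)) (coeff g (i + j)) else 0)"
      unfolding subst_op_def coeff_sum coeff2_plus_funpow
      by (intro sum.cong refl) (auto simp: binomial_symmetric[of i "i + j"])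
    then show ?thesis by (auto simp: coeff_eq_0)
  qed
  note * = this
  show ?thesis unfolding coeff2_subst_lam2 by (simp add: * cong: if_cong)
qed

lemma act_affine:
  "kindex w \<le> n \<Longrightarrow> coeff (act M (single w [:C, A:]) v) k
    = csc C (dmode w k v) - csc A (if k = 0 then 0 else dmode w (k - 1) v)"
proof -
  assume w: "kindex w \<le> n"
  have e: "single w [:C, A:] = cscale (k_alg n) C (gen w) + cscale (k_alg n) A (deriv_of (k_alg n) (gen w))"
    by (rule poly_mapping_eqI)
       (simp add: cscale_def deriv_of_def k_alg_simps lookup_add lookup_free_scale lookup_single when_def one_pCons)
  have c: "cscale (k_alg n) C (gen w) \<in> carrier_of (k_alg n)" "cscale (k_alg n) A (deriv_of (k_alg n) (gen w)) \<in> carrier_of (k_alg n)"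
    "deriv_of (k_alg n) (gen w) \<in> carrier_of (k_alg n)"
    using w by (auto intro!: grade_carrier[where i="kparity w"]
       simp: cscale_def deriv_of_def k_alg_simps lookup_free_scale lookup_single when_def in_keys_iff split: if_splits)
  show ?thesis
    unfolding e using w c
    by (simp add: act_sesq(1) act_sesq(3,5) gen_carrier coeff_map_poly dmode_def coeff_pCons CV.scale_minus_right split: nat.splits)
qed

lemma bracket_gen_coeff:
  "coeff (bracket (k_alg n) (gen g) (gen h)) k = (\<Sum>(F, w)\<leftarrow>kbracket_gen n g h. single w (coeff F k))"
proof -
  have e1: "eval_at 1 X = 1" for X by (simp add: eval_at_def one_pCons map_poly_pCons)
  have sl: "coeff (\<Sum>(F, w)\<leftarrow>xs. f F w) k = (\<Sum>(F, w)\<leftarrow>xs. coeff (f F w) k)"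
    for xs :: "(complex poly poly \<times> kgen) list" and f :: "_ \<Rightarrow> _ \<Rightarrow> kelem poly"
    by (induction xs) auto
  show ?thesis
    by (simp add: k_alg_simps sesquilinear_extension_def e1 sl coeff_map_poly)
qed

lemma carrier_add:
  assumes ab: "a \<in> carrier_of (k_alg n)" "b \<in> carrier_of (k_alg n)"
  shows "a + b \<in> carrier_of (k_alg n)"
proof -
  obtain a0 a1 where a: "a = a0 + a1" "a0 \<in> grade (k_alg n) 0" "a1 \<in> grade (k_alg n) 1"
    using ab(1) unfolding carrier_of_def by blast
  obtain b0 b1 where b: "b = b0 + b1" "b0 \<in> grade (k_alg n) 0" "b1 \<in> grade (k_alg n) 1"
    using ab(2) unfolding carrier_of_def by blast
  have "a + b = (a0 + b0) + (a1 + b1)" using a b by simp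
  moreover have "a0 + b0 \<in> grade (k_alg n) 0" "a1 + b1 \<in> grade (k_alg n) 1"
    using a b R.subspace_grade module.subspace_add[OF R.module_pscale] by blast+
  ultimately show ?thesis unfolding carrier_of_def by blast
qed

lemma act_sum_list:
  assumes "\<And>F w. (F, w) \<in> set xs \<Longrightarrow> f F w \<in> carrier_of (k_alg n)"
  shows "act M (\<Sum>(F, w)\<leftarrow>xs. f F w) v = (\<Sum>(F, w)\<leftarrow>xs. act M (f F w) v) \<and> (\<Sum>(F, w)\<leftarrow>xs. f F w) \<in> carrier_of (k_alg n)"
  using assms
proof (induction xs)
  case Nil
  show ?case using act_0_left by (auto intro!: grade_carrier[where i=0] simp: k_alg_simps)
next
  case (Cons p xs)
  obtain F w where p: "p = (F, w)" by (cases p)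
  show ?case using Cons unfolding p by (auto simp: act_sesq(1) intro: carrier_add)
qed

lemma single_carrier: "kindex w \<le> n \<Longrightarrow> single w p \<in> carrier_of (k_alg n)"
  by (rule grade_carrier[where i="kparity w"]) (auto simp: k_alg_simps)

lemma bracket_terms:
  assumes "kindex g + kindex h \<le> n"
  shows "coeff (act M (coeff (bracket (k_alg n) (gen g) (gen h)) k) v) m =
    (\<Sum>(A, B, C, w)\<leftarrow>kbracket_coeffs n g h. if k = 0 then csc C (dmode w m v) - csc A (if m = 0 then 0 else dmode w (m - 1) v)
       else if k = 1 then csc B (dmode w m v) else 0)"
proof -
  have idx: "kindex w \<le> n" if "(F, w) \<in> set (kbracket_gen n g h)" for F w
    using kbracket_gen_parity that by blast
  have "coeff (act M (coeff (bracket (k_alg n) (gen g) (gen h)) k) v) m =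
    coeff (\<Sum>(F, w)\<leftarrow>kbracket_gen n g h. act M (single w (coeff F k)) v) m"
    unfolding bracket_gen_coeff by (subst act_sum_list[THEN conjunct1]) (auto intro: single_carrier idx)
  also have "\<dots> = (\<Sum>(F, w)\<leftarrow>kbracket_gen n g h. coeff (act M (single w (coeff F k)) v) m)"
  proof -
    have "coeff (\<Sum>(F, w)\<leftarrow>xs. f F w) m = (\<Sum>(F, w)\<leftarrow>xs. coeff (f F w) m)"
      for xs :: "(complex poly poly \<times> kgen) list" and f :: "_ \<Rightarrow> _ \<Rightarrow> 'm poly"
      by (induction xs) auto
    then show ?thesis .
  qed
  also have "\<dots> = (\<Sum>(A, B, C, w)\<leftarrow>kbracket_coeffs n g h. coeff (act M (single w (coeff [:[:C, A:], [:B:]:] k)) v) m)"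
    unfolding kbracket_gen_kbracket_coeffs using assms by (simp add: comp_def case_prod_unfold)
  also have "\<dots> = (\<Sum>(A, B, C, w)\<leftarrow>kbracket_coeffs n g h. if k = 0 then csc C (dmode w m v) - csc A (if m = 0 then 0 else dmode w (m - 1) v)
       else if k = 1 then csc B (dmode w m v) else 0)"
  proof (rule arg_cong[where f=sum_list], rule map_cong[OF refl], clarify)
    fix A B C w assume *: "(A, B, C, w) \<in> set (kbracket_coeffs n g h)"
    have "kindex w \<le> n"
      using kbracket_values_index * assms by (fastforce simp: kbracket_coeffs_def)
    moreover have "single w [:B:] = single w [:B, 0:]" by simp
    moreover have "coeff [:[:C, A:], [:B:]:] k = (if k = 0 then [:C, A:] else if k = 1 then [:B:] else 0)"
      by (auto simp: coeff_pCons split: nat.splits)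
    ultimately show "coeff (act M (single w (coeff [:[:C, A:], [:B:]:] k)) v) m =
       (if k = 0 then csc C (dmode w m v) - csc A (if m = 0 then 0 else dmode w (m - 1) v)
       else if k = 1 then csc B (dmode w m v) else 0)"
      using act_affine[of w C A v m] act_affine[of w B 0 v m] by (simp add: act_0_left)
  qed
  finally show ?thesis .
qed

text \<open>Comparison of the coefficients of \<lambda>^i \<mu>^j in the module axiom. The binomial
  coefficients come from the powers of \<lambda> + \<mu>. The bracket is affine, so its \<lambda>
  lowers i by one, while its \<partial> acts as -(\<lambda> + \<mu>) and lowers i + j by
  one.\<close>

lemma dmode_bracket:
  assumes g: "kindex g \<le> n" "kindex h \<le> n" and gh: "kindex g + kindex h \<le> n"
  shows "dmode g i (dmode h j v) - koszul (kparity g) (kparity h) (dmode h j (dmode g i v)) =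
    (\<Sum>(A, B, C, w)\<leftarrow>kbracket_coeffs n g h. csc (of_nat ((i + j) choose j)) (csc C (dmode w (i + j) v) - csc A (if i + j = 0 then 0 else dmode w (i + j - 1) v))
       + (if i = 0 then 0 else csc (of_nat ((i - 1 + j) choose j)) (csc B (dmode w (i - 1 + j) v))))"
proof -
  let ?f = "bracket (k_alg n) (gen g) (gen h)"
  let ?T = "\<lambda>k. if i < k then 0 else csc (of_nat ((i - k + j) choose j)) (coeff (act M (coeff ?f k) v) (i - k + j))"
  have "coeff (coeff (bracketed (bracket (k_alg n)) (act M) (gen g) (gen h) v) j) i = (\<Sum>k\<le>degree ?f. ?T k)"
    unfolding bracketed_def by (rule coeff2_bracketed)
  \<comment> \<open>The range is enlarged to contain 1 even when the bracket is constant in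
    \<lambda>, so that exactly the summands for 0 and 1 can be singled out.\<close>
  also have "\<dots> = (\<Sum>k\<le>max 1 (degree ?f). ?T k)"
    by (rule sum.mono_neutral_left) (auto simp: coeff_eq_0 act_0_left)
  also have "\<dots> = (\<Sum>k\<in>{0, 1}. ?T k)"
  proof (rule sum.mono_neutral_right)
    have "coeff (act M (coeff ?f k) v) m = 0" if "k \<notin> {0, 1}" for k m
    proof -
      have "(\<Sum>(A, B, C, w)\<leftarrow>xs. 0) = (0 :: 'm)" for xs :: "(complex \<times> complex \<times> complex \<times> kgen) list"
        by (induction xs) auto
      then show ?thesis unfolding bracket_terms[OF gh] using that by simp
    qed
    then show "\<forall>k\<in>{..max 1 (degree ?f)} - {0, 1}. ?T k = 0" by simp
  qed auto
  also have "\<dots> = (\<Sum>(A, B, C, w)\<leftarrow>kbracket_coeffs n g h. csc (of_nat ((i + j) choose j)) (csc C (dmode w (i + j) v) - csc A (if i + j = 0 then 0 else dmode w (i + j - 1) v))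
       + (if i = 0 then 0 else csc (of_nat ((i - 1 + j) choose j)) (csc B (dmode w (i - 1 + j) v))))"
  proof -
    have sc: "csc c (\<Sum>(A, B, C, w)\<leftarrow>xs. f A B C w) = (\<Sum>(A, B, C, w)\<leftarrow>xs. csc c (f A B C w))"
      and ad: "(\<Sum>(A, B, C, w)\<leftarrow>xs. f A B C w) + (\<Sum>(A, B, C, w)\<leftarrow>xs. f' A B C w) = (\<Sum>(A, B, C, w)\<leftarrow>xs. f A B C w + f' A B C w)"
      for c f f' and xs :: "(complex \<times> complex \<times> complex \<times> kgen) list"
      by (induction xs) (auto simp: CV.scale_right_distrib algebra_simps)
    show ?thesis
      by (cases "i = 0") (simp_all add: bracket_terms[OF gh] sc ad cong: if_cong)
  qed
  finally have 1: "coeff (coeff (bracketed (bracket (k_alg n)) (act M) (gen g) (gen h) v) j) i = \<dots>" .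
  have kz: "coeff (coeff (koszul p q F) j) i = koszul p q (coeff (coeff F j) i)" for p q and F :: "'m poly poly"
    by (simp add: koszul_def)
  show ?thesis
    using 1 unfolding act_bracket[OF gen_grade[OF g(1)] gen_grade[OF g(2)]]
    by (simp add: kz coeff2_iterated act_0 gen_carrier g dmode_def)
qed

text \<open>Multiplication by i! j! absorbs the binomial coefficients. Modes of index above n are
  zero by definition, so the formula holds for all pairs of generators, the truncated brackets
  included. If i + j = 0, the truncated number \<open>i + j - 1\<close> comes with the factor
  0.\<close>

lemma mode_bracket:
  "mode g i (mode h j v) - koszul (kparity g) (kparity h) (mode h j (mode g i v)) =
    (\<Sum>(A, B, C, w)\<leftarrow>kbracket_coeffs n g h. csc C (mode w (i + j) v) + csc (B * of_nat i - A * of_nat (i + j)) (mode w (i + j - 1) v))"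
proof (cases "kindex g + kindex h \<le> n")
  case False
  have w: "kindex w > n" if "(A, B, C, w) \<in> set (kbracket_coeffs n g h)" for A B C w
    using kbracket_values_index that False by (fastforce simp: kbracket_coeffs_def)
  have "(\<Sum>(A, B, C, w)\<leftarrow>xs. csc C (mode w (i + j) v) + csc (B * of_nat i - A * of_nat (i + j)) (mode w (i + j - 1) v)) = 0"
    if "\<And>A B C w. (A, B, C, w) \<in> set xs \<Longrightarrow> kindex w > n" for xs
    using that by (induction xs) (fastforce simp: mode_index)+
  then have r: "(\<Sum>(A, B, C, w)\<leftarrow>kbracket_coeffs n g h. csc C (mode w (i + j) v) + csc (B * of_nat i - A * of_nat (i + j)) (mode w (i + j - 1) v)) = 0"
    using w by blast
  show ?thesis
  proof (cases "kindex g \<le> n \<and> kindex h \<le> n")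
    case True
    let ?f = "bracket (k_alg n) (gen g) (gen h)"
    have f0: "?f = 0"
      by (rule poly_eqI) (use False in \<open>simp add: bracket_gen_coeff kbracket_gen_kbracket_coeffs\<close>)
    have "coeff (coeff (bracketed (bracket (k_alg n)) (act M) (gen g) (gen h) v) j) i = 0"
      unfolding bracketed_def coeff2_bracketed f0 by (simp add: act_0_left)
    moreover have kz: "coeff (coeff (koszul p q F) j) i = koszul p q (coeff (coeff F j) i)" for p q and F :: "'m poly poly"
      by (simp add: koszul_def)
    ultimately have "dmode g i (dmode h j v) - koszul (kparity g) (kparity h) (dmode h j (dmode g i v)) = 0"
      unfolding act_bracket[OF gen_grade[OF True[THEN conjunct1]] gen_grade[OF True[THEN conjunct2]]]
      using True by (simp add: coeff2_iterated act_0 gen_carrier dmode_def)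
    then have "csc (fact i * fact j) (dmode g i (dmode h j v) - koszul (kparity g) (kparity h) (dmode h j (dmode g i v))) = 0"
      by simp
    then show ?thesis unfolding r
      by (simp add: mode_def dmode_csc koszul_def CV.scale_right_diff_distrib CV.scale_right_distrib mult.commute split: if_splits)
  next
    case False
    then show ?thesis unfolding r by (auto simp: mode_index koszul_def)
  qed
next
  case True
  then have g: "kindex g \<le> n" "kindex h \<le> n" by auto
  have "mode g i (mode h j v) - koszul (kparity g) (kparity h) (mode h j (mode g i v)) =
    csc (fact i * fact j) (dmode g i (dmode h j v) - koszul (kparity g) (kparity h) (dmode h j (dmode g i v)))"
    by (simp add: mode_def dmode_csc koszul_def CV.scale_right_diff_distrib CV.scale_right_distrib mult.commute)
  also have "\<dots> = (\<Sum>(A, B, C, w)\<leftarrow>kbracket_coeffs n g h. csc (fact i * fact j) (csc (of_nat ((i + j) choose j)) (csc C (dmode w (i + j) v) - csc A (if i + j = 0 then 0 else dmode w (i + j - 1) v))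
       + (if i = 0 then 0 else csc (of_nat ((i - 1 + j) choose j)) (csc B (dmode w (i - 1 + j) v)))))"
  proof -
    have "csc c (\<Sum>(A, B, C, w)\<leftarrow>xs. f A B C w) = (\<Sum>(A, B, C, w)\<leftarrow>xs. csc c (f A B C w))"
      for c f and xs :: "(complex \<times> complex \<times> complex \<times> kgen) list"
      by (induction xs) (auto simp: CV.scale_right_distrib)
    then show ?thesis unfolding dmode_bracket[OF g True] .
  qed
  also have "\<dots> = (\<Sum>(A, B, C, w)\<leftarrow>kbracket_coeffs n g h. csc C (mode w (i + j) v) + csc (B * of_nat i - A * of_nat (i + j)) (mode w (i + j - 1) v))"
  proof (rule arg_cong[where f=sum_list], rule map_cong[OF refl], clarify)
    fix A B C w
    have b: "fact i * fact j * of_nat ((i + j) choose j) = (fact (i + j) :: complex)" for i j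
    proof -
      have "fact j * fact i * ((i + j) choose j) = (fact (i + j) :: nat)"
        using binomial_fact_lemma[of j "i + j"] by simp
      then have "of_nat (fact j * fact i * ((i + j) choose j)) = (of_nat (fact (i + j)) :: complex)" by simp
      then show ?thesis by (simp add: mult_ac)
    qed
    show "csc (fact i * fact j) (csc (of_nat ((i + j) choose j)) (csc C (dmode w (i + j) v) - csc A (if i + j = 0 then 0 else dmode w (i + j - 1) v))
       + (if i = 0 then 0 else csc (of_nat ((i - 1 + j) choose j)) (csc B (dmode w (i - 1 + j) v))))
      = csc C (mode w (i + j) v) + csc (B * of_nat i - A * of_nat (i + j)) (mode w (i + j - 1) v)"
    proof (cases "i + j = 0")
      case True
      then show ?thesis by (simp add: mode_def)
    next
      case False
      then obtain m where m: "i + j = Suc m" by (metis not0_implies_Suc)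
      have 1: "csc (fact i * fact j) (csc (of_nat ((i + j) choose j)) x) = csc (fact (i + j)) x" for x
        using b[of i j] by simp
      have 2: "csc (fact i * fact j) (if i = 0 then 0 else csc (of_nat ((i - 1 + j) choose j)) (csc B (dmode w (i - 1 + j) v)))
         = csc (B * of_nat i) (mode w (i + j - 1) v)"
      proof (cases i)
        case (Suc i')
        have "csc (fact i * fact j) (csc (of_nat ((i' + j) choose j)) x) = csc (of_nat i * fact (i' + j)) x" for x
          using b[of i' j] unfolding Suc by (simp add: mult.assoc)
        then show ?thesis using Suc by (simp add: mode_def mult_ac)
      qed simp
      have 3: "csc (fact (i + j)) (csc A (dmode w (i + j - 1) v)) = csc (A * of_nat (i + j)) (mode w (i + j - 1) v)"
        unfolding m by (simp add: mode_def mult_ac)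
      have 4: "csc (fact (i + j)) (csc C (dmode w (i + j) v)) = csc C (mode w (i + j) v)"
        by (simp add: mode_def mult.commute)
      show ?thesis
        unfolding CV.scale_right_distrib 1 2 CV.scale_right_diff_distrib 4
        using False by (simp only: if_False 3 CV.scale_left_diff_distrib) simp
    qed
  qed
  finally show ?thesis .
qed

end

section \<open>Commutation relations and the grading by energy\<close>

context kmodule
begin

text \<open>These are the relations of the annihilation algebra. A bracket term A \<partial> + B
  \<lambda> contributes the factor B a - A (a + b); for two \<open>L\<close> this is (i + j - 2 n) a
  - (i - n) (a + b), which simplifies to (j - n) a - (i - n) b.\<close>

lemma commute_modes:
  "mode (L i) a (mode (L j) b v) = mode (L j) b (mode (L i) a v)
     + csc ((cn j - cn n) * cn a - (cn i - cn n) * cn b) (mode (L (i + j)) (a + b - 1) v)"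
  "mode (L i) a (mode (J j) b v) = mode (J j) b (mode (L i) a v)
     + csc (cn j * cn a - (cn i - cn n) * cn b) (mode (J (i + j)) (a + b - 1) v)"
  "mode (J i) a (mode (L j) b v) = mode (L j) b (mode (J i) a v)
     + csc ((cn j - cn n) * cn a - cn i * cn b) (mode (J (i + j)) (a + b - 1) v)"
  "mode (L i) a (mode (Gp j) b v) = mode (Gp j) b (mode (L i) a v)
     + csc ((cn j - half n) * cn a - (cn i - cn n) * cn b) (mode (Gp (i + j)) (a + b - 1) v)"
  "mode (L i) a (mode (Gm j) b v) = mode (Gm j) b (mode (L i) a v)
     + csc ((cn j - half n) * cn a - (cn i - cn n) * cn b) (mode (Gm (i + j)) (a + b - 1) v)"
  "mode (J i) a (mode (J j) b v) = mode (J j) b (mode (J i) a v)"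
  "mode (J i) a (mode (Gp j) b v) = mode (Gp j) b (mode (J i) a v) + mode (Gp (i + j)) (a + b) v"
  "mode (J i) a (mode (Gm j) b v) = mode (Gm j) b (mode (J i) a v) - mode (Gm (i + j)) (a + b) v"
  "mode (Gp i) a (mode (Gp j) b v) = - mode (Gp j) b (mode (Gp i) a v)"
  "mode (Gm i) a (mode (Gm j) b v) = - mode (Gm j) b (mode (Gm i) a v)"
  "mode (Gp i) a (mode (Gm j) b v) = - mode (Gm j) b (mode (Gp i) a v)
     + csc ((2 * cn j - cn n) * cn a - (2 * cn i - cn n) * cn b) (mode (J (i + j)) (a + b - 1) v)
     + csc 2 (mode (L (i + j)) (a + b) v)"
  "mode (Gm i) a (mode (Gp j) b v) = - mode (Gp j) b (mode (Gm i) a v)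
     + csc ((2 * cn i - cn n) * cn b - (2 * cn j - cn n) * cn a) (mode (J (i + j)) (a + b - 1) v)
     + csc 2 (mode (L (i + j)) (a + b) v)"
proof -
  have r: "x - y = csc c' w \<Longrightarrow> c' = c \<Longrightarrow> x = y + csc c w" for x y c c' w by (simp add: diff_eq_eq)
  have r2: "x - - y = csc c' w + z \<Longrightarrow> c' = c \<Longrightarrow> x = - y + csc c w + z" for x y c c' w z by (simp add: algebra_simps)
  show "mode (L i) a (mode (L j) b v) = mode (L j) b (mode (L i) a v)
     + csc ((cn j - cn n) * cn a - (cn i - cn n) * cn b) (mode (L (i + j)) (a + b - 1) v)"
    by (rule r[of _ _ "(cn i + cn j - 4 * half n) * cn a - (cn i - 2 * half n) * cn (a + b)"])
       (use mode_bracket[of "L i" a "L j" b v] in \<open>simp add: kbracket_coeffs_def koszul_def\<close>, simp add: half_def algebra_simps)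
  show "mode (L i) a (mode (J j) b v) = mode (J j) b (mode (L i) a v)
     + csc (cn j * cn a - (cn i - cn n) * cn b) (mode (J (i + j)) (a + b - 1) v)"
    by (rule r[of _ _ "(cn i + cn j - 2 * half n) * cn a - (cn i - 2 * half n) * cn (a + b)"])
       (use mode_bracket[of "L i" a "J j" b v] in \<open>simp add: kbracket_coeffs_def koszul_def\<close>, simp add: half_def algebra_simps)
  show "mode (J i) a (mode (L j) b v) = mode (L j) b (mode (J i) a v)
     + csc ((cn j - cn n) * cn a - cn i * cn b) (mode (J (i + j)) (a + b - 1) v)"
    by (rule r[of _ _ "(cn i + cn j - 2 * half n) * cn a - (cn i) * cn (a + b)"])
       (use mode_bracket[of "J i" a "L j" b v] in \<open>simp add: kbracket_coeffs_def koszul_def\<close>, simp add: half_def algebra_simps)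
  show "mode (L i) a (mode (Gp j) b v) = mode (Gp j) b (mode (L i) a v)
     + csc ((cn j - half n) * cn a - (cn i - cn n) * cn b) (mode (Gp (i + j)) (a + b - 1) v)"
    by (rule r[of _ _ "(cn i + cn j - 3 * half n) * cn a - (cn i - 2 * half n) * cn (a + b)"])
       (use mode_bracket[of "L i" a "Gp j" b v] in \<open>simp add: kbracket_coeffs_def koszul_def\<close>, simp add: half_def algebra_simps)
  show "mode (L i) a (mode (Gm j) b v) = mode (Gm j) b (mode (L i) a v)
     + csc ((cn j - half n) * cn a - (cn i - cn n) * cn b) (mode (Gm (i + j)) (a + b - 1) v)"
    by (rule r[of _ _ "(cn i + cn j - 3 * half n) * cn a - (cn i - 2 * half n) * cn (a + b)"])
       (use mode_bracket[of "L i" a "Gm j" b v] in \<open>simp add: kbracket_coeffs_def koszul_def\<close>, simp add: half_def algebra_simps)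
  show "mode (J i) a (mode (J j) b v) = mode (J j) b (mode (J i) a v)"
    using mode_bracket[of "J i" a "J j" b v] by (simp add: kbracket_coeffs_def koszul_def)
  show "mode (J i) a (mode (Gp j) b v) = mode (Gp j) b (mode (J i) a v) + mode (Gp (i + j)) (a + b) v"
    using mode_bracket[of "J i" a "Gp j" b v] by (simp add: kbracket_coeffs_def koszul_def diff_eq_eq add.commute)
  show "mode (J i) a (mode (Gm j) b v) = mode (Gm j) b (mode (J i) a v) - mode (Gm (i + j)) (a + b) v"
    using mode_bracket[of "J i" a "Gm j" b v] by (simp add: kbracket_coeffs_def koszul_def diff_eq_eq add.commute)
  show "mode (Gp i) a (mode (Gp j) b v) = - mode (Gp j) b (mode (Gp i) a v)"
    using mode_bracket[of "Gp i" a "Gp j" b v] by (simp add: kbracket_coeffs_def koszul_def eq_neg_iff_add_eq_0)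
  show "mode (Gm i) a (mode (Gm j) b v) = - mode (Gm j) b (mode (Gm i) a v)"
    using mode_bracket[of "Gm i" a "Gm j" b v] by (simp add: kbracket_coeffs_def koszul_def eq_neg_iff_add_eq_0)
  have gpgm: "mode (Gp i) a (mode (Gm j) b v) = - mode (Gm j) b (mode (Gp i) a v)
     + csc ((2 * cn j - cn n) * cn a - (2 * cn i - cn n) * cn b) (mode (J (i + j)) (a + b - 1) v)
     + csc 2 (mode (L (i + j)) (a + b) v)" for i a j b
    by (rule r2[of _ _ "2 * (cn i + cn j - 2 * half n) * cn a - (2 * cn i - 2 * half n) * cn (a + b)"])
       (use mode_bracket[of "Gp i" a "Gm j" b v] in \<open>simp add: kbracket_coeffs_def koszul_def\<close>, simp add: half_def algebra_simps)
  then show "mode (Gp i) a (mode (Gm j) b v) = - mode (Gm j) b (mode (Gp i) a v)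
     + csc ((2 * cn j - cn n) * cn a - (2 * cn i - cn n) * cn b) (mode (J (i + j)) (a + b - 1) v)
     + csc 2 (mode (L (i + j)) (a + b) v)" .
  have r3: "x = - y + c + z \<Longrightarrow> y = - x + c + z" for x y c z :: 'm by (simp add: algebra_simps)
  show "mode (Gm i) a (mode (Gp j) b v) = - mode (Gp j) b (mode (Gm i) a v)
     + csc ((2 * cn i - cn n) * cn b - (2 * cn j - cn n) * cn a) (mode (J (i + j)) (a + b - 1) v)
     + csc 2 (mode (L (i + j)) (a + b) v)"
    using r3[OF gpgm[of j b i a]] by (simp only: add.commute[of j i] add.commute[of b a])
qed

fun weight :: "kgen \<Rightarrow> int" where
  "weight (L i) = 2 * int i - 2 * int n" | "weight (J i) = 2 * int i"
| "weight (Gp i) = 2 * int i - int n" | "weight (Gm i) = 2 * int i - int n"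

text \<open>Twice the eigenvalue by which a mode shifts \<open>L\<^sub>0\<^sub>(\<^sub>1\<^sub>)\<close>, so that it is an integer.\<close>

definition energy :: "kgen \<Rightarrow> nat \<Rightarrow> int" where
  "energy g k = 2 * int n * int k + weight g"

text \<open>Terms with \<open>C\<close> \<noteq> 0 contribute at mode i + j and the others at mode i
  + j - 1. The extra 2 n makes up for the lost mode, so that \<open>energy\<close> is additive under
  commutators.\<close>

lemma kbracket_coeffs_weight:
  "(A, B, C, w) \<in> set (kbracket_coeffs n g h) \<Longrightarrow>
     (C \<noteq> 0 \<longrightarrow> weight w = weight g + weight h) \<and> (C = 0 \<longrightarrow> weight w = weight g + weight h + 2 * int n)"
  by (cases g; cases h) (auto simp: kbracket_coeffs_def)

lemma kbracket_coeffs_C: "(A, B, C, w) \<in> set (kbracket_coeffs n g h) \<Longrightarrow> C \<noteq> 0 \<Longrightarrow> A = 0 \<and> B = 0"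
  by (cases g; cases h) (auto simp: kbracket_coeffs_def)

text \<open>The commutator of two modes involves only modes whose energy is the sum of theirs; if
  all of these kill \<open>v\<close>, the two operators supercommute on \<open>v\<close>.\<close>

lemma mode_swap:
  assumes "\<And>w k. energy w k = energy g i + energy h j \<Longrightarrow> mode w k v = 0"
  shows "mode g i (mode h j v) = koszul (kparity g) (kparity h) (mode h j (mode g i v))"
proof -
  have "csc C (mode w (i + j) v) + csc (B * of_nat i - A * of_nat (i + j)) (mode w (i + j - 1) v) = 0"
    if "(A, B, C, w) \<in> set (kbracket_coeffs n g h)" for A B C w
  proof (cases "C = 0")
    case True
    show ?thesis
    proof (cases "i + j = 0")
      case False
      then obtain m where m: "i + j = Suc m" by (metis not0_implies_Suc)
      then have im: "int m = int i + int j - 1" by linarith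
      have "energy w (i + j - 1) = 2 * int n * int m + weight w" by (simp add: energy_def m)
      also have "\<dots> = energy g i + energy h j"
        unfolding im using kbracket_coeffs_weight[OF that] True by (simp add: energy_def algebra_simps)
      finally have "energy w (i + j - 1) = energy g i + energy h j" .
      then show ?thesis using assms True by simp
    qed (use True in simp)
  next
    case False
    then have "energy w (i + j) = energy g i + energy h j"
      using kbracket_coeffs_weight[OF that] by (simp add: energy_def algebra_simps)
    then show ?thesis using assms kbracket_coeffs_C[OF that False] by simp
  qed
  then have "(\<Sum>(A, B, C, w)\<leftarrow>xs. csc C (mode w (i + j) v) + csc (B * of_nat i - A * of_nat (i + j)) (mode w (i + j - 1) v)) = 0"
    if "set xs \<subseteq> set (kbracket_coeffs n g h)" for xs
    using that by (induction xs) (auto split: prod.splits)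
  then show ?thesis using mode_bracket[of g i h j v] by simp
qed

text \<open>The action on p(\<partial>) w is p(\<partial> + \<lambda>) applied to the action on w,
  so the degree in \<lambda> grows by deg \<open>p\<close>. Allowing \<open>m\<close> above the
  degree of \<open>p\<close>, with coefficient 0, lets several polynomials be compared at one common
  \<open>m\<close>.\<close>

lemma dmode_psc_top:
  assumes "\<And>k. k > K \<Longrightarrow> dmode g k w = 0" "degree p \<le> m"
  shows "dmode g (K + m) (psc p w) = csc (coeff p m) (dmode g K w)"
  using assms(2)
proof (induction p arbitrary: m)
  case 0
  then show ?case using dmode_csc[of g "K + m" 0 w] by (simp add: cscale_def)
next
  case (pCons a p)
  show ?case
  proof (cases m)
    case 0
    then have "p = 0" using pCons.prems by (auto split: if_splits)
    then show ?thesis using 0 dmode_csc[of g K a w] by (simp add: cscale_def)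
  next
    case (Suc m')
    have d: "degree p \<le> m'" using pCons.prems Suc by (auto split: if_splits)
    then have c: "coeff p m = 0" using Suc by (intro coeff_eq_0) simp
    have "dmode g (K + m) (psc p w) = 0" using pCons.IH[of m] d c Suc by simp
    moreover have "dmode g (K + m') (psc p w) = csc (coeff p m') (dmode g K w)" using pCons.IH[of m'] d by simp
    moreover have "dmode g (K + m) w = 0" using assms(1) Suc by simp
    ultimately show ?thesis using Suc by (simp add: psc_pCons dmode_add dmode_csc dmode_D)
  qed
qed

lemma dmode_sum: "dmode g k (sum f A) = (\<Sum>a\<in>A. dmode g k (f a))"
  by (induction A rule: infinite_finite_induct) (auto simp: dmode_add mode_eq_0_iff[symmetric])

lemma mode_sum: "mode g k (sum f A) = (\<Sum>a\<in>A. mode g k (f a))"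
  by (induction A rule: infinite_finite_induct) (auto simp: mode_add)

lemma psc_commute:
  assumes "\<And>v w. T (v + w) = T v + T w" "\<And>c v. T (csc c v) = csc c (T v)" "\<And>v. T (D v) = D (T v)"
  shows "T (psc p v) = psc p (T v)"
proof (induction p)
  case 0
  show ?case using assms(2)[of 0 v] by (simp add: cscale_def)
next
  case (pCons a p)
  then show ?case by (simp add: psc_pCons assms)
qed

lemma free_scale_carrier: "kindex g \<le> n \<Longrightarrow> free_scale p (gen g) \<in> carrier_of (k_alg n)"
  by (rule grade_carrier[where i="kparity g"])
     (auto simp: k_alg_simps in_keys_iff lookup_free_scale lookup_single when_def split: if_splits)

lemma carrier_induct [consumes 1, case_names gen add cscale deriv]:
  assumes a: "a \<in> carrier_of (k_alg n)"
    and gen: "\<And>g. kindex g \<le> n \<Longrightarrow> Q (gen g)"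
    and add: "\<And>a b. a \<in> carrier_of (k_alg n) \<Longrightarrow> b \<in> carrier_of (k_alg n) \<Longrightarrow> Q a \<Longrightarrow> Q b \<Longrightarrow> Q (a + b)"
    and cscale: "\<And>c a. a \<in> carrier_of (k_alg n) \<Longrightarrow> Q a \<Longrightarrow> Q (cscale (k_alg n) c a)"
    and deriv: "\<And>a. a \<in> carrier_of (k_alg n) \<Longrightarrow> Q a \<Longrightarrow> Q (deriv_of (k_alg n) a)"
  shows "Q a"
proof -
  have zero: "cscale (k_alg n) 0 x = 0" for x
    by (rule poly_mapping_eqI) (simp add: cscale_def k_alg_simps lookup_free_scale)
  have "Q (cscale (k_alg n) 0 (gen (L 0)))" by (intro cscale gen gen_carrier) auto
  then have Q0: "Q 0" by (simp only: zero)
  have gp: "Q (free_scale p (gen g))" if g: "kindex g \<le> n" for p g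
  proof (induction p)
    case 0
    have "free_scale 0 (gen g) = 0" by (rule poly_mapping_eqI) (simp add: lookup_free_scale)
    then show ?case using Q0 by simp
  next
    case (pCons x p)
    have e: "free_scale (pCons x p) (gen g) = cscale (k_alg n) x (gen g) + deriv_of (k_alg n) (free_scale p (gen g))"
      by (rule poly_mapping_eqI)
         (simp add: cscale_def deriv_of_def k_alg_simps lookup_add lookup_free_scale lookup_single when_def one_pCons)
    have "cscale (k_alg n) x (gen g) \<in> carrier_of (k_alg n)"
      using free_scale_carrier[OF g, of "[:x:]"] by (simp add: cscale_def k_alg_simps)
    moreover have "deriv_of (k_alg n) (free_scale p (gen g)) = free_scale ([:0, 1:] * p) (gen g)"
      by (rule poly_mapping_eqI) (simp add: deriv_of_def k_alg_simps lookup_free_scale)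
    then have "deriv_of (k_alg n) (free_scale p (gen g)) \<in> carrier_of (k_alg n)"
      using free_scale_carrier[OF g] by simp
    ultimately show ?case
      unfolding e using pCons gen g by (intro add cscale deriv free_scale_carrier gen_carrier) auto
  qed
  have idx: "kindex g \<le> n" if "g \<in> keys a" for g
  proof -
    obtain x y where "a = x + y" "x \<in> grade (k_alg n) 0" "y \<in> grade (k_alg n) 1"
      using a unfolding carrier_of_def by blast
    then show ?thesis using that keys_add[of x y] by (auto simp: k_alg_simps)
  qed
  have "(\<Sum>g\<in>G. free_scale (lookup a g) (gen g)) \<in> carrier_of (k_alg n) \<and>
      Q (\<Sum>g\<in>G. free_scale (lookup a g) (gen g))"
    if "finite G" "G \<subseteq> keys a" for G
    using that
  proof (induction G rule: finite_induct)
    case empty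
    have "0 \<in> carrier_of (k_alg n)" by (rule grade_carrier[where i=0]) (simp add: k_alg_simps)
    then show ?case using Q0 by simp
  next
    case (insert g G)
    then show ?case
      using gp idx[of g] free_scale_carrier by (simp add: carrier_add add)
  qed
  from this[OF finite_keys subset_refl] show ?thesis by (simp add: free_expand)
qed

text \<open>With \<open>V\<close> = \<open>N\<close> this shows that a subspace stable under all
  modes is stable under the algebra; with \<open>V\<close> = \<open>UNIV\<close> and
  \<open>N\<close> = \<open>{0}\<close> it shows that an action without nonzero modes
  vanishes.\<close>

lemma act_in:
  assumes N: "0 \<in> N" "\<And>v w. v \<in> N \<Longrightarrow> w \<in> N \<Longrightarrow> v + w \<in> N" "\<And>c v. v \<in> N \<Longrightarrow> csc c v \<in> N"
    and mode: "\<And>g k v. v \<in> V \<Longrightarrow> mode g k v \<in> N" and a: "a \<in> carrier_of (k_alg n)" and v: "v \<in> V"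
  shows "coeff (act M a v) k \<in> N"
proof -
  have neg: "- x \<in> N" if "x \<in> N" for x using N(3)[OF that, of "- 1"] by simp
  from a have "\<forall>k. coeff (act M a v) k \<in> N"
  proof (induction rule: carrier_induct)
    case (gen g)
    have "dmode g k v = csc (inverse (fact k)) (mode g k v)" for k by (simp add: mode_def)
    then have "dmode g k v \<in> N" for k using mode N(3) v by simp
    then show ?case using gen by (simp add: dmode_def)
  next
    case (deriv a)
    then show ?case using N neg by (simp add: act_sesq(5) coeff_pCons split: nat.splits)
  qed (simp_all add: act_sesq(1,3) coeff_map_poly N)
  then show ?thesis by blast
qed

end

section \<open>Irreducible modules\<close>

locale kirreducible = kmodule n M for n :: nat and M :: "('m::ab_group_add, kelem) conf_mod" +
  assumes n1: "n \<ge> 1"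
    and nontrivial: "nontrivial_conf_module (k_alg n) M"
    and finite_gen: "finite_conf_module M"
    and irreducible: "irreducible_conf_module (k_alg n) M"
begin

text \<open>The form in which irreducibility is used: a property that defines a graded submodule and
  holds for one nonzero vector holds for all vectors. It is enough to check even components in
  \<open>gr\<close>, the odd ones being differences.\<close>

lemma submodule_cases:
  assumes N: "0 \<in> N" "\<And>v w. v \<in> N \<Longrightarrow> w \<in> N \<Longrightarrow> v + w \<in> N" "\<And>c v. v \<in> N \<Longrightarrow> csc c v \<in> N"
    "\<And>v. v \<in> N \<Longrightarrow> D v \<in> N" "\<And>g k v. v \<in> N \<Longrightarrow> mode g k v \<in> N"
    and gr: "\<And>x y. x + y \<in> N \<Longrightarrow> x \<in> grade M 0 \<Longrightarrow> y \<in> grade M 1 \<Longrightarrow> x \<in> N"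
    and x: "x \<in> N" "x \<noteq> 0"
  shows "v \<in> N"
proof -
  have psc: "psc p v \<in> N" if "v \<in> N" for p v
  proof (induction p)
    case 0
    then show ?case using N(1) by simp
  next
    case (pCons a p)
    then show ?case using N that by (simp add: psc_pCons)
  qed
  have "conf_submodule (k_alg n) M N"
    unfolding conf_submodule_def
  proof (intro conjI)
    show "PM.subspace N" unfolding PM.subspace_def using N(1,2) psc by auto
    show "N \<subseteq> {x + y | x y. x \<in> N \<inter> grade M 0 \<and> y \<in> N \<inter> grade M 1}"
    proof
      fix v assume v: "v \<in> N"
      have "v \<in> carrier_of M" using carrier_M by simp
      then obtain x y where xy: "v = x + y" "x \<in> grade M 0" "y \<in> grade M 1" unfolding carrier_of_def by blast
      have "x \<in> N" using gr v xy by simp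
      moreover have "y = v + csc (- 1) x" using xy by simp
      then have "y \<in> N" using N(2,3) v \<open>x \<in> N\<close> by metis
      ultimately show "v \<in> {x + y | x y. x \<in> N \<inter> grade M 0 \<and> y \<in> N \<inter> grade M 1}" using xy by blast
    qed
    show "\<forall>a\<in>carrier_of (k_alg n). \<forall>v\<in>N. \<forall>k. coeff (act M a v) k \<in> N"
      using act_in[OF N(1-3), of N] N(5) by blast
  qed
  then have "N = UNIV" using irreducible x unfolding irreducible_conf_module_def by blast
  then show ?thesis by simp
qed

lemma grade_direct:
  assumes "x + y = 0" "x \<in> grade M i" "y \<in> grade M (i + 1)"
  shows "x = 0"
proof -
  have "y = csc (- 1) x" using assms(1) by (simp add: eq_neg_iff_add_eq_0 add.commute)
  then have "y \<in> grade M i" using assms(2) PM.subspace_scale[OF M.subspace_grade] by (simp add: cscale_def)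
  then have "y \<in> grade M 0 \<inter> grade M 1" using assms(3) by (cases "i = 0") auto
  then have "y = 0" using M.grade_Int by blast
  then show ?thesis using assms(1) by simp
qed

lemma grade_decomp: obtains x y where "v = x + y" "x \<in> grade M 0" "y \<in> grade M 1"
proof -
  have "v \<in> carrier_of M" using carrier_M by simp
  then show ?thesis using that unfolding carrier_of_def by blast
qed

text \<open>The images of the two homogeneous components have different parities, so they can cancel
  only if both vanish.\<close>

lemma kernel_graded:
  assumes T: "\<And>v w. T (v + w) = T v + T w" "\<And>j v. v \<in> grade M j \<Longrightarrow> T v \<in> grade M (i + j)"
    and "T (x + y) = 0" "x \<in> grade M 0" "y \<in> grade M 1"
  shows "T x = 0"
proof (rule grade_direct[of _ "T y" i])
  show "T x + T y = 0" using assms by simp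
  have "T x \<in> grade M (i + 0)" using assms by blast
  then show "T x \<in> grade M i" by (simp only: add_0_right)
  show "T y \<in> grade M (i + 1)" using assms by blast
qed

lemma mode_kernel_graded:
  "mode g k (x + y) = 0 \<Longrightarrow> x \<in> grade M 0 \<Longrightarrow> y \<in> grade M 1 \<Longrightarrow> mode g k x = 0"
  by (rule kernel_graded[of "mode g k" "kparity g"]) (simp_all only: mode_add mode_grade)

text \<open>The vectors killed by all modes form a submodule. If it contained a nonzero vector, it
  would be the whole module and the action would be trivial.\<close>

lemma mode_all_0: "(\<And>g k. mode g k v = 0) \<Longrightarrow> v = 0"
proof (rule ccontr)
  assume v: "\<And>g k. mode g k v = 0" "v \<noteq> 0"
  define N where "N = {v. \<forall>g k. mode g k v = 0}"
  have "w \<in> N" for w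
  proof (rule submodule_cases[of N v])
    show "csc c v \<in> N" if "v \<in> N" for c v using that by (simp add: N_def mode_csc)
    show "D v \<in> N" if "v \<in> N" for v using that by (simp add: N_def mode_D)
    show "x \<in> N" if "x + y \<in> N" "x \<in> grade M 0" "y \<in> grade M 1" for x y
      using that mode_kernel_graded unfolding N_def by blast
  qed (use v in \<open>auto simp: N_def mode_add\<close>)
  then have "mode g k w = 0" for g k w by (simp add: N_def)
  then have "coeff (act M a w) k \<in> {0}" if "a \<in> carrier_of (k_alg n)" for a w k
    using that by (intro act_in[of _ UNIV]) auto
  then have "act M a w = 0" if "a \<in> carrier_of (k_alg n)" for a w
    using that by (intro poly_eqI) auto
  then show False using nontrivial unfolding nontrivial_conf_module_def by blast
qed

text \<open>Some generator \<open>g\<close> acts on \<open>v\<close> with a nonzero coefficient. If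
  \<open>K\<close> is the highest such degree, then the coefficient of degree \<open>K\<close> + deg
  \<open>p\<close> of \<open>g\<close> on p(\<partial>) v is a nonzero multiple of the one at
  \<open>K\<close>.\<close>

lemma torsion_free:
  assumes "psc p v = 0" "p \<noteq> 0"
  shows "v = 0"
proof (rule ccontr)
  assume "v \<noteq> 0"
  then obtain g k where gk: "dmode g k v \<noteq> 0" using mode_all_0 mode_eq_0_iff by blast
  obtain B where B: "\<And>k. k \<ge> B \<Longrightarrow> dmode g k v = 0" using dmode_finite by blast
  have fin: "finite {k. dmode g k v \<noteq> 0}" by (rule finite_subset[of _ "{..<B}"]) (use B not_le in auto)
  define K where "K = Max {k. dmode g k v \<noteq> 0}"
  have K: "dmode g K v \<noteq> 0" using Max_in[OF fin] gk unfolding K_def by blast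
  have top: "dmode g k v = 0" if "k > K" for k using Max_ge[OF fin, of k] that unfolding K_def by fastforce
  have "csc (coeff p (degree p)) (dmode g K v) = 0"
    using dmode_psc_top[of K g v p "degree p"] top assms(1) dmode_csc[of g "K + degree p" 0 0] by simp
  then show False using K assms(2) by simp
qed

end

section \<open>Highest vectors\<close>

context kirreducible
begin

text \<open>Apply \<open>g\<^sub>\<lambda>\<close> to the relation and compare the coefficients of the highest power of \<open>\<lambda>\<close>.\<close>

lemma top_relation:
  assumes "finite I" "(\<Sum>i\<in>I. psc (p i) (f i)) = 0" "\<exists>i\<in>I. p i \<noteq> 0"
  shows "\<exists>c. (\<exists>i\<in>I. c i \<noteq> 0) \<and>
    (\<forall>g K. (\<forall>i\<in>I. \<forall>k>K. mode g k (f i) = 0) \<longrightarrow> (\<Sum>i\<in>I. csc (c i) (mode g K (f i))) = 0)"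
proof -
  let ?S = "{i \<in> I. p i \<noteq> 0}"
  define m where "m = Max ((\<lambda>i. degree (p i)) ` ?S)"
  have "m \<in> (\<lambda>i. degree (p i)) ` ?S" unfolding m_def using assms by (intro Max_in) auto
  then obtain i where i: "i \<in> I" "p i \<noteq> 0" "degree (p i) = m" by auto
  have le: "degree (p j) \<le> m" if "j \<in> I" for j
  proof (cases "p j = 0")
    case False
    then show ?thesis unfolding m_def using that assms(1) by (intro Max_ge) auto
  qed simp
  show ?thesis
  proof (intro exI[of _ "\<lambda>i. coeff (p i) m"] conjI allI impI)
    show "\<exists>i\<in>I. coeff (p i) m \<noteq> 0" using i by (metis leading_coeff_0_iff)
    fix g K assume K: "\<forall>i\<in>I. \<forall>k>K. mode g k (f i) = 0"
    have "0 = dmode g (K + m) (\<Sum>i\<in>I. psc (p i) (f i))"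
      using assms(2) dmode_sum[of g "K + m" "\<lambda>_. 0" "{}"] by simp
    also have "\<dots> = (\<Sum>i\<in>I. csc (coeff (p i) m) (dmode g K (f i)))"
      unfolding dmode_sum using K le by (intro sum.cong refl dmode_psc_top) (auto simp: mode_eq_0_iff)
    finally have "csc (fact K) (\<Sum>i\<in>I. csc (coeff (p i) m) (dmode g K (f i))) = 0" by simp
    then show "(\<Sum>i\<in>I. csc (coeff (p i) m) (mode g K (f i))) = 0"
      by (simp add: mode_def CV.scale_sum_right mult.commute)
  qed
qed

text \<open>An increasing family of subspaces that exhausts the module. The least nonzero one turns
  out to be finite-dimensional, and it is stable under all modes of nonnegative energy.\<close>

definition level :: "int \<Rightarrow> 'm set" where
  "level d = {v. \<forall>g k. energy g k \<ge> d \<longrightarrow> mode g k v = 0}"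

lemma level_subspace: "0 \<in> level d" "v \<in> level d \<Longrightarrow> w \<in> level d \<Longrightarrow> v + w \<in> level d" "v \<in> level d \<Longrightarrow> csc c v \<in> level d"
  by (auto simp: level_def mode_add mode_csc)

text \<open>Commuting a mode of nonnegative energy past one of energy at least \<open>d\<close>
  produces only modes of energy at least \<open>d\<close>, which kill \<open>v\<close>.\<close>

lemma level_stable:
  assumes "v \<in> level d" "energy h j \<ge> 0"
  shows "mode h j v \<in> level d"
  unfolding level_def
proof (clarify)
  fix g k assume g: "energy g k \<ge> d"
  have "mode g k (mode h j v) = koszul (kparity g) (kparity h) (mode h j (mode g k v))"
    by (rule mode_swap) (use assms g in \<open>auto simp: level_def\<close>)
  then show "mode g k (mode h j v) = 0" using assms g by (simp add: level_def koszul_def)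
qed

lemma weight_bounds: "weight g \<ge> - 2 * int n" "kindex g \<le> n \<Longrightarrow> weight g \<le> 2 * int n"
  by (cases g; simp)+

lemma finite_gens: "finite {g. kindex g \<le> n}"
proof -
  have "{g. kindex g \<le> n} \<subseteq> L ` {..n} \<union> J ` {..n} \<union> Gp ` {..n} \<union> Gm ` {..n}"
  proof
    fix g assume "g \<in> {g. kindex g \<le> n}"
    then show "g \<in> L ` {..n} \<union> J ` {..n} \<union> Gp ` {..n} \<union> Gm ` {..n}" by (cases g) auto
  qed
  then show ?thesis by (rule finite_subset) simp
qed

text \<open>No mode has energy below -2 n, so vectors of such a level are killed by all modes and
  vanish by \<open>mode_all_0\<close>.\<close>

lemma level_low: "d \<le> - 2 * int n \<Longrightarrow> level d = {0}"
proof -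
  assume d: "d \<le> - 2 * int n"
  have "energy g k \<ge> d" for g k
    using weight_bounds(1)[of g] d by (auto simp: energy_def intro: order_trans)
  then show ?thesis using mode_all_0 level_subspace(1) unfolding level_def by auto
qed

text \<open>Each generator has only finitely many nonzero modes on \<open>v\<close>, and there are
  only finitely many generators of index at most n.\<close>

lemma level_exhaust: "\<exists>d. v \<in> level d"
proof -
  obtain K where K: "\<And>g k. k \<ge> K g \<Longrightarrow> mode g k v = 0"
    using dmode_finite[of _ v] unfolding mode_eq_0_iff by metis
  define B where "B = Max (K ` {g. kindex g \<le> n})"
  have B: "mode g k v = 0" if "k \<ge> B" for g k
  proof (cases "kindex g \<le> n")
    case True
    then have "K g \<le> B" unfolding B_def using finite_gens by (intro Max_ge) auto
    then show ?thesis using K that by simp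
  qed (simp add: mode_index)
  have "mode g k v = 0" if "energy g k \<ge> 2 * int n * int B + 2 * int n + 1" for g k
  proof (cases "kindex g \<le> n")
    case True
    then have "2 * int n * int k \<ge> 2 * int n * int B"
      using that weight_bounds(2)[OF True] by (simp add: energy_def)
    then have "k \<ge> B" using n1 by simp
    then show ?thesis by (rule B)
  qed (simp add: mode_index)
  then show ?thesis unfolding level_def by blast
qed

lemma critical_level: "\<exists>d. level d \<noteq> {0} \<and> (\<forall>d'<d. level d' = {0})"
proof -
  \<comment> \<open>Levels at or below -2 n are zero, so shifting by 2 n moves the search for the
    least nonzero level to the natural numbers.\<close>
  define P where "P = (\<lambda>e::nat. level (int e - 2 * int n) \<noteq> {0})"
  obtain v :: 'm where v: "v \<noteq> 0"
    using irreducible unfolding irreducible_conf_module_def by auto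
  obtain d where d: "v \<in> level d" using level_exhaust by blast
  have "d > - 2 * int n" using level_low[of d] d v by (cases "d \<le> - 2 * int n") auto
  then have "int (nat (d + 2 * int n)) - 2 * int n = d" by simp
  then have "P (nat (d + 2 * int n))" unfolding P_def using d v by auto
  then have 1: "P (LEAST e. P e)" by (rule LeastI)
  define e where "e = (LEAST e. P e)"
  have "level d' = {0}" if "d' < int e - 2 * int n" for d'
  proof (cases "d' \<le> - 2 * int n")
    case False
    then have eq: "int (nat (d' + 2 * int n)) - 2 * int n = d'" by simp
    have "nat (d' + 2 * int n) < e" using that False by linarith
    then have "\<not> P (nat (d' + 2 * int n))" unfolding e_def by (rule not_less_Least)
    then show ?thesis unfolding P_def eq by blast
  qed (rule level_low)
  moreover have "level (int e - 2 * int n) \<noteq> {0}" using 1 unfolding P_def e_def .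
  ultimately show ?thesis by (intro exI[of _ "int e - 2 * int n"]) simp
qed

lemma rank_relation:
  "\<exists>r. \<forall>f :: nat \<Rightarrow> 'm. \<exists>p. (\<exists>i\<le>r. p i \<noteq> 0) \<and> (\<Sum>i\<le>r. psc (p i) (f i)) = 0"
proof -
  obtain B where B: "finite B" "module.span psc B = UNIV"
    using finite_gen unfolding finite_conf_module_def by blast
  have "\<exists>p. (\<exists>i\<in>{..card B}. p i \<noteq> 0) \<and> (\<Sum>i\<in>{..card B}. psc (p i) (f i)) = 0" for f :: "nat \<Rightarrow> 'm"
    by (rule rank_bound[OF M.module_pscale B]) auto
  then show ?thesis unfolding Bex_def atMost_iff by blast
qed

text \<open>The top coefficients of a relation over \<open>\<complex>[\<partial>]\<close> between elements of level \<open>d\<close> combine to an element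
  of level \<open>d - 2 n\<close>. If there are no such elements, the rank bounds the dimension over \<open>\<complex>\<close>.\<close>

lemma fin_dep_critical:
  assumes d: "\<And>d'. d' < d \<Longrightarrow> level d' = {0}"
  shows "CV.fin_dep (level d)"
proof -
  obtain r where r: "\<And>f :: nat \<Rightarrow> 'm. \<exists>p. (\<exists>i\<le>r. p i \<noteq> 0) \<and> (\<Sum>i\<le>r. psc (p i) (f i)) = 0"
    using rank_relation by blast
  have "\<exists>c. (\<exists>j\<le>r. c j \<noteq> 0) \<and> (\<Sum>j\<le>r. csc (c j) (f j)) = 0" if f: "\<forall>j\<le>r. f j \<in> level d" for f
  proof -
    obtain p where p: "\<exists>i\<le>r. p i \<noteq> 0" "(\<Sum>i\<le>r. psc (p i) (f i)) = 0" using r by blast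
    obtain c where c: "\<exists>i\<in>{..r}. c i \<noteq> 0"
      "\<forall>g K. (\<forall>i\<in>{..r}. \<forall>k>K. mode g k (f i) = 0) \<longrightarrow> (\<Sum>i\<in>{..r}. csc (c i) (mode g K (f i))) = 0"
      using top_relation[of "{..r}" p f] p by auto
    have "(\<Sum>i\<le>r. csc (c i) (f i)) \<in> level (d - 2 * int n)"
      unfolding level_def
    proof (clarify)
      fix g K assume "energy g K \<ge> d - 2 * int n"
      moreover have "2 * int n * int k \<ge> 2 * int n * int K + 2 * int n" if "k > K" for k
      proof -
        have "int k \<ge> int K + 1" using that by simp
        then have "2 * int n * int k \<ge> 2 * int n * (int K + 1)" by (intro mult_left_mono) auto
        then show ?thesis by (simp add: algebra_simps)
      qed
      ultimately have "energy g k \<ge> d" if "k > K" for k using that by (fastforce simp: energy_def)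
      then have "\<forall>i\<in>{..r}. \<forall>k>K. mode g k (f i) = 0" using f by (auto simp: level_def)
      then show "mode g K (\<Sum>i\<le>r. csc (c i) (f i)) = 0" using c(2) by (simp add: mode_sum mode_csc)
    qed
    then have "(\<Sum>i\<le>r. csc (c i) (f i)) = 0" using d[of "d - 2 * int n"] n1 by auto
    then show ?thesis using c(1) by auto
  qed
  then show ?thesis unfolding CV.fin_dep_def by blast
qed

lemma finite_level: obtains d where "CV.fin_dep (level d)" "level d \<noteq> {0}"
proof -
  obtain d where "level d \<noteq> {0}" "\<forall>d'<d. level d' = {0}" using critical_level by blast
  then show ?thesis using that[of d] fin_dep_critical[of d] by blast
qed

lemma energy_shift:
  "mode (L 0) 1 (mode g k v) = mode g k (mode (L 0) 1 v) + csc (of_int (energy g k) / 2) (mode g k v)"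
proof (cases g)
  case (L j)
  have "of_int (energy g k) / 2 = (cn j - cn n) * cn 1 - (cn 0 - cn n) * cn k"
    by (simp add: L energy_def half_def field_simps)
  then show ?thesis
    using commute_modes(1)[of 0 1 j k v] by (simp only: L add_0 diff_add_inverse)
next
  case (J j)
  have "of_int (energy g k) / 2 = cn j * cn 1 - (cn 0 - cn n) * cn k"
    by (simp add: J energy_def half_def field_simps)
  then show ?thesis
    using commute_modes(2)[of 0 1 j k v] by (simp only: J add_0 diff_add_inverse)
next
  case (Gp j)
  have "of_int (energy g k) / 2 = (cn j - half n) * cn 1 - (cn 0 - cn n) * cn k"
    by (simp add: Gp energy_def half_def field_simps)
  then show ?thesis
    using commute_modes(4)[of 0 1 j k v] by (simp only: Gp add_0 diff_add_inverse)
next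
  case (Gm j)
  have "of_int (energy g k) / 2 = (cn j - half n) * cn 1 - (cn 0 - cn n) * cn k"
    by (simp add: Gm energy_def half_def field_simps)
  then show ?thesis
    using commute_modes(5)[of 0 1 j k v] by (simp only: Gm add_0 diff_add_inverse)
qed

lemma eigen_graded:
  assumes T: "\<And>v w. T (v + w) = T v + T w" "\<And>j v. v \<in> grade M j \<Longrightarrow> T v \<in> grade M j"
    and "T (x + y) = csc c (x + y)" "x \<in> grade M 0" "y \<in> grade M 1"
  shows "T x = csc c x"
proof -
  have "T x + csc (- c) x = 0"
  proof (rule kernel_graded[of "\<lambda>v. T v + csc (- c) v" 0])
    show "T (v + w) + csc (- c) (v + w) = T v + csc (- c) v + (T w + csc (- c) w)" for v w
      by (simp add: T CV.scale_right_distrib)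
    show "T v + csc (- c) v \<in> grade M (0 + j)" if "v \<in> grade M j" for j v
      unfolding add_0_left cscale_def
      using that T(2) by (intro PM.subspace_add[OF M.subspace_grade] PM.subspace_scale[OF M.subspace_grade])
  qed (use assms in simp_all)
  then show ?thesis by simp
qed

lemma mode_even: "kparity g = 0 \<Longrightarrow> v \<in> grade M j \<Longrightarrow> mode g k v \<in> grade M j"
  using mode_grade[of v j g k] by (simp only: add_0_left)

lemma level_graded:
  assumes "x + y \<in> level d" "x \<in> grade M 0" "y \<in> grade M 1"
  shows "x \<in> level d" "y \<in> level d"
proof -
  show x: "x \<in> level d" using assms mode_kernel_graded unfolding level_def by blast
  have "y = (x + y) + csc (- 1) x" by simp
  then show "y \<in> level d" using level_subspace assms(1) x by metis
qed

text \<open>Schur's lemma. An operator commuting with all modes preserves every level and so has an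
  eigenvector in a finite-dimensional one; its eigenspace is a submodule, graded because the
  operator is even.\<close>

lemma central_scalar:
  assumes T: "\<And>v w. T (v + w) = T v + T w" "\<And>c v. T (csc c v) = csc c (T v)"
    "\<And>v. T (D v) = D (T v)" "\<And>g k v. T (mode g k v) = mode g k (T v)"
    and gr: "\<And>j v. v \<in> grade M j \<Longrightarrow> T v \<in> grade M j"
  shows "\<exists>c. \<forall>v. T v = csc c v"
proof -
  obtain d where d: "CV.fin_dep (level d)" "level d \<noteq> {0}" by (rule finite_level)
  then obtain w where w: "w \<in> level d" "w \<noteq> 0" using level_subspace(1) by blast
  have T0: "T 0 = 0" using T(2)[of 0 0] by simp
  have "T v \<in> level d" if "v \<in> level d" for v using that T0 by (auto simp: level_def T(4)[symmetric])
  then obtain c x where x: "x \<in> level d" "x \<noteq> 0" "T x = csc c x"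
    using eigenvector_exists[OF CV.complex_vector_space_axioms T(1,2) level_subspace _ d(1) w] by blast
  have "v \<in> {v. T v = csc c v}" for v
  proof (rule submodule_cases[of _ x])
    show "x \<in> {v. T v = csc c v}" if "x + y \<in> {v. T v = csc c v}" "x \<in> grade M 0" "y \<in> grade M 1" for x y
      using eigen_graded[OF T(1) gr] that by blast
  qed (use x T0 in \<open>auto simp: T CV.scale_right_distrib mult.commute D_csc mode_csc\<close>)
  then show ?thesis by blast
qed

text \<open>Modes of positive energy add a positive real number to the eigenvalue of
  \<open>mode (L 0) 1\<close>. An eigenvector in the finite-dimensional level whose eigenvalue has
  maximal real part is therefore killed by all of them.\<close>

lemma highest_vector:
  obtains v p \<theta> \<Lambda> where "v \<noteq> 0" "v \<in> grade M p" "\<And>g k. energy g k > 0 \<Longrightarrow> mode g k v = 0"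
    "mode (L 0) 1 v = csc \<theta> v" "mode (J 0) 0 v = csc \<Lambda> v"
proof -
  obtain d where d: "CV.fin_dep (level d)" "level d \<noteq> {0}" by (rule finite_level)
  then obtain w0 where w0: "w0 \<in> level d" "w0 \<noteq> 0" using level_subspace(1) by blast
  let ?T = "mode (L 0) 1"
  have st: "?T v \<in> level d" if "v \<in> level d" for v using that by (intro level_stable) (auto simp: energy_def)
  define E where "E = {\<theta>. \<exists>w\<in>level d. w \<noteq> 0 \<and> ?T w = csc \<theta> w}"
  have fE: "finite E" unfolding E_def by (rule CV.finite_eigenvalues[OF mode_add mode_csc d(1)])
  have "E \<noteq> {}"
    unfolding E_def
    using eigenvector_exists[OF CV.complex_vector_space_axioms mode_add mode_csc level_subspace st d(1) w0] by blast
  then have "Max (Re ` E) \<in> Re ` E" using fE by (intro Max_in) auto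
  then obtain \<theta> where \<theta>: "\<theta> \<in> E" "Re \<theta> = Max (Re ` E)" by auto
  have max: "Re \<theta>' \<le> Re \<theta>" if "\<theta>' \<in> E" for \<theta>' unfolding \<theta>(2) using fE that by (intro Max_ge) auto
  have kill: "mode g k w = 0" if w: "w \<in> level d" "?T w = csc \<theta> w" and g: "energy g k > 0" for w g k
  proof (rule ccontr)
    assume "mode g k w \<noteq> 0"
    moreover have "mode g k w \<in> level d" using w g by (intro level_stable) auto
    moreover have "?T (mode g k w) = csc (\<theta> + of_int (energy g k) / 2) (mode g k w)"
      unfolding energy_shift w(2) mode_csc by (simp add: CV.scale_left_distrib)
    ultimately have "\<theta> + of_int (energy g k) / 2 \<in> E" unfolding E_def by blast
    from max[OF this] g show False by simp
  qed
  obtain w where w: "w \<in> level d" "w \<noteq> 0" "?T w = csc \<theta> w" using \<theta>(1) unfolding E_def by blast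
  obtain x y where xy: "w = x + y" "x \<in> grade M 0" "y \<in> grade M 1" by (rule grade_decomp)
  have x: "x \<in> level d" "?T x = csc \<theta> x" and y: "y \<in> level d"
    using level_graded[of x y] eigen_graded[of ?T x y \<theta>] w xy mode_add mode_even[of "L 0"] by auto
  have "?T y = csc \<theta> y"
    using w(3) x(2) unfolding xy(1) by (simp add: mode_add CV.scale_right_distrib)
  \<comment> \<open>Both homogeneous components of \<open>w\<close> lie in the level and satisfy the
    eigenvalue equation, and at least one of them is nonzero.\<close>
  with x y w xy obtain u p where u: "u \<in> level d" "u \<noteq> 0" "?T u = csc \<theta> u" "u \<in> grade M p"
    by (metis add_0_left)
  \<comment> \<open>\<open>mode (J 0) 0\<close> is even and of energy 0, so it preserves the level,
    the eigenspace and the parity and has an eigenvector in their intersection.\<close>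
  define S where "S = {v \<in> level d. ?T v = csc \<theta> v \<and> v \<in> grade M p}"
  have gs: "0 \<in> grade M p" "v \<in> grade M p \<Longrightarrow> w \<in> grade M p \<Longrightarrow> v + w \<in> grade M p"
    "v \<in> grade M p \<Longrightarrow> csc c v \<in> grade M p" for v w c
    using M.subspace_grade[of p] unfolding PM.subspace_def cscale_def by auto
  have S: "0 \<in> S" "v \<in> S \<Longrightarrow> w \<in> S \<Longrightarrow> v + w \<in> S" "v \<in> S \<Longrightarrow> csc c v \<in> S" for v w c
    unfolding S_def using gs level_subspace by (auto simp: mode_add mode_csc CV.scale_right_distrib mult.commute)
  have J: "mode (J 0) 0 v \<in> S" if "v \<in> S" for v
  proof -
    have "energy (J 0) 0 = 0" by (simp add: energy_def)
    then show ?thesis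
      using that level_stable[of v d "J 0" 0] mode_even[of "J 0" v p 0] energy_shift[of "J 0" 0 v]
      unfolding S_def by (simp add: mode_csc)
  qed
  have "CV.fin_dep S" by (rule CV.fin_dep_subset[OF d(1)]) (auto simp: S_def)
  moreover have "u \<in> S" using u by (simp add: S_def)
  ultimately obtain \<Lambda> v where "v \<in> S" "v \<noteq> 0" "mode (J 0) 0 v = csc \<Lambda> v"
    using eigenvector_exists[OF CV.complex_vector_space_axioms mode_add mode_csc S J _ _ u(2)] by blast
  then show ?thesis using that[of v p \<theta> \<Lambda>] kill unfolding S_def by blast
qed

end

section \<open>Modes of positive index\<close>

context kirreducible
begin

text \<open>Counterpart of \<open>mode_swap\<close> by index instead of energy: every generator in
  the bracket of \<open>g\<close> and \<open>h\<close> has the sum of their indices.\<close>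

lemma supercommute:
  assumes "\<And>w k. kindex w = kindex g + kindex h \<Longrightarrow> mode w k u = 0"
  shows "mode g a (mode h b u) = koszul (kparity g) (kparity h) (mode h b (mode g a u))"
proof -
  have ind: "kindex w = kindex g + kindex h" if "(A, B, C, w) \<in> set (kbracket_coeffs n g h)" for A B C w
    using kbracket_values_index that by (fastforce simp: kbracket_coeffs_def)
  have "(\<Sum>(A, B, C, w)\<leftarrow>xs. csc C (mode w (a + b) u) + csc (B * of_nat a - A * of_nat (a + b)) (mode w (a + b - 1) u)) = 0"
    if "set xs \<subseteq> set (kbracket_coeffs n g h)" for xs
    using that by (induction xs) (auto simp: assms[OF ind] split: prod.splits)
  then show ?thesis using mode_bracket[of g a h b u] by simp
qed

text \<open>For i = n and a = 0 the factors in the relations for \<open>L i\<close> vanish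
  identically, so this even operator commutes with all modes; as a mode of number 0 it also commutes
  with \<partial>.\<close>

lemma Ln_scalar: "\<exists>c. \<forall>w. mode (L n) 0 w = csc c w"
proof (rule central_scalar)
  show "mode (L n) 0 (D v) = D (mode (L n) 0 v)" for v by (simp add: mode_D)
  show "mode (L n) 0 (mode g k v) = mode g k (mode (L n) 0 v)" for g k v
    by (cases g) (simp_all add: commute_modes(1,2,4,5)[of n 0])
qed (simp_all only: mode_add mode_csc mode_even kparity.simps)

lemma L0_commute: "mode (L 0) 0 (mode g k v) = mode g k (mode (L 0) 0 v) + csc (cn n * cn k) (mode g (k - 1) v)"
  by (cases g) (simp_all add: commute_modes(1,2,4,5)[of 0 0])

text \<open>The commutator of \<open>mode (L 0) 0\<close> with \<open>mode g k\<close> is n k times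
  \<open>mode g (k - 1)\<close>, and that of n \<partial> is the opposite, so the sum of the two
  operators is central.\<close>

lemma L0_scalar: "\<exists>\<alpha>. \<forall>w. mode (L 0) 0 w = csc (- cn n) (D w + csc \<alpha> w)"
proof -
  let ?T = "\<lambda>w. mode (L 0) 0 w + csc (cn n) (D w)"
  have "\<exists>c. \<forall>w. ?T w = csc c w"
  proof (rule central_scalar)
    show "?T (D v) = D (?T v)" for v by (simp add: mode_D D_add D_csc)
    show "?T (mode g k v) = mode g k (?T v)" for g k v
      unfolding L0_commute by (simp add: mode_add mode_csc mode_D CV.scale_right_distrib)
    have gs: "v + w \<in> grade M p" "csc c v \<in> grade M p" if "v \<in> grade M p" "w \<in> grade M p" for v w c p
      using that M.subspace_grade[of p] unfolding PM.subspace_def cscale_def by auto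
    have "D v \<in> grade M j" if "v \<in> grade M j" for v j
      using that M.subspace_grade[of j] unfolding PM.subspace_def deriv_of_def by auto
    then show "?T v \<in> grade M j" if "v \<in> grade M j" for v j
      using that by (intro gs mode_even) auto
  qed (simp_all add: mode_add mode_csc D_add D_csc CV.scale_right_distrib mult.commute)
  then obtain c where c: "\<And>w. ?T w = csc c w" by blast
  show ?thesis
  proof (intro exI[of _ "- c / cn n"] allI)
    fix w
    have "mode (L 0) 0 w = csc c w - csc (cn n) (D w)" using c[of w] by (simp add: eq_diff_eq)
    then show "mode (L 0) 0 w = csc (- cn n) (D w + csc (- c / cn n) w)"
      using n1 by (simp add: CV.scale_right_distrib CV.scale_right_diff_distrib)
  qed
qed

end

text \<open>The highest vector is arbitrary rather than the one just constructed, because in the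
  degenerate cases the context is instantiated a second time, at \<open>P\<close> or
  \<open>Q\<close>.\<close>

locale khighest = kirreducible n M for n :: nat and M :: "('m::ab_group_add, kelem) conf_mod" +
  fixes v :: 'm and p :: bit and \<theta> \<Lambda> c \<alpha> :: complex
  assumes v0: "v \<noteq> 0" and vgr: "v \<in> grade M p"
    and kill: "\<And>g k. energy g k > 0 \<Longrightarrow> mode g k v = 0"
    and L01: "mode (L 0) 1 v = csc \<theta> v" and J00: "mode (J 0) 0 v = csc \<Lambda> v"
    and c: "\<And>w. mode (L n) 0 w = csc c w"
    and L00: "\<And>w. mode (L 0) 0 w = csc (- cn n) (D w + csc \<alpha> w)"
begin

lemma power_energy: "mode (L 0) 1 ((mode (L i) 0 ^^ b) v) = csc (\<theta> + cn b * (cn i - cn n)) ((mode (L i) 0 ^^ b) v)"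
proof (induction b)
  case 0
  then show ?case using L01 by simp
next
  case (Suc b)
  have d: "of_int (energy (L i) 0) / 2 = cn i - cn n" by (simp add: energy_def field_simps)
  show ?case
    unfolding funpow.simps comp_def energy_shift Suc mode_csc d CV.scale_left_distrib[symmetric]
    by (rule arg_cong[where f="\<lambda>e. csc e _"]) (simp add: algebra_simps)
qed

text \<open>A relation over \<complex>[\<partial>] between the powers of \<open>mode (L i) 0\<close>
  on \<open>v\<close> becomes, by \<open>top_relation\<close> at \<open>K\<close> = 0, a relation
  over \<complex> between the powers with exponents b + e'. For i < n these have pairwise different
  eigenvalues under \<open>mode (L 0) 1\<close>, so one of them is zero.\<close>

lemma power_relation:
  assumes i: "i < n" and K: "\<And>b k. k > 0 \<Longrightarrow> mode g k ((mode (L i) 0 ^^ b) v) = 0"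
    and 0: "\<And>b. mode g 0 ((mode (L i) 0 ^^ b) v) = csc e ((mode (L i) 0 ^^ (b + e')) v)" and e: "e \<noteq> 0"
  shows "\<exists>b. (mode (L i) 0 ^^ b) v = 0"
proof -
  let ?y = "mode (L i) 0"
  obtain r where r: "\<And>f :: nat \<Rightarrow> 'm. \<exists>p. (\<exists>i\<le>r. p i \<noteq> 0) \<and> (\<Sum>i\<le>r. psc (p i) (f i)) = 0"
    using rank_relation by blast
  from r[of "\<lambda>b. (?y ^^ b) v"] obtain q where q: "\<exists>b\<le>r. q b \<noteq> 0" "(\<Sum>b\<le>r. psc (q b) ((?y ^^ b) v)) = 0"
    by blast
  have "\<exists>i\<in>{..r}. q i \<noteq> 0" using q(1) by auto
  from top_relation[OF finite_atMost q(2) this] obtain a where a: "\<exists>b\<in>{..r}. a b \<noteq> 0"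
    "\<forall>g K. (\<forall>b\<in>{..r}. \<forall>k>K. mode g k ((?y ^^ b) v) = 0) \<longrightarrow> (\<Sum>b\<in>{..r}. csc (a b) (mode g K ((?y ^^ b) v))) = 0"
    by blast
  then have "(\<Sum>b\<in>{..r}. csc (a b) (mode g 0 ((?y ^^ b) v))) = 0" using K by blast
  then have s: "(\<Sum>b\<le>r. csc (a b * e) ((?y ^^ (b + e')) v)) = 0" by (simp add: 0)
  obtain b where b: "b \<le> r" "a b \<noteq> 0" using a(1) by auto
  have "csc (a b * e) ((?y ^^ (b + e')) v) = 0"
  proof (rule CV.sum_eigenvectors_zero[OF mode_add mode_csc _ _ _ s])
    show "inj_on (\<lambda>b. \<theta> + cn (b + e') * (cn i - cn n)) {..r}"
      using i by (auto simp: inj_on_def)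
    show "mode (L 0) 1 (csc (a b * e) ((?y ^^ (b + e')) v)) =
      csc (\<theta> + cn (b + e') * (cn i - cn n)) (csc (a b * e) ((?y ^^ (b + e')) v))" for b
      unfolding mode_csc power_energy by (simp only: CV.scale_scale mult.commute)
  qed (use b in auto)
  then show ?thesis using b e by auto
qed

text \<open>The commutator of \<open>L\<^sub>n\<^sub>-\<^sub>1\<^sub>(\<^sub>1\<^sub>)\<close> and \<open>L\<^sub>1\<^sub>(\<^sub>0\<^sub>)\<close> is a multiple of \<open>c\<close>, as in a Heisenberg algebra, so no power of
  \<open>L\<^sub>1\<^sub>(\<^sub>0\<^sub>)\<close> can kill \<open>v\<close> unless \<open>c = 0\<close>.\<close>

lemma c_zero:
  assumes n: "n > 1"
  shows "c = 0"
proof (rule ccontr)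
  assume c0: "c \<noteq> 0"
  let ?y = "mode (L 1) 0"
  have Ln: "mode (L n) k ((?y ^^ b) v) = 0" if "k > 0" for k b
  proof (induction b)
    case 0
    have "energy (L n) k > 0" using that n1 by (simp add: energy_def)
    then show ?case using kill by simp
  next
    case (Suc b)
    have "mode (L n) k (?y u) = ?y (mode (L n) k u)" for u
      using supercommute[of "L n" "L 1" u k 0] by (simp add: mode_index koszul_def)
    then show ?case using Suc by simp
  qed
  have "\<exists>b. (?y ^^ b) v = 0"
    by (rule power_relation[OF n, where g="L n" and e=c and e'=0]) (erule Ln, simp only: c add_0_right, rule c0)
  moreover have "(?y ^^ b) v \<noteq> 0 \<and> mode (L (n - 1)) 1 ((?y ^^ Suc b) v) = csc (cn (Suc b) * (1 - cn n) * c) ((?y ^^ b) v)" for b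
  proof (induction b)
    case 0
    have z: "mode (L (n - 1)) 1 (?y u) = ?y (mode (L (n - 1)) 1 u) + csc ((1 - cn n) * c) u" for u
      using commute_modes(1)[of "n - 1" 1 1 0 u] n by (simp add: c)
    have "energy (L (n - 1)) 1 > 0" using n by (simp add: energy_def)
    then have "mode (L (n - 1)) 1 v = 0" by (rule kill)
    then show ?case using v0 z[of v] by simp
  next
    case (Suc b)
    have z: "mode (L (n - 1)) 1 (?y u) = ?y (mode (L (n - 1)) 1 u) + csc ((1 - cn n) * c) u" for u
      using commute_modes(1)[of "n - 1" 1 1 0 u] n by (simp add: c)
    have "cn (Suc b) * (1 - cn n) * c \<noteq> 0" using c0 n by (auto simp del: of_nat_Suc)
    then have "mode (L (n - 1)) 1 ((?y ^^ Suc b) v) \<noteq> 0" using Suc by simp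
    then have nz: "(?y ^^ Suc b) v \<noteq> 0" by (metis mode_0)
    have "mode (L (n - 1)) 1 ((?y ^^ Suc (Suc b)) v) = ?y (mode (L (n - 1)) 1 ((?y ^^ Suc b) v)) + csc ((1 - cn n) * c) ((?y ^^ Suc b) v)"
      using z[of "(?y ^^ Suc b) v"] by simp
    also have "\<dots> = csc (cn (Suc b) * (1 - cn n) * c) ((?y ^^ Suc b) v) + csc ((1 - cn n) * c) ((?y ^^ Suc b) v)"
      using Suc by (simp add: mode_csc)
    also have "\<dots> = csc (cn (Suc (Suc b)) * (1 - cn n) * c) ((?y ^^ Suc b) v)"
      unfolding CV.scale_left_distrib[symmetric] by (rule arg_cong[where f="\<lambda>e. csc e _"]) (simp add: algebra_simps)
    finally show ?case using nz by blast
  qed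
  ultimately show False by blast
qed

lemma double_zero: "(x :: 'm) = - x \<Longrightarrow> x = 0"
proof -
  assume "x = - x"
  then have "x + x = 0" by (simp add: eq_neg_iff_add_eq_0)
  moreover have "x + x = csc 2 x" using CV.scale_left_distrib[of 1 1 x] by simp
  ultimately show ?thesis by simp
qed

text \<open>The odd operator \<open>mode x 0\<close> squares to zero and supercommutes with the
  modes in \<open>Q\<close>, because the commutators have index 2 i, where everything vanishes.
  Hence either \<open>u\<close> itself or its image under this operator is a nonzero vector killed
  by the enlarged set.\<close>

lemma kill_odd:
  assumes u: "u \<noteq> 0" and S: "\<And>g k. Q g k \<Longrightarrow> mode g k u = 0" "\<And>g k. Q g k \<Longrightarrow> kindex g = i"
    and x: "kindex x = i" "kparity x = 1" and z: "\<And>g k u. kindex g = i + i \<Longrightarrow> mode g k u = 0"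
  shows "\<exists>u'. u' \<noteq> 0 \<and> (\<forall>g k. Q g k \<or> (g = x \<and> k = 0) \<longrightarrow> mode g k u' = 0)"
proof (cases "mode x 0 u = 0")
  case True
  then show ?thesis using u S by blast
next
  case False
  have "mode x 0 (mode x 0 u) = - mode x 0 (mode x 0 u)"
    using supercommute[of x x u 0 0] z x by (simp add: koszul_def)
  then have "mode x 0 (mode x 0 u) = 0" by (rule double_zero)
  moreover have "mode g k (mode x 0 u) = 0" if "Q g k" for g k
    using supercommute[of g x u k 0] z x S(1,2)[OF that] by (simp add: koszul_def)
  ultimately show ?thesis using False by blast
qed

text \<open>Modes of index \<open>i\<close> supercommute with each other, since 2 i > i, and
  \<open>mode (L i) 0\<close> is nilpotent on \<open>v\<close>: for i = n because \<open>c\<close> =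
  0, otherwise by \<open>power_relation\<close>. The last nonzero power is improved to a vector
  killed by all modes of index \<open>i\<close>, and such vectors form a submodule.\<close>

lemma top_index_zero:
  assumes n: "n > 1" and i: "i \<ge> 1" "i \<le> n" and H: "\<And>g k w. kindex g > i \<Longrightarrow> mode g k w = 0"
    and g: "kindex g = i"
  shows "mode g k w = 0"
proof -
  let ?y = "mode (L i) 0"
  have comm: "mode g k ((?y ^^ b) v) = 0" if "kindex g = i" "mode g k v = 0" for g k b
  proof (induction b)
    case (Suc b)
    then show ?case
      using supercommute[of g "L i" "(?y ^^ b) v" k 0] that i H by (simp add: koszul_def)
  qed (use that in simp)
  \<comment> \<open>The energy is at least 2 i for k > 0 and equals 2 i for \<open>J i\<close> at k
    = 0. This leaves only \<open>L i\<close>, \<open>Gp i\<close> and \<open>Gm i\<close> at k =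
    0.\<close>
  have pos: "mode g k v = 0" if "kindex g = i" "k > 0 \<or> g = J i" for g k
  proof (rule kill)
    show "energy g k > 0"
    proof (cases "k > 0")
      case True
      then have "2 * int n * int k \<ge> 2 * int n" using mult_left_mono[of 1 "int k" "2 * int n"] by simp
      moreover have "weight g \<ge> 2 * int i - 2 * int n" using that(1) by (cases g) auto
      ultimately show ?thesis unfolding energy_def using i by linarith
    next
      case False
      then show ?thesis using that i by (simp add: energy_def)
    qed
  qed
  have "\<exists>b. (?y ^^ b) v = 0"
  proof (cases "i = n")
    case True
    then show ?thesis using c c_zero[OF n] by (intro exI[of _ 1]) simp
  next
    case False
    show ?thesis
      by (rule power_relation[where g="L i" and e=1 and e'=1]) (use False i comm pos in auto)
  qed
  then obtain b where b: "(?y ^^ b) v = 0" "\<And>b'. b' < b \<Longrightarrow> (?y ^^ b') v \<noteq> 0"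
    unfolding exists_least_iff[of "\<lambda>b. (?y ^^ b) v = 0"] by blast
  then obtain m where m: "b = Suc m" using v0 by (cases b) auto
  define u where "u = (?y ^^ m) v"
  have u: "u \<noteq> 0" "?y u = 0" using b m by (auto simp: u_def)
  \<comment> \<open>All modes of index \<open>i\<close> except the two odd ones at k = 0, which
    \<open>kill_odd\<close> adds one at a time.\<close>
  define Q where "Q = (\<lambda>g (k::nat). kindex g = i \<and> \<not> (k = 0 \<and> (g = Gp i \<or> g = Gm i)))"
  have Q: "mode g k u = 0" if "Q g k" for g k
  proof (cases "g = L i \<and> k = 0")
    case True
    then show ?thesis using u by simp
  next
    case False
    then have "k > 0 \<or> g = J i" using that by (cases g) (auto simp: Q_def)
    then show ?thesis unfolding u_def using comm pos that by (simp add: Q_def)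
  qed
  have z: "mode g k u = 0" if "kindex g = i + i" for g k u using H that i by simp
  have Qi: "kindex g = i" if "Q g k" for g k using that by (simp add: Q_def)
  have "\<exists>u'. u' \<noteq> 0 \<and> (\<forall>g k. Q g k \<or> (g = Gp i \<and> k = 0) \<longrightarrow> mode g k u' = 0)"
    by (rule kill_odd[OF u(1) Q Qi _ _ z]) simp_all
  then obtain u1 where u1: "u1 \<noteq> 0" "\<forall>g k. Q g k \<or> (g = Gp i \<and> k = 0) \<longrightarrow> mode g k u1 = 0" by blast
  define Q1 where "Q1 = (\<lambda>g (k::nat). Q g k \<or> (g = Gp i \<and> k = 0))"
  have Q1: "mode g k u1 = 0" "kindex g = i" if "Q1 g k" for g k using that u1(2) Qi by (auto simp: Q1_def)
  have "\<exists>u'. u' \<noteq> 0 \<and> (\<forall>g k. Q1 g k \<or> (g = Gm i \<and> k = 0) \<longrightarrow> mode g k u' = 0)"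
    by (rule kill_odd[OF u1(1) Q1 _ _ z]) simp_all
  then obtain u2 where u2: "u2 \<noteq> 0" "\<And>g k. Q1 g k \<or> (g = Gm i \<and> k = 0) \<Longrightarrow> mode g k u2 = 0" by blast
  have u2i: "mode g k u2 = 0" if "kindex g = i" for g k
    by (rule u2(2)) (use that in \<open>auto simp: Q1_def Q_def\<close>)
  have "w \<in> {u. \<forall>g k. kindex g = i \<longrightarrow> mode g k u = 0}"
  proof (rule submodule_cases[of _ u2])
    show "mode h j u \<in> {u. \<forall>g k. kindex g = i \<longrightarrow> mode g k u = 0}" if "u \<in> {u. \<forall>g k. kindex g = i \<longrightarrow> mode g k u = 0}" for h j u
    proof (intro CollectI allI impI)
      fix g k assume g: "kindex g = i"
      \<comment> \<open>The sum of the indices is \<open>i\<close> if \<open>h\<close> has index 0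
        and exceeds \<open>i\<close> otherwise; in both cases \<open>u\<close> is killed.\<close>
      have "mode w k u = 0" if "kindex w = kindex g + kindex h" for w k
        using that g H \<open>u \<in> _\<close> by (cases "kindex h = 0") auto
      then have "mode g k (mode h j u) = koszul (kparity g) (kparity h) (mode h j (mode g k u))" by (rule supercommute)
      then show "mode g k (mode h j u) = 0" using g \<open>u \<in> _\<close> by (simp add: koszul_def)
    qed
    show "x \<in> {u. \<forall>g k. kindex g = i \<longrightarrow> mode g k u = 0}"
      if "x + y \<in> {u. \<forall>g k. kindex g = i \<longrightarrow> mode g k u = 0}" "x \<in> grade M 0" "y \<in> grade M 1" for x y
      using that mode_kernel_graded by blast
    show "u2 \<in> {u. \<forall>g k. kindex g = i \<longrightarrow> mode g k u = 0}" using u2i by blast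
  qed (use u2(1) in \<open>auto simp: mode_add mode_csc mode_D\<close>)
  then show ?thesis using g by blast
qed

text \<open>Downward induction on the index, starting above n, where all modes vanish by
  definition.\<close>

lemma positive_index_zero:
  assumes n: "n > 1" and g: "kindex g \<ge> 1"
  shows "mode g k w = 0"
proof -
  have "\<forall>g k w. kindex g > n - j \<longrightarrow> mode g k w = 0" if "j \<le> n" for j
    using that
  proof (induction j)
    case 0
    then show ?case by (simp add: mode_index)
  next
    case (Suc j)
    then have IH: "\<And>g k w. kindex g > n - j \<Longrightarrow> mode g k w = 0" by simp
    show ?case
    proof (clarify)
      fix g k w assume "kindex g > n - Suc j"
      then have "kindex g > n - j \<or> kindex g = n - j" by linarith
      then show "mode g k w = 0"
      proof
        assume "kindex g = n - j"
        then show ?thesis using top_index_zero[OF n, of "n - j"] IH Suc.prems by simp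
      qed (rule IH)
    qed
  qed
  from this[of n] show ?thesis using g by simp
qed

end

section \<open>Homomorphisms from free modules\<close>

lemma free_poly_induct [case_names basis add cscale deriv]:
  fixes u :: "'h \<Rightarrow>\<^sub>0 complex poly"
  assumes basis: "\<And>h. Q (gen h)"
    and add: "\<And>u w. Q u \<Longrightarrow> Q w \<Longrightarrow> Q (u + w)"
    and cscale: "\<And>c u. Q u \<Longrightarrow> Q (free_scale [:c:] u)"
    and deriv: "\<And>u. Q u \<Longrightarrow> Q (free_scale [:0, 1:] u)"
  shows "Q u"
proof -
  have zero: "free_scale [:0:] w = 0" for w :: "'h \<Rightarrow>\<^sub>0 complex poly"
    by (rule poly_mapping_eqI) (simp add: lookup_free_scale)
  have Q0: "Q 0" using cscale[OF basis, of 0 undefined] by (simp only: zero)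
  have ps: "Q (free_scale p (gen h))" for p h
  proof (induction p)
    case 0
    have "free_scale 0 (gen h) = (0 :: 'h \<Rightarrow>\<^sub>0 complex poly)"
      by (rule poly_mapping_eqI) (simp add: lookup_free_scale)
    then show ?case using Q0 by simp
  next
    case (pCons a p)
    have "free_scale (pCons a p) (gen h) = free_scale [:a:] (gen h)
        + free_scale [:0, 1:] (free_scale p (gen h))"
      by (rule poly_mapping_eqI) (simp add: lookup_add lookup_free_scale lookup_single when_def one_pCons)
    then show ?case using pCons by (simp only:) (intro add cscale deriv basis)
  qed
  have "Q (\<Sum>h\<in>H. free_scale (lookup u h) (gen h))" for H
    by (induction H rule: infinite_finite_induct) (simp_all add: Q0 add ps)
  then show ?thesis by (metis free_expand)
qed

context kmodule
begin

definition lin_ext :: "('h \<Rightarrow> 'm) \<Rightarrow> ('h \<Rightarrow>\<^sub>0 complex poly) \<Rightarrow> 'm" where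
  "lin_ext E u = (\<Sum>h\<in>keys u. psc (lookup u h) (E h))"

lemma lin_ext_superset:
  "finite H \<Longrightarrow> keys u \<subseteq> H \<Longrightarrow> lin_ext E u = (\<Sum>h\<in>H. psc (lookup u h) (E h))"
  unfolding lin_ext_def by (rule sum.mono_neutral_left) (auto simp: in_keys_iff)

lemma lin_ext_single: "lin_ext E (single h p) = psc p (E h)"
  by (subst lin_ext_superset[of "{h}"]) auto

lemma lin_ext_add: "lin_ext E (u + w) = lin_ext E u + lin_ext E w"
proof -
  let ?H = "keys u \<union> keys w \<union> keys (u + w)"
  show ?thesis
    by (subst (1 2 3) lin_ext_superset[of ?H]) (auto simp: lookup_add PM.scale_left_distrib sum.distrib)
qed

lemma lin_ext_scale: "lin_ext E (free_scale p u) = psc p (lin_ext E u)"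
  by (subst (1 2) lin_ext_superset[of "keys u"])
     (auto simp: lookup_free_scale PM.scale_sum_right dest: subsetD[OF keys_free_scale])

lemma lin_ext_0 [simp]: "lin_ext E 0 = 0"
  by (simp add: lin_ext_def)

lemma lin_ext_minus: "lin_ext E (- u) = - lin_ext E u"
  using lin_ext_add[of E u "- u"] by (simp add: add_eq_0_iff)

lemma lin_ext_sum_list:
  "lin_ext E (\<Sum>(F, m)\<leftarrow>xs. f F m) = (\<Sum>(F, m)\<leftarrow>xs. lin_ext E (f F m))"
  by (induction xs) (auto simp: lin_ext_add)

text \<open>Both sides obey the same rules under sums, scalars and \<partial> in each argument, so
  it is enough to compare them for a generator of the algebra and a basis vector of the free module.
  That comparison is the hypothesis on \<open>dmode\<close>.\<close>

lemma lin_ext_intertwines: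
  fixes E :: "'h \<Rightarrow> 'm"
  assumes N: "conformal_module (k_alg n) (free_conf_module par tab)"
    and E: "\<And>g h k. kindex g \<le> n \<Longrightarrow> dmode g k (E h) = (\<Sum>(F, w)\<leftarrow>tab g h. psc (coeff F k) (E w))"
    and a: "a \<in> carrier_of (k_alg n)"
  shows "act M a (lin_ext E u) = map_poly (lin_ext E) (act (free_conf_module par tab) a u)"
proof -
  interpret N: kmodule n "free_conf_module par tab" using N by (simp add: kmodule_def)
  let ?f = "lin_ext E"
  have c: "?f (cscale (free_conf_module par tab) c u) = csc c (?f u)" for c u
    by (simp add: cscale_def free_conf_module_simps lin_ext_scale)
  have d: "?f (deriv_of (free_conf_module par tab) u) = D (?f u)" for u
    by (simp add: deriv_of_def free_conf_module_simps lin_ext_scale)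
  from a have "\<forall>u. act M a (?f u) = map_poly ?f (act (free_conf_module par tab) a u)"
  proof (induction rule: carrier_induct)
    case (gen g)
    show ?case
    proof
      fix u
      note g = gen_carrier[OF gen]
      show "act M (gen g) (?f u) = map_poly ?f (act (free_conf_module par tab) (gen g) u)"
      proof (induction u rule: free_poly_induct)
        case (basis h)
        have e1: "eval_at 1 X = 1" for X by (simp add: eval_at_def one_pCons map_poly_pCons)
        have sl: "coeff (\<Sum>(F, w)\<leftarrow>xs. map_poly (single w) F) k
          = (\<Sum>(F, w)\<leftarrow>xs. single w (coeff F k))"
          for xs :: "(complex poly poly \<times> 'h) list" and k
          by (induction xs) (auto simp: coeff_map_poly)
        show ?case
        proof (rule poly_eqI)
          fix k
          have "coeff (act (free_conf_module par tab) (gen g) (gen h)) k =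
            (\<Sum>(F, w)\<leftarrow>tab g h. single w (coeff F k))"
            by (simp add: free_conf_module_simps sesquilinear_extension_def e1 sl)
          then show "coeff (act M (gen g) (?f (gen h))) k =
            coeff (map_poly ?f (act (free_conf_module par tab) (gen g) (gen h))) k"
            using E[OF gen, of k h] gen
            by (simp add: coeff_map_poly lin_ext_sum_list lin_ext_single dmode_def)
        qed
      next
        case (add u w)
        then show ?case
          by (intro poly_eqI) (simp add: lin_ext_add act_sesq(2)[OF g] N.act_sesq(2)[OF g] coeff_map_poly)
      next
        case (cscale c u)
        have "free_scale [:c:] u = cscale (free_conf_module par tab) c u"
          by (simp add: cscale_def free_conf_module_simps)
        then show ?case
          using cscale by (intro poly_eqI) (simp add: c act_sesq(4)[OF g] N.act_sesq(4)[OF g] coeff_map_poly)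
      next
        case (deriv u)
        have "free_scale [:0, 1:] u = deriv_of (free_conf_module par tab) u"
          by (simp add: deriv_of_def free_conf_module_simps)
        then show ?case
          using deriv by (intro poly_eqI)
            (simp add: d lin_ext_add act_sesq(6)[OF g] N.act_sesq(6)[OF g] coeff_map_poly coeff_pCons split: nat.splits)
      qed
    qed
  next
    case (add a b)
    then show ?case
      by (auto intro!: poly_eqI simp: act_sesq(1) N.act_sesq(1) lin_ext_add coeff_map_poly)
  next
    case (cscale x a)
    then show ?case
      by (auto intro!: poly_eqI simp: act_sesq(3) N.act_sesq(3) c coeff_map_poly)
  next
    case (deriv a)
    then show ?case
      by (auto intro!: poly_eqI simp: act_sesq(5) N.act_sesq(5) lin_ext_minus coeff_map_poly coeff_pCons split: nat.splits)
  qed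
  then show ?thesis by blast
qed

end

context kirreducible
begin

lemma lin_ext_grade:
  assumes "\<And>h. E h \<in> grade M (par h + p)" "\<forall>h\<in>keys u. par h = i"
  shows "lin_ext E u \<in> grade M (i + p)"
  unfolding lin_ext_def
proof (intro PM.subspace_sum[OF M.subspace_grade] PM.subspace_scale[OF M.subspace_grade])
  fix h assume "h \<in> keys u"
  then have "par h = i" using assms(2) by blast
  then show "E h \<in> grade M (i + p)" using assms(1)[of h] by (simp only:)
qed

lemma free_decomp:
  fixes u :: "'h \<Rightarrow>\<^sub>0 complex poly"
  obtains u0 u1 where "u = u0 + u1" "\<forall>h\<in>keys u0. par h = (0::bit)" "\<forall>h\<in>keys u1. par h = 1"
proof
  show "u = restrict_keys (\<lambda>h. par h = 0) u + restrict_keys (\<lambda>h. par h = 1) u"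
    by (rule poly_mapping_eqI) (auto simp: lookup_add lookup_restrict_keys)
qed (auto simp: in_keys_iff lookup_restrict_keys split: if_splits)

lemma grade_unique:
  assumes "x + y = x' + y'" "x \<in> grade M i" "x' \<in> grade M i" "y \<in> grade M (i + 1)" "y' \<in> grade M (i + 1)"
  shows "x = x'"
proof -
  have "x - x' = 0"
  proof (rule grade_direct[of _ "y - y'" i])
    show "x - x' + (y - y') = 0" using assms(1) by (simp add: algebra_simps)
    show "x - x' \<in> grade M i" "y - y' \<in> grade M (i + 1)"
      using assms PM.subspace_diff[OF M.subspace_grade] by auto
  qed
  then show ?thesis by simp
qed

text \<open>The image is a graded submodule containing \<open>E h0\<close> \<noteq> 0, hence
  everything. The source may be reducible, which is what the degenerate parameters call for. The
  shift \<open>p\<close> accounts for the parity of the highest vector.\<close>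

lemma lin_ext_surj:
  fixes E :: "'h \<Rightarrow> 'm"
  assumes N: "conformal_module (k_alg n) (free_conf_module par tab)"
    and E: "\<And>g h k. kindex g \<le> n \<Longrightarrow> dmode g k (E h) = (\<Sum>(F, w)\<leftarrow>tab g h. psc (coeff F k) (E w))"
    and gr: "\<And>h. E h \<in> grade M (par h + p)" and nz: "E h0 \<noteq> 0"
  shows "\<exists>u. w = lin_ext E u"
proof -
  have "w \<in> range (lin_ext E)"
  proof (rule submodule_cases[of _ "E h0"])
    show "0 \<in> range (lin_ext E)" by (metis lin_ext_0 rangeI)
    show "v + w \<in> range (lin_ext E)" if "v \<in> range (lin_ext E)" "w \<in> range (lin_ext E)" for v w
      using that by (auto simp: lin_ext_add[symmetric])
    show "csc c v \<in> range (lin_ext E)" "D v \<in> range (lin_ext E)" if "v \<in> range (lin_ext E)" for c v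
      using that by (auto simp: cscale_def deriv_of_def lin_ext_scale[symmetric])
    show "mode g k v \<in> range (lin_ext E)" if v: "v \<in> range (lin_ext E)" for g k v
    proof (cases "kindex g \<le> n")
      case True
      obtain u where "v = lin_ext E u" using v by blast
      then have "dmode g k v = lin_ext E (coeff (act (free_conf_module par tab) (gen g) u) k)"
        using True lin_ext_intertwines[OF N E gen_carrier[OF True]] by (simp add: dmode_def coeff_map_poly)
      then show ?thesis by (simp add: mode_def cscale_def lin_ext_scale[symmetric])
    next
      case False
      then show ?thesis using lin_ext_0 by (metis mode_index not_le rangeI)
    qed
    show "E h0 \<in> range (lin_ext E)" using lin_ext_single[of E h0 1] by (metis PM.scale_one rangeI)
    show "x \<in> range (lin_ext E)" if xy: "x + y \<in> range (lin_ext E)" "x \<in> grade M 0" "y \<in> grade M 1" for x y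
    proof -
      obtain u where u: "x + y = lin_ext E u" using xy by blast
      obtain u0 u1 where u01: "u = u0 + u1" "\<forall>h\<in>keys u0. par h = 0" "\<forall>h\<in>keys u1. par h = 1"
        by (rule free_decomp)
      have g0: "lin_ext E u0 \<in> grade M (0 + p)" and g1: "lin_ext E u1 \<in> grade M (1 + p)"
        by (rule lin_ext_grade[where par=par and E=E and p=p, OF gr]; fact)+
      show ?thesis
      proof (cases "p = 0")
        case True
        then have "x = lin_ext E u0"
          using grade_unique[of x y "lin_ext E u0" "lin_ext E u1" 0] g0 g1 u u01 xy by (simp add: lin_ext_add)
        then show ?thesis by blast
      next
        case False
        then have "x = lin_ext E u1"
          using grade_unique[of x y "lin_ext E u1" "lin_ext E u0" 0] g0 g1 u u01 xy by (simp add: lin_ext_add add.commute)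
        then show ?thesis by blast
      qed
    qed
  qed (use nz in auto)
  then show ?thesis by blast
qed

text \<open>The kernel is a graded submodule of the irreducible source that misses
  \<open>gen h0\<close>, so it is zero. The isomorphism asked for starts at \<open>M\<close> and is
  therefore the inverse map; a parity shift \<open>p\<close> = 1 becomes the parity change.\<close>

lemma lin_ext_isomorphic:
  fixes E :: "'h \<Rightarrow> 'm"
  assumes irr: "nontrivial_finite_irreducible (k_alg n) (free_conf_module par tab)"
    and E: "\<And>g h k. kindex g \<le> n \<Longrightarrow> dmode g k (E h) = (\<Sum>(F, w)\<leftarrow>tab g h. psc (coeff F k) (E w))"
    and gr: "\<And>h. E h \<in> grade M (par h + p)" and nz: "E h0 \<noteq> 0"
  shows "isomorphic_up_to_parity (k_alg n) M (free_conf_module par tab)"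
proof -
  let ?N = "free_conf_module par tab" and ?f = "lin_ext E"
  have N: "conformal_module (k_alg n) ?N" and Nirr: "irreducible_conf_module (k_alg n) ?N"
    using irr unfolding nontrivial_finite_irreducible_def by auto
  have tw: "act M a (?f u) = map_poly ?f (act ?N a u)" if "a \<in> carrier_of (k_alg n)" for a u
    by (rule lin_ext_intertwines[OF N _ that]) (rule E)
  have surj: "\<exists>u. w = ?f u" for w by (rule lin_ext_surj[OF N E gr nz])
  have kgr: "?f x = 0" if "?f (x + y) = 0" "\<forall>h\<in>keys x. par h = 0" "\<forall>h\<in>keys y. par h = 1" for x y
  proof -
    have g0: "?f x \<in> grade M (0 + p)" and g1: "?f y \<in> grade M (1 + p)"
      by (rule lin_ext_grade[where par=par and E=E and p=p, OF gr]; fact)+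
    show ?thesis
    proof (rule grade_direct[of _ "?f y" p])
      show "?f x + ?f y = 0" using that(1) by (simp only: lin_ext_add)
      show "?f x \<in> grade M p" using g0 by (simp only: add_0_left)
      show "?f y \<in> grade M (p + 1)" using g1 by (simp only: add.commute)
    qed
  qed
  have "conf_submodule (k_alg n) ?N {u. ?f u = 0}"
    unfolding conf_submodule_def
  proof (intro conjI)
    show "module.subspace (pscale ?N) {u. ?f u = 0}"
      unfolding free_conf_module_simps module.subspace_def[OF module_free_scale]
      by (simp add: lin_ext_add lin_ext_scale)
    show "{u. ?f u = 0} \<subseteq> {x + y | x y. x \<in> {u. ?f u = 0} \<inter> grade ?N 0 \<and> y \<in> {u. ?f u = 0} \<inter> grade ?N 1}"
    proof
      fix u assume u: "u \<in> {u. ?f u = 0}"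
      obtain x y where xy: "u = x + y" "\<forall>h\<in>keys x. par h = 0" "\<forall>h\<in>keys y. par h = 1"
        by (rule free_decomp)
      then have "?f x = 0" using kgr u by auto
      moreover then have "?f y = 0" using u xy by (simp add: lin_ext_add)
      ultimately show "u \<in> {x + y | x y. x \<in> {u. ?f u = 0} \<inter> grade ?N 0 \<and> y \<in> {u. ?f u = 0} \<inter> grade ?N 1}"
        using xy unfolding free_conf_module_simps by blast
    qed
    show "\<forall>a\<in>carrier_of (k_alg n). \<forall>u\<in>{u. ?f u = 0}. \<forall>k. coeff (act ?N a u) k \<in> {u. ?f u = 0}"
    proof (intro ballI allI)
      fix a u k assume a: "a \<in> carrier_of (k_alg n)" and u: "u \<in> {u. ?f u = 0}"
      have "map_poly ?f (act ?N a u) = 0" using tw[OF a, of u] u act_0[OF a] by simp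
      then have "coeff (map_poly ?f (act ?N a u)) k = 0" by simp
      then show "coeff (act ?N a u) k \<in> {u. ?f u = 0}" by (simp add: coeff_map_poly)
    qed
  qed
  moreover have "{u. ?f u = 0} \<noteq> UNIV"
    using nz lin_ext_single[of E h0 1] by (metis (mono_tags) PM.scale_one UNIV_I mem_Collect_eq)
  ultimately have ker: "{u. ?f u = 0} = {0}"
    using Nirr unfolding irreducible_conf_module_def by blast
  have inj: "inj ?f"
  proof (rule injI)
    fix x y assume "?f x = ?f y"
    then have "?f (x + - y) = 0" by (simp only: lin_ext_add lin_ext_minus) simp
    then have "x + - y = 0" using ker by blast
    then show "x = y" by simp
  qed
  then have bij: "bij ?f" unfolding bij_def surj_def using surj by blast
  define F where "F = inv ?f"
  have Ff: "F (?f u) = u" and fF: "?f (F w) = w" for u w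
    unfolding F_def using bij by (simp_all add: bij_is_inj bij_is_surj surj_f_inv_f)
  have bF: "bij F" unfolding F_def by (rule bij_imp_bij_inv[OF bij])
  have hom: "module_hom psc (pscale ?N) F"
    unfolding module_hom_def module_hom_axioms_def free_conf_module_simps
  proof (intro conjI allI)
    show "module psc" by (rule M.module_pscale)
    show "module (free_scale :: complex poly \<Rightarrow> ('h \<Rightarrow>\<^sub>0 complex poly) \<Rightarrow> _)" by (rule module_free_scale)
    show "F (a + b) = F a + F b" for a b by (metis Ff fF lin_ext_add)
    show "F (psc r b) = free_scale r (F b)" for r b by (metis Ff fF lin_ext_scale)
  qed
  have Fact: "act ?N a (F w) = map_poly F (act M a w)" if a: "a \<in> carrier_of (k_alg n)" for a w
  proof (rule poly_eqI)
    fix k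
    have F0: "F 0 = 0" using Ff[of 0] by simp
    have "act M a w = map_poly ?f (act ?N a (F w))" using tw[OF a, of "F w"] by (simp add: fF)
    then show "coeff (act ?N a (F w)) k = coeff (map_poly F (act M a w)) k"
      by (simp add: coeff_map_poly Ff F0)
  qed
  have gr1: "?f u \<in> grade M (i + p)" if "u \<in> grade ?N i" for u i
    by (rule lin_ext_grade[where par=par and E=E and p=p, OF gr]) (use that in \<open>simp add: free_conf_module_simps\<close>)
  have gr2: "F w \<in> grade ?N i" if w: "w \<in> grade M (i + p)" for w i
  proof -
    obtain u0 u1 where u: "F w = u0 + u1" "\<forall>h\<in>keys u0. par h = 0" "\<forall>h\<in>keys u1. par h = 1"
      by (rule free_decomp)
    have g: "?f u0 \<in> grade M (0 + p)" "?f u1 \<in> grade M (1 + p)" by (rule lin_ext_grade[where par=par and E=E and p=p, OF gr]; fact)+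
    have w': "w = ?f u0 + ?f u1" using fF[of w] u by (simp add: lin_ext_add)
    have z: "0 \<in> grade M j" for j using PM.subspace_0[OF M.subspace_grade] .
    show ?thesis
    proof (cases "i = 0")
      case True
      have "w = ?f u0"
      proof (rule grade_unique[of w 0 "?f u0" "?f u1" p])
        show "w + 0 = ?f u0 + ?f u1" using w' by (simp only: add_0_right)
        show "w \<in> grade M p" using w by (simp only: True add_0_left)
        show "?f u0 \<in> grade M p" using g(1) by (simp only: add_0_left)
        show "?f u1 \<in> grade M (p + 1)" using g(2) by (simp only: add.commute)
      qed (rule z)
      then show ?thesis using Ff u True by (simp add: free_conf_module_simps)
    next
      case False
      then have i: "i = 1" by simp
      have e: "1 + p + 1 = 0 + p" by (cases p) simp_all
      have "w = ?f u1"
      proof (rule grade_unique[of w 0 "?f u1" "?f u0" "1 + p"])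
        show "w + 0 = ?f u1 + ?f u0" unfolding w' by simp
        show "w \<in> grade M (1 + p)" using w by (simp only: i)
        show "?f u1 \<in> grade M (1 + p)" by (rule g(2))
        show "?f u0 \<in> grade M (1 + p + 1)" unfolding e by (rule g(1))
      qed (rule z)
      then show ?thesis using Ff u i by (simp add: free_conf_module_simps)
    qed
  qed
  have img: "F ` grade M (i + p) = grade ?N i" for i
  proof
    show "F ` grade M (i + p) \<subseteq> grade ?N i" using gr2 by blast
    show "grade ?N i \<subseteq> F ` grade M (i + p)"
    proof
      fix u assume "u \<in> grade ?N i"
      then have "?f u \<in> grade M (i + p)" by (rule gr1)
      then show "u \<in> F ` grade M (i + p)" using Ff[of u] by (metis imageI)
    qed
  qed
  show ?thesis
  proof (cases "p = 0")
    case True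
    have "F ` grade M i = grade ?N i" for i using img[of i] by (simp only: True add_0_right)
    then have "conf_isomorphic (k_alg n) M ?N"
      unfolding conf_isomorphic_def using bF hom Fact by blast
    then show ?thesis unfolding isomorphic_up_to_parity_def by blast
  next
    case False
    then have p: "p = 1" by simp
    have e: "i + 1 + p = i" for i unfolding p by (cases i) simp_all
    have "grade (parity_change ?N) i = grade ?N (i + 1)" for i by (simp add: parity_change_def)
    then have "F ` grade M i = grade (parity_change ?N) i" for i
      using img[of "i + 1"] by (simp only: e)
    moreover have "pscale (parity_change ?N) = pscale ?N" "act (parity_change ?N) = act ?N"
      by (simp_all add: parity_change_def)
    ultimately have "conf_isomorphic (k_alg n) M (parity_change ?N)"
      unfolding conf_isomorphic_def using bF hom Fact by metis
    then show ?thesis unfolding isomorphic_up_to_parity_def by blast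
  qed
qed

end

section \<open>Action on the vectors generated by a highest vector\<close>

context khighest
begin

lemma psc_linear: "psc [:a, b:] x = csc a x + csc b (D x)" "psc [:a:] x = csc a x" "psc 0 x = 0"
  by (simp_all add: psc_pCons D_add D_csc D_0)

lemma kill_modes:
  "mode (L 0) (Suc (Suc k)) v = 0" "mode (J 0) (Suc k) v = 0" "mode (Gp 0) (Suc k) v = 0" "mode (Gm 0) (Suc k) v = 0"
proof -
  have e: "2 * int n * int (Suc k) = 2 * int n * int k + 2 * int n" for k by (simp add: algebra_simps)
  have "2 * int n * int k \<ge> 0" "int n > 0" using n1 by simp_all
  then have "energy (L 0) (Suc (Suc k)) > 0" "energy (J 0) (Suc k) > 0" "energy (Gp 0) (Suc k) > 0" "energy (Gm 0) (Suc k) > 0"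
    unfolding energy_def e weight.simps by linarith+
  then show "mode (L 0) (Suc (Suc k)) v = 0" "mode (J 0) (Suc k) v = 0" "mode (Gp 0) (Suc k) v = 0" "mode (Gm 0) (Suc k) v = 0"
    using kill by auto
qed

text \<open>Puts n = 1 and n > 1 on the same footing: for n = 1 the operator is
  \<open>mode (L n) 0\<close>, for n > 1 both sides are zero.\<close>

lemma L1_scalar: "mode (L 1) 0 w = csc c w"
proof (cases "n = 1")
  case True
  then show ?thesis using c by simp
next
  case False
  then show ?thesis using n1 positive_index_zero[of "L 1" 0 w] c_zero by simp
qed

text \<open>For n = 1 these modes have positive energy; for n > 1 the positive index already makes
  them vanish.\<close>

lemma index1_kill:
  "mode (L 1) (Suc k) v = 0" "mode (J 1) k v = 0" "mode (Gp 1) k v = 0" "mode (Gm 1) k v = 0"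
proof -
  have "mode g k v = 0" if "kindex g = 1" "energy g k > 0 \<or> n > 1" for g k
    using that kill positive_index_zero[of g k v] by auto
  note * = this
  have "energy (L 1) (Suc k) > 0 \<and> energy (J 1) k > 0 \<and> energy (Gp 1) k > 0 \<and> energy (Gm 1) k > 0" if "n = 1"
    unfolding energy_def weight.simps using that by simp
  then show "mode (L 1) (Suc k) v = 0" "mode (J 1) k v = 0" "mode (Gp 1) k v = 0" "mode (Gm 1) k v = 0"
    using *[of "L 1" "Suc k"] *[of "J 1" k] *[of "Gp 1" k] *[of "Gm 1" k] n1 by fastforce+
qed

lemma index_ge2: "kindex g > 1 \<Longrightarrow> mode g k w = 0"
  using positive_index_zero[of g k w] mode_index[of g k w] n1 by (cases "n = 1") auto

definition "P = mode (Gp 0) 0 v"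
definition "Q = mode (Gm 0) 0 v"
text \<open>The other order of the two odd operators gives nothing new:
  \<open>mode (Gm 0) 0 P\<close> is \<open>- R\<close> plus twice \<open>mode (L 0) 0 v\<close>,
  which lies in \<complex>[\<partial>] \<open>v\<close>.\<close>

definition "R = mode (Gp 0) 0 Q"

lemma move_Gp:
  "mode (L i) k (mode (Gp 0) 0 u) = mode (Gp 0) 0 (mode (L i) k u) + csc (- half n * cn k) (mode (Gp i) (k - 1) u)"
  "mode (J i) k (mode (Gp 0) 0 u) = mode (Gp 0) 0 (mode (J i) k u) + mode (Gp i) k u"
  "mode (Gp i) k (mode (Gp 0) 0 u) = - mode (Gp 0) 0 (mode (Gp i) k u)"
  "mode (Gm i) k (mode (Gp 0) 0 u) = - mode (Gp 0) 0 (mode (Gm i) k u) + csc (cn n * cn k) (mode (J i) (k - 1) u) + csc 2 (mode (L i) k u)"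
  using commute_modes(4)[of i k 0 0 u] commute_modes(7)[of i k 0 0 u] commute_modes(9)[of i k 0 0 u] commute_modes(12)[of i k 0 0 u]
  by simp_all

lemma move_Gm:
  "mode (L i) k (mode (Gm 0) 0 u) = mode (Gm 0) 0 (mode (L i) k u) + csc (- half n * cn k) (mode (Gm i) (k - 1) u)"
  "mode (J i) k (mode (Gm 0) 0 u) = mode (Gm 0) 0 (mode (J i) k u) - mode (Gm i) k u"
  "mode (Gp i) k (mode (Gm 0) 0 u) = - mode (Gm 0) 0 (mode (Gp i) k u) + csc (- cn n * cn k) (mode (J i) (k - 1) u) + csc 2 (mode (L i) k u)"
  "mode (Gm i) k (mode (Gm 0) 0 u) = - mode (Gm 0) 0 (mode (Gm i) k u)"
  using commute_modes(5)[of i k 0 0 u] commute_modes(8)[of i k 0 0 u] commute_modes(11)[of i k 0 0 u] commute_modes(10)[of i k 0 0 u]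
  by simp_all

lemma L01': "mode (L 0) (Suc 0) v = csc \<theta> v" using L01 by simp
lemma L1_scalar': "mode (L (Suc 0)) 0 w = csc c w" using L1_scalar[of w] by simp
lemmas index1_kill' = index1_kill[unfolded One_nat_def]

text \<open>Each mode is commuted past \<open>mode (Gp 0) 0\<close> until it meets \<open>v\<close>.
  With \<Delta> = -\<theta>/n the scalar at \<open>mode (Gm 0) (Suc 0)\<close> is -n (2 \<Delta> -
  \<Lambda>); when it and \<open>c\<close> vanish, \<open>P\<close> satisfies the conditions on a
  highest vector, apart from being nonzero.\<close>

lemma on_P:
  "mode (L 0) (Suc 0) P = csc (\<theta> - half n) P" "mode (L 0) (Suc (Suc k)) P = 0"
  "mode (J 0) 0 P = csc (\<Lambda> + 1) P" "mode (J 0) (Suc k) P = 0"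
  "mode (Gp 0) k P = 0"
  "mode (Gm 0) 0 P = - R + csc 2 (mode (L 0) 0 v)" "mode (Gm 0) (Suc 0) P = csc (cn n * \<Lambda> + 2 * \<theta>) v"
  "mode (Gm 0) (Suc (Suc k)) P = 0"
  "mode (L (Suc 0)) (Suc k) P = 0" "mode (J (Suc 0)) k P = 0" "mode (Gp (Suc 0)) k P = 0"
  "mode (Gm (Suc 0)) 0 P = csc (2 * c) v" "mode (Gm (Suc 0)) (Suc k) P = 0"
proof -
  have gp: "mode (Gp 0) k P = 0" for k
  proof (cases k)
    case 0
    have "mode (Gp 0) 0 P = - mode (Gp 0) 0 P" using move_Gp(3)[of 0 0 v] unfolding P_def .
    then show ?thesis using double_zero 0 by blast
  next
    case (Suc k')
    then show ?thesis unfolding P_def by (simp add: move_Gp kill_modes)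
  qed
  then show "mode (Gp 0) k P = 0" .
  note s = P_def move_Gp kill_modes L01' J00 mode_csc index1_kill' L1_scalar'
  show "mode (L 0) (Suc 0) P = csc (\<theta> - half n) P" "mode (L 0) (Suc (Suc k)) P = 0"
    "mode (J 0) 0 P = csc (\<Lambda> + 1) P" "mode (J 0) (Suc k) P = 0"
    by (simp_all add: s CV.scale_left_diff_distrib CV.scale_left_distrib)
  show "mode (Gm 0) 0 P = - R + csc 2 (mode (L 0) 0 v)" using move_Gp(4)[of 0 0 v] by (simp add: P_def R_def Q_def)
  show "mode (Gm 0) (Suc 0) P = csc (cn n * \<Lambda> + 2 * \<theta>) v"
    by (simp add: s CV.scale_left_distrib)
  show "mode (Gm 0) (Suc (Suc k)) P = 0" by (simp add: s)
  show "mode (L (Suc 0)) (Suc k) P = 0" "mode (J (Suc 0)) k P = 0" "mode (Gp (Suc 0)) k P = 0"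
    "mode (Gm (Suc 0)) 0 P = csc (2 * c) v" "mode (Gm (Suc 0)) (Suc k) P = 0"
    by (simp_all add: s)
qed

text \<open>Mirror image for the other odd operator; here the critical scalar, at
  \<open>mode (Gp 0) (Suc 0)\<close>, is -n (2 \<Delta> + \<Lambda>).\<close>

lemma on_Q:
  "mode (L 0) (Suc 0) Q = csc (\<theta> - half n) Q" "mode (L 0) (Suc (Suc k)) Q = 0"
  "mode (J 0) 0 Q = csc (\<Lambda> - 1) Q" "mode (J 0) (Suc k) Q = 0"
  "mode (Gm 0) k Q = 0"
  "mode (Gp 0) 0 Q = R" "mode (Gp 0) (Suc 0) Q = csc (2 * \<theta> - cn n * \<Lambda>) v"
  "mode (Gp 0) (Suc (Suc k)) Q = 0"
  "mode (L (Suc 0)) (Suc k) Q = 0" "mode (J (Suc 0)) k Q = 0" "mode (Gm (Suc 0)) k Q = 0"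
  "mode (Gp (Suc 0)) 0 Q = csc (2 * c) v" "mode (Gp (Suc 0)) (Suc k) Q = 0"
proof -
  have gm: "mode (Gm 0) k Q = 0" for k
  proof (cases k)
    case 0
    have "mode (Gm 0) 0 Q = - mode (Gm 0) 0 Q" using move_Gm(4)[of 0 0 v] unfolding Q_def .
    then show ?thesis using double_zero 0 by blast
  next
    case (Suc k')
    then show ?thesis unfolding Q_def by (simp add: move_Gm kill_modes)
  qed
  then show "mode (Gm 0) k Q = 0" .
  show "mode (Gp 0) 0 Q = R" by (simp add: R_def)
  note s = Q_def move_Gm kill_modes L01' J00 mode_csc index1_kill' L1_scalar'
  show "mode (L 0) (Suc 0) Q = csc (\<theta> - half n) Q" "mode (L 0) (Suc (Suc k)) Q = 0"
    "mode (J 0) 0 Q = csc (\<Lambda> - 1) Q" "mode (J 0) (Suc k) Q = 0"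
    by (simp_all add: s CV.scale_left_diff_distrib)
  show "mode (Gp 0) (Suc 0) Q = csc (2 * \<theta> - cn n * \<Lambda>) v"
    by (simp add: s CV.scale_left_diff_distrib)
  show "mode (Gp 0) (Suc (Suc k)) Q = 0" by (simp add: s)
  show "mode (L (Suc 0)) (Suc k) Q = 0" "mode (J (Suc 0)) k Q = 0" "mode (Gm (Suc 0)) k Q = 0"
    "mode (Gp (Suc 0)) 0 Q = csc (2 * c) v" "mode (Gp (Suc 0)) (Suc k) Q = 0"
    by (simp_all add: s)
qed

text \<open>Obtained from the action on \<open>Q\<close> by commuting past
  \<open>mode (Gp 0) 0\<close> once more. The terms in \<open>v\<close> that appear are multiples of
  the critical scalar of \<open>Q\<close> or of \<open>c\<close>.\<close>

lemma on_R:
  "mode (L 0) (Suc 0) R = csc (\<theta> - cn n) R" "mode (L 0) (Suc (Suc 0)) R = csc (- cn n * (2 * \<theta> - cn n * \<Lambda>)) v"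
  "mode (L 0) (Suc (Suc (Suc k))) R = 0"
  "mode (J 0) 0 R = csc \<Lambda> R" "mode (J 0) (Suc 0) R = csc (2 * \<theta> - cn n * \<Lambda>) v" "mode (J 0) (Suc (Suc k)) R = 0"
  "mode (Gp 0) 0 R = 0" "mode (Gp 0) (Suc 0) R = csc (- (2 * \<theta> - cn n * \<Lambda>)) P" "mode (Gp 0) (Suc (Suc k)) R = 0"
  "mode (Gm 0) 0 R = csc 2 (mode (L 0) 0 Q)" "mode (Gm 0) (Suc 0) R = csc (cn n * \<Lambda> + 2 * \<theta> - 2 * cn n) Q"
  "mode (Gm 0) (Suc (Suc k)) R = 0"
  "mode (L (Suc 0)) (Suc 0) R = csc (- cn n * c) v" "mode (L (Suc 0)) (Suc (Suc k)) R = 0"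
  "mode (J (Suc 0)) 0 R = csc (2 * c) v" "mode (J (Suc 0)) (Suc k) R = 0"
  "mode (Gp (Suc 0)) 0 R = csc (- 2 * c) P" "mode (Gp (Suc 0)) (Suc k) R = 0"
  "mode (Gm (Suc 0)) 0 R = csc (2 * c) Q" "mode (Gm (Suc 0)) (Suc k) R = 0"
proof -
  have comb: "csc a x + csc b x = csc (a + b) x" "csc a x - csc b x = csc (a - b) x"
    "- csc a x = csc (- a) x" "csc a x - x = csc (a - 1) x" "csc a x + x = csc (a + 1) x" for a b x
    by (simp_all add: CV.scale_left_distrib CV.scale_left_diff_distrib)
  have z: "mode (Gp 0) 0 R = 0"
  proof -
    have "mode (Gp 0) 0 R = - mode (Gp 0) 0 R" using move_Gp(3)[of 0 0 Q] unfolding R_def .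
    then show ?thesis using double_zero by blast
  qed
  then show "mode (Gp 0) 0 R = 0" .
  have PQ: "mode (Gp 0) 0 v = P" by (simp add: P_def)
  note s = on_Q mode_csc index1_kill' L1_scalar' PQ
  have cc: "csc a x = csc b x" if "a = b" for a b x using that by simp
  have m: "mode g k R = mode g k (mode (Gp 0) 0 Q)" for g k by (simp add: R_def)
  show "mode (L 0) (Suc 0) R = csc (\<theta> - cn n) R"
    unfolding m move_Gp by (simp add: s comb half_def del: CV.scale_minus_left)
  show "mode (L 0) (Suc (Suc 0)) R = csc (- cn n * (2 * \<theta> - cn n * \<Lambda>)) v"
    unfolding m move_Gp by (simp add: s comb half_def del: CV.scale_minus_left)
  show "mode (L 0) (Suc (Suc (Suc k))) R = 0" unfolding m move_Gp by (simp add: s)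
  show "mode (J 0) 0 R = csc \<Lambda> R" unfolding m move_Gp by (simp add: s comb del: CV.scale_minus_left)
  show "mode (J 0) (Suc 0) R = csc (2 * \<theta> - cn n * \<Lambda>) v" "mode (J 0) (Suc (Suc k)) R = 0"
    unfolding m move_Gp by (simp_all add: s)
  show "mode (Gp 0) (Suc 0) R = csc (- (2 * \<theta> - cn n * \<Lambda>)) P" "mode (Gp 0) (Suc (Suc k)) R = 0"
    unfolding m move_Gp by (simp_all add: s comb del: CV.scale_minus_left)
  show "mode (Gm 0) 0 R = csc 2 (mode (L 0) 0 Q)"
    unfolding m move_Gp by (simp add: s)
  show "mode (Gm 0) (Suc 0) R = csc (cn n * \<Lambda> + 2 * \<theta> - 2 * cn n) Q" "mode (Gm 0) (Suc (Suc k)) R = 0"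
    unfolding m move_Gp by (simp add: s comb half_def del: CV.scale_minus_left, simp add: algebra_simps) (simp add: s)
  show "mode (L (Suc 0)) (Suc 0) R = csc (- cn n * c) v" "mode (L (Suc 0)) (Suc (Suc k)) R = 0"
    unfolding m move_Gp by (simp add: s comb half_def del: CV.scale_minus_left) (simp add: s)
  show "mode (J (Suc 0)) 0 R = csc (2 * c) v" "mode (J (Suc 0)) (Suc k) R = 0"
    unfolding m move_Gp by (simp_all add: s)
  show "mode (Gp (Suc 0)) 0 R = csc (- 2 * c) P" "mode (Gp (Suc 0)) (Suc k) R = 0"
    unfolding m move_Gp by (simp_all add: s comb del: CV.scale_minus_left)
  show "mode (Gm (Suc 0)) 0 R = csc (2 * c) Q" "mode (Gm (Suc 0)) (Suc k) R = 0"
    unfolding m move_Gp by (simp_all add: s)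
qed

end

section \<open>Comparison with the table of the module of rank four\<close>

context khighest
begin

text \<open>The powers of 1 / s are dictated by \<open>V_act\<close>, where \<open>Gp 0\<close> and
  \<open>Gm 0\<close> carry \<open>v01\<close> to s times \<open>v11\<close> and \<open>v12\<close>,
  and \<open>Gp 0\<close> carries \<open>v12\<close> to s times \<open>v02\<close> up to a term with
  \<lambda>.\<close>

fun E4 :: "complex \<Rightarrow> basis4 \<Rightarrow> 'm" where
  "E4 s v01 = v" | "E4 s v02 = csc (1 / (s * s)) R" | "E4 s v11 = csc (1 / s) P" | "E4 s v12 = csc (1 / s) Q"

lemma dmode_mode: "dmode g k x = csc (1 / fact k) (mode g k x)"
  by (simp add: mode_def)

lemma mode_minus: "mode g k (- x) = - mode g k x"
  using mode_csc[of g k "- 1" x] by simp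

lemma mode_cases: 
  obtains "k = 0" | "k = Suc 0" | "k = Suc (Suc 0)" | k' where "k = Suc (Suc (Suc k'))"
  by (metis not0_implies_Suc)

text \<open>Everything is rewritten in s, \<Delta>, \<Lambda> and \<alpha> through n = -s^2 and
  \<theta> = s^2 \<Delta>. Coefficients of degree above 2 vanish on both sides, which leaves
  finitely many comparisons.\<close>

lemma V_table:
  assumes s2: "s\<^sup>2 = - cn n" and g: "kindex g = 0"
  shows "dmode g k (E4 s h) = (\<Sum>(F, w)\<leftarrow>V_act n s (- \<theta> / cn n) \<Lambda> \<alpha> g h. psc (coeff F k) (E4 s w))"
proof -
  have s0: "s \<noteq> 0" using s_nonzero[OF s2 n1] .
  have n: "cn n = - (s * s)" using s2 by (simp add: power2_eq_square)
  have h: "half n = - (s * s) / 2" using n by (simp add: half_def)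
  obtain \<Delta> where \<Delta>: "\<Delta> = - \<theta> / cn n" by blast
  then have \<theta>: "\<theta> = s * s * \<Delta>" using n s0 by simp
  note on = on_P[unfolded n h \<theta>] on_Q[unfolded n h \<theta>] on_R[unfolded n h \<theta>] L00[unfolded n] L01'[unfolded \<theta>] J00
     P_def[symmetric] Q_def[symmetric] kill_modes
  note r = dmode_mode mode_csc n psc_linear power2_eq_square D_csc CV.scale_right_distrib CV.scale_right_diff_distrib
  show ?thesis
    unfolding \<Delta>[symmetric]
  proof (cases g)
    case (L i)
    then show "dmode g k (E4 s h) = (\<Sum>(F, w)\<leftarrow>V_act n s \<Delta> \<Lambda> \<alpha> g h. psc (coeff F k) (E4 s w))"
      using g s0 by (cases k rule: mode_cases; cases h) (simp_all add: r on, (simp_all add: field_simps)?)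
  next
    case (J i)
    then show "dmode g k (E4 s h) = (\<Sum>(F, w)\<leftarrow>V_act n s \<Delta> \<Lambda> \<alpha> g h. psc (coeff F k) (E4 s w))"
      using g s0 by (cases k rule: mode_cases; cases h) (simp_all add: r on, (simp_all add: field_simps)?)
  next
    case (Gp i)
    then show "dmode g k (E4 s h) = (\<Sum>(F, w)\<leftarrow>V_act n s \<Delta> \<Lambda> \<alpha> g h. psc (coeff F k) (E4 s w))"
      using g s0 by (cases k rule: mode_cases; cases h) (simp_all add: r on del: CV.scale_minus_left, (simp_all add: field_simps del: CV.scale_left_distrib_NO_MATCH CV.scale_left_diff_distrib_NO_MATCH)?)
  next
    case (Gm i)
    then show "dmode g k (E4 s h) = (\<Sum>(F, w)\<leftarrow>V_act n s \<Delta> \<Lambda> \<alpha> g h. psc (coeff F k) (E4 s w))"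
      using g s0 by (cases k rule: mode_cases; cases h) (simp_all add: r on, (simp_all add: field_simps)?)
  qed
qed

text \<open>The value \<beta> = 2 s c comes from \<open>L 1\<close>: the table prescribes the scalar
  -(s / 2) \<beta> = -s^2 c, which is \<open>c\<close> because s^2 = -1 for n = 1. For n > 1 both
  sides are zero since \<open>c\<close> = 0.\<close>

lemma W1_table:
  assumes s2: "s\<^sup>2 = - cn n" and g: "kindex g = 1"
  shows "dmode g k (E4 s h) = (\<Sum>(F, w)\<leftarrow>W1_act s (2 * s * c) g h. psc (coeff F k) (E4 s w))"
proof -
  have s0: "s \<noteq> 0" using s_nonzero[OF s2 n1] .
  note on = on_P on_Q on_R L1_scalar' P_def[symmetric] Q_def[symmetric] index1_kill'
  have n: "c = 0 \<or> cn n = 1 \<and> s * s = - 1"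
    using c_zero n1 s2 by (cases "n = 1") (auto simp: power2_eq_square)
  note r = dmode_mode mode_csc mode_minus psc_linear
  show ?thesis
  proof (cases "c = 0")
    case True
    then show ?thesis
      using g by (cases k rule: mode_cases; cases h; cases g) (simp_all add: r on)
  next
    case False
    then have n: "cn n = 1" "s * s = - 1" using n by auto
    then have si: "1 / s = - s" using s0 by (simp add: field_simps)
    have "s * (2 * s * c) = 2 * (s * s) * c" "2 * s * c * s = 2 * (s * s) * c" by (simp_all add: mult_ac)
    then have sc: "s * (2 * s * c) = - (2 * c)" "2 * s * c * s = - (2 * c)" using n by simp_all
    from n have ss: "s * (s * x) = - x" for x by (simp add: mult.assoc[symmetric])
    show ?thesis
      using g by (cases k rule: mode_cases; cases h; cases g) (simp_all add: r on n si ss sc)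
  qed
qed

lemma E4_grade: "E4 s h \<in> grade M (parity4 h + p)"
proof -
  have sc: "csc a x \<in> grade M j" if "x \<in> grade M j" for a x j
    using that PM.subspace_scale[OF M.subspace_grade] by (simp add: cscale_def)
  have P: "P \<in> grade M (1 + p)" and Q: "Q \<in> grade M (1 + p)"
    using mode_grade[OF vgr, of "Gp 0" 0] mode_grade[OF vgr, of "Gm 0" 0] by (simp_all only: P_def Q_def kparity.simps)
  have "R \<in> grade M (1 + (1 + p))" using mode_grade[OF Q, of "Gp 0" 0] by (simp only: R_def kparity.simps)
  moreover have "1 + (1 + p) = 0 + p" by (cases p) simp_all
  ultimately have R: "R \<in> grade M (0 + p)" by (simp only:)
  have "v \<in> grade M (0 + p)" using vgr by (simp only: add_0_left)
  then show ?thesis using P Q R sc by (cases h) (simp_all only: E4.simps parity4.simps)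
qed

lemma W_table:
  assumes s2: "s\<^sup>2 = - cn n" and g: "kindex g \<le> n"
  shows "dmode g k (E4 s h) = (\<Sum>(F, w)\<leftarrow>W_act n s (- \<theta> / cn n) \<Lambda> \<alpha> (2 * s * c) g h. psc (coeff F k) (E4 s w))"
proof -
  consider "kindex g = 0" | "kindex g = 1" | "kindex g > 1" by linarith
  then show ?thesis
  proof cases
    case 1
    then show ?thesis using V_table[OF s2] by (simp add: W_act_def)
  next
    case 2
    then show ?thesis using W1_table[OF s2] by (simp add: W_act_def)
  next
    case 3
    then show ?thesis using index_ge2[of g k] by (simp add: W_act_def mode_eq_0_iff)
  qed
qed

end

section \<open>The classification\<close>

context khighest
begin

text \<open>Positive energy forces k \<ge> 2 for \<open>L 0\<close> and k \<ge> 1 for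
  \<open>J 0\<close>, \<open>Gp 0\<close>, \<open>Gm 0\<close> and \<open>L 1\<close>, and indices
  above 1 act by zero, so the listed conditions suffice. The scalars \<open>c\<close> and \<alpha>
  belong to the module and stay the same.\<close>

lemma highest_vector_at:
  assumes "x \<noteq> 0" "x \<in> grade M q" "mode (L 0) 1 x = csc t x" "mode (J 0) 0 x = csc u x"
    and L: "\<And>k. mode (L 0) (Suc (Suc k)) x = 0" "\<And>k. mode (L (Suc 0)) (Suc k) x = 0"
    and J: "\<And>k. mode (J 0) (Suc k) x = 0" "\<And>k. mode (J (Suc 0)) k x = 0"
    and G: "\<And>k. mode (Gp 0) (Suc k) x = 0" "\<And>k. mode (Gm 0) (Suc k) x = 0"
      "\<And>k. mode (Gp (Suc 0)) k x = 0" "\<And>k. mode (Gm (Suc 0)) k x = 0"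
  shows "khighest n M x q t u c \<alpha>"
proof (unfold_locales)
  fix g k assume d: "energy g k > 0"
  consider "kindex g = 0" | "kindex g = 1" | "kindex g > 1" by linarith
  then show "mode g k x = 0"
  proof cases
    case 1
    show ?thesis
    proof (cases g)
      case (L i)
      then have "i = 0" using 1 by simp
      with L d n1 have "k \<noteq> 0" "k \<noteq> 1" by (auto simp: energy_def)
      then obtain k' where "k = Suc (Suc k')" by (metis One_nat_def not0_implies_Suc)
      then show ?thesis using \<open>i = 0\<close> L assms(5) by simp
    next
      case (J i)
      then have "i = 0" using 1 by simp
      have "k \<noteq> 0" using d J \<open>i = 0\<close> by (cases k) (auto simp: energy_def)
      then obtain k' where "k = Suc k'" by (metis not0_implies_Suc)
      then show ?thesis using \<open>i = 0\<close> J assms(7) by simp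
    next
      case (Gp i)
      then have "i = 0" using 1 by simp
      have "k \<noteq> 0" using d Gp \<open>i = 0\<close> by (cases k) (auto simp: energy_def)
      then obtain k' where "k = Suc k'" by (metis not0_implies_Suc)
      then show ?thesis using \<open>i = 0\<close> Gp G by simp
    next
      case (Gm i)
      then have "i = 0" using 1 by simp
      have "k \<noteq> 0" using d Gm \<open>i = 0\<close> by (cases k) (auto simp: energy_def)
      then obtain k' where "k = Suc k'" by (metis not0_implies_Suc)
      then show ?thesis using \<open>i = 0\<close> Gm G by simp
    qed
  next
    case 2
    show ?thesis
    proof (cases g)
      case (L i)
      then have "i = Suc 0" using 2 by simp
      have "k \<noteq> 0" using d n1 L \<open>i = Suc 0\<close> by (cases k) (auto simp: energy_def)
      then obtain k' where "k = Suc k'" by (metis not0_implies_Suc)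
      then show ?thesis using \<open>i = Suc 0\<close> L assms(6) by simp
    qed (use 2 J G in auto)
  next
    case 3
    then show ?thesis by (rule index_ge2)
  qed
qed (use assms c L00 in auto)

lemma psc_md0: "mode g 0 (psc q x) = psc q (mode g 0 x)"
  by (rule psc_commute[OF mode_add mode_csc]) (simp add: mode_D)

text \<open>By \<open>L00\<close> such an equation reads (1 - q) v = 0 with q divisible by
  \<partial> + \<alpha>. The polynomial 1 - q takes the value 1 at -\<alpha>, so it is nonzero,
  which contradicts \<open>torsion_free\<close>.\<close>

lemma not_multiple:
  assumes "v = psc y (csc 2 (mode (L 0) 0 v))"
  shows False
proof -
  let ?q = "y * ([:2:] * ([:- cn n:] * [:\<alpha>, 1:]))"
  have "D v + csc \<alpha> v = psc [:\<alpha>, 1:] v" by (simp add: psc_linear add.commute)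
  then have "csc 2 (mode (L 0) 0 v) = psc ([:2:] * ([:- cn n:] * [:\<alpha>, 1:])) v"
    unfolding L00 cscale_def by (simp only: PM.scale_scale)
  then have "v = psc ?q v" using assms by (simp only: PM.scale_scale)
  then have "psc (1 - ?q) v = 0" by (simp only: PM.scale_left_diff_distrib PM.scale_one) simp
  then have "1 - ?q = 0" using torsion_free v0 by blast
  then have "poly (1 - ?q) (- \<alpha>) = 0" by simp
  then show False by simp
qed

lemma W_conformal:
  assumes s2: "s\<^sup>2 = - cn n" and \<beta>: "n = 1 \<or> \<beta> = 0"
  shows "conformal_module (k_alg n) (free_conf_module parity4 (W_act n s \<Delta> \<Lambda>' \<alpha>' \<beta>))"
  using W_parity W_identity[OF s2 n1 \<beta>] by (rule free_conformal_module)

text \<open>The module of rank four, possibly reducible, maps onto \<open>M\<close>, and the images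
  of its basis are multiples of \<open>v\<close>, \<open>R\<close>, \<open>P\<close> and
  \<open>Q\<close>.\<close>

lemma generated:
  assumes s2: "s\<^sup>2 = - cn n"
  shows "\<exists>a1 a2 a3 a4. w = psc a1 v + psc a2 R + psc a3 P + psc a4 Q"
proof -
  have "n = 1 \<or> 2 * s * c = 0" using c_zero n1 by (cases "n = 1") auto
  then have "\<exists>u. w = lin_ext (E4 s) u"
    using v0 by (intro lin_ext_surj[OF W_conformal[OF s2] W_table[OF s2] E4_grade, where ?h0.0=v01]) auto
  then obtain u where u: "w = lin_ext (E4 s) u" by blast
  have "lin_ext (E4 s) u = (\<Sum>h\<in>{v01, v02, v11, v12}. psc (lookup u h) (E4 s h))"
    by (rule lin_ext_superset) (simp_all add: keys4)
  then have "w = psc (lookup u v01) v + psc (lookup u v02 * [:1 / (s * s):]) R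
     + psc (lookup u v11 * [:1 / s:]) P + psc (lookup u v12 * [:1 / s:]) Q"
    unfolding u by (simp add: cscale_def add.assoc mult.commute)
  then show ?thesis by blast
qed

lemma grade_psc: "x \<in> grade M j \<Longrightarrow> psc a x \<in> grade M j"
  by (rule PM.subspace_scale[OF M.subspace_grade])

lemma grade_sum: "x \<in> grade M j \<Longrightarrow> y \<in> grade M j \<Longrightarrow> x + y \<in> grade M j"
  by (rule PM.subspace_add[OF M.subspace_grade])

lemma grade_PQR: "P \<in> grade M (p + 1)" "Q \<in> grade M (p + 1)" "R \<in> grade M p"
proof -
  show P: "P \<in> grade M (p + 1)" and Q: "Q \<in> grade M (p + 1)"
    using mode_grade[OF vgr, of "Gp 0" 0] mode_grade[OF vgr, of "Gm 0" 0]
    by (simp_all only: P_def Q_def kparity.simps add.commute)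
  have "R \<in> grade M (1 + (p + 1))" using mode_grade[OF Q, of "Gp 0" 0] by (simp only: R_def kparity.simps)
  moreover have "1 + (p + 1) = p" by (cases p) simp_all
  ultimately show "R \<in> grade M p" by (simp only:)
qed

lemma grade_zero: "0 \<in> grade M j"
  by (rule PM.subspace_0[OF M.subspace_grade])

text \<open>Otherwise \<open>Q\<close> is another highest vector, so it generates \<open>v\<close>, which makes \<open>v\<close> a multiple of \<open>R\<close>; applying
  \<open>G\<^sup>+\<close> yields \<open>P = 0\<close>, whence \<open>R\<close> is a multiple of \<open>(\<partial> + \<alpha>) v\<close> and \<open>v\<close> would be torsion.\<close>

lemma Q_zero:
  assumes s2: "s\<^sup>2 = - cn n" and c0: "c = 0" and a: "2 * \<theta> - cn n * \<Lambda> = 0"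
  shows "Q = 0"
proof (rule ccontr)
  assume "Q \<noteq> 0"
  have Gp: "mode (Gp 0) (Suc k) Q = 0" for k by (cases k) (simp_all add: on_Q a)
  have Gp1: "mode (Gp (Suc 0)) k Q = 0" for k by (cases k) (simp_all add: on_Q c0)
  interpret q: khighest n M Q "p + 1" "\<theta> - half n" "\<Lambda> - 1" c \<alpha>
    by (rule highest_vector_at) (use \<open>Q \<noteq> 0\<close> grade_PQR Gp Gp1 on_Q in auto)
  have qP: "q.P = R" by (simp add: q.P_def R_def)
  have qQ: "q.Q = 0" by (simp add: q.Q_def on_Q)
  have qR: "q.R = 0" by (simp add: q.R_def qQ)
  obtain a1 a2 a3 a4 where "v = psc a1 Q + psc a2 q.R + psc a3 q.P + psc a4 q.Q"
    using q.generated[OF s2] by blast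
  then have e: "v + 0 = psc a3 R + psc a1 Q" by (simp add: qP qQ qR add.commute)
  have v: "v = psc a3 R"
    using grade_unique[OF e vgr] grade_psc grade_PQR grade_zero by blast
  have "P = psc a3 (mode (Gp 0) 0 R)" unfolding P_def by (subst v) (rule psc_md0)
  then have "P = 0" by (simp add: on_R)
  then have "R = csc 2 (mode (L 0) 0 v)" using on_P(6) by simp
  then show False using not_multiple v by metis
qed

text \<open>The counterpart of \<open>Q_zero\<close> under the exchange of the two odd operators.
  Now \<open>v\<close> becomes a multiple of \<open>q.Q\<close>, which is
  \<open>mode (Gm 0) 0 P\<close>. Applying \<open>mode (Gm 0) 0\<close> once more gives
  \<open>Q\<close> = 0, hence \<open>R\<close> = 0, so \<open>q.Q\<close> is twice
  \<open>mode (L 0) 0 v\<close>, contrary to \<open>not_multiple\<close>.\<close>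

lemma P_zero:
  assumes s2: "s\<^sup>2 = - cn n" and c0: "c = 0" and a: "cn n * \<Lambda> + 2 * \<theta> = 0"
  shows "P = 0"
proof (rule ccontr)
  assume "P \<noteq> 0"
  have Gm: "mode (Gm 0) (Suc k) P = 0" for k by (cases k) (simp_all add: on_P a)
  have Gm1: "mode (Gm (Suc 0)) k P = 0" for k by (cases k) (simp_all add: on_P c0)
  interpret q: khighest n M P "p + 1" "\<theta> - half n" "\<Lambda> + 1" c \<alpha>
    by (rule highest_vector_at) (use \<open>P \<noteq> 0\<close> grade_PQR Gm Gm1 on_P in auto)
  have qP: "q.P = 0" by (simp add: q.P_def on_P)
  obtain a1 a2 a3 a4 where "v = psc a1 P + psc a2 q.R + psc a3 q.P + psc a4 q.Q"
    using q.generated[OF s2] by blast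
  then have e: "v + 0 = psc a4 q.Q + (psc a1 P + psc a2 q.R)" by (simp add: qP add_ac)
  \<comment> \<open>\<open>v\<close> and \<open>q.Q\<close> have parity \<open>p\<close>, whereas
    \<open>P\<close> and \<open>q.R\<close> have the opposite one, so comparing components leaves
    only the term with \<open>q.Q\<close>.\<close>
  have pp: "p + 1 + 1 = p" by (cases p) simp_all
  have v: "v = psc a4 q.Q"
    using grade_unique[OF e vgr] grade_psc[OF q.grade_PQR(2)] grade_zero
      grade_sum[OF grade_psc[OF grade_PQR(1)] grade_psc[OF q.grade_PQR(3)]] unfolding pp by blast
  have "mode (Gm 0) 0 q.Q = - mode (Gm 0) 0 q.Q" using move_Gm(4)[of 0 0 P] unfolding q.Q_def .
  then have z: "mode (Gm 0) 0 q.Q = 0" by (rule double_zero)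
  have "Q = psc a4 (mode (Gm 0) 0 q.Q)" unfolding Q_def by (subst v) (rule psc_md0)
  then have "Q = 0" by (simp add: z)
  then have "R = 0" by (simp add: R_def)
  then have "q.Q = csc 2 (mode (L 0) 0 v)" using on_P(6) by (simp add: q.Q_def)
  then show False using not_multiple v by metis
qed

fun E2 :: "'m \<Rightarrow> basis2 \<Rightarrow> 'm" where
  "E2 w v0 = v" | "E2 w v1 = w"

lemma E2_grade: "w \<in> grade M (p + 1) \<Longrightarrow> E2 w h \<in> grade M (parity2 h + p)"
  using vgr by (cases h) (simp_all only: E2.simps parity2.simps add.commute[of p] add_0_left)

text \<open>With \<open>Q\<close> also \<open>R\<close> vanishes, so \<open>mode (Gm 0) 0\<close>
  sends \<open>P\<close> back to twice \<open>mode (L 0) 0 v\<close> and two basis vectors remain.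
  The vanishing scalar means \<Lambda> = -2 \<Delta>.\<close>

lemma V1_table:
  assumes s2: "s\<^sup>2 = - cn n" and c0: "c = 0" and a: "2 * \<theta> - cn n * \<Lambda> = 0" and Q: "Q = 0"
  shows "dmode g k (E2 (csc (1 / s) P) h) = (\<Sum>(F, w)\<leftarrow>V1_act n s (- \<theta> / cn n) \<alpha> g h. psc (coeff F k) (E2 (csc (1 / s) P) w))"
proof (cases "kindex g = 0")
  case True
  have s0: "s \<noteq> 0" using s_nonzero[OF s2 n1] .
  have n: "cn n = - (s * s)" using s2 by (simp add: power2_eq_square)
  have h: "half n = - (s * s) / 2" using n by (simp add: half_def)
  obtain \<Delta> where \<Delta>: "\<Delta> = - \<theta> / cn n" by blast
  then have \<theta>: "\<theta> = s * s * \<Delta>" using n s0 by simp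
  have "s * s * (2 * \<Delta> + \<Lambda>) = 0" using a unfolding \<theta> n by (simp add: algebra_simps)
  then have \<Lambda>: "\<Lambda> = - 2 * \<Delta>" using s0 by (simp add: eq_neg_iff_add_eq_0 add.commute)
  have R: "R = 0" using Q by (simp add: R_def)
  note on = on_P[unfolded n h \<theta> \<Lambda>] L00[unfolded n] L01'[unfolded \<theta>] J00[unfolded \<Lambda>] P_def[symmetric] Q_def[symmetric] Q R kill_modes
  note r = dmode_mode mode_csc n psc_linear power2_eq_square D_csc CV.scale_right_distrib CV.scale_right_diff_distrib
  show ?thesis
    unfolding \<Delta>[symmetric]
    using True s0 by (cases g; cases k rule: mode_cases; cases h) (simp_all add: r on, (simp_all add: field_simps)?)
next
  case False
  then consider "kindex g = 1" | "kindex g > 1" by linarith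
  then show ?thesis
  proof cases
    case 1
    then show ?thesis
      by (cases k rule: mode_cases; cases h; cases g)
         (simp_all add: V1_nonzero_index dmode_mode mode_csc on_P L1_scalar' index1_kill' c0)
  next
    case 2
    then show ?thesis using index_ge2[of g k] by (simp add: V1_nonzero_index mode_eq_0_iff)
  qed
qed

text \<open>With \<open>P\<close> = 0 the formula for \<open>mode (Gm 0) 0 P\<close> makes
  \<open>R\<close> equal to twice \<open>mode (L 0) 0 v\<close>, so it is no longer an independent
  vector. The vanishing scalar means \<Lambda> = 2 \<Delta>.\<close>

lemma V2_table:
  assumes s2: "s\<^sup>2 = - cn n" and c0: "c = 0" and a: "cn n * \<Lambda> + 2 * \<theta> = 0" and P: "P = 0"
  shows "dmode g k (E2 (csc (1 / s) Q) h) = (\<Sum>(F, w)\<leftarrow>V2_act n s (- \<theta> / cn n) \<alpha> g h. psc (coeff F k) (E2 (csc (1 / s) Q) w))"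
proof (cases "kindex g = 0")
  case True
  have s0: "s \<noteq> 0" using s_nonzero[OF s2 n1] .
  have n: "cn n = - (s * s)" using s2 by (simp add: power2_eq_square)
  have h: "half n = - (s * s) / 2" using n by (simp add: half_def)
  obtain \<Delta> where \<Delta>: "\<Delta> = - \<theta> / cn n" by blast
  then have \<theta>: "\<theta> = s * s * \<Delta>" using n s0 by simp
  have "s * s * (2 * \<Delta> - \<Lambda>) = 0" using a unfolding \<theta> n by (simp add: algebra_simps)
  then have \<Lambda>: "\<Lambda> = 2 * \<Delta>" using s0 by simp
  have R: "R = csc 2 (mode (L 0) 0 v)" using on_P(6) P by simp
  note on = on_Q[unfolded n h \<theta> \<Lambda> R] L00[unfolded n] L01'[unfolded \<theta>] J00[unfolded \<Lambda>] P_def[symmetric] Q_def[symmetric] P kill_modes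
  note r = dmode_mode mode_csc n psc_linear power2_eq_square D_csc CV.scale_right_distrib CV.scale_right_diff_distrib
  show ?thesis
    unfolding \<Delta>[symmetric]
    using True s0 by (cases g; cases k rule: mode_cases; cases h) (simp_all add: r on, (simp_all add: field_simps)?)
next
  case False
  then consider "kindex g = 1" | "kindex g > 1" by linarith
  then show ?thesis
  proof cases
    case 1
    then show ?thesis
      by (cases k rule: mode_cases; cases h; cases g)
         (simp_all add: V2_nonzero_index dmode_mode mode_csc on_Q L1_scalar' index1_kill' c0)
  next
    case 2
    then show ?thesis using index_ge2[of g k] by (simp add: V2_nonzero_index mode_eq_0_iff)
  qed
qed

text \<open>Otherwise \<open>R\<close> = 0 and hence \<open>mode (L 0) 0 v\<close> = 0, that is
  (\<partial> + \<alpha>) v = 0, against \<open>torsion_free\<close>.\<close>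

lemma P_or_Q_nonzero: "\<not> (P = 0 \<and> Q = 0)"
proof
  assume *: "P = 0 \<and> Q = 0"
  then have "csc 2 (mode (L 0) 0 v) = 0" using on_P(6) by (simp add: R_def)
  then have "D v + csc \<alpha> v = 0" using n1 by (simp add: L00)
  then have "psc [:\<alpha>, 1:] v = 0" by (simp add: psc_linear add.commute)
  then show False using torsion_free v0 by fastforce
qed

text \<open>Away from the degenerate parameters the module of rank four is irreducible and the
  comparison is an isomorphism. For \<beta> = 0, the vector \<open>Q\<close> vanishes if 2 \<Delta>
  + \<Lambda> = 0 and \<open>P\<close> vanishes if 2 \<Delta> - \<Lambda> = 0, and the remaining two
  vectors match a module of rank two.\<close>

lemma classification:
  assumes s2: "s\<^sup>2 = - cn n"
  shows "(\<exists>\<Delta> \<alpha>. \<Delta> \<noteq> 0 \<and> isomorphic_up_to_parity (k_alg n) M (V1_mod n s \<Delta> \<alpha>)) \<or>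
    (\<exists>\<Delta> \<alpha>. \<Delta> \<noteq> 0 \<and> isomorphic_up_to_parity (k_alg n) M (V2_mod n s \<Delta> \<alpha>)) \<or>
    (\<exists>\<Delta> \<Lambda> \<alpha> \<beta>. (n = 1 \<or> \<beta> = 0) \<and> (2 * \<Delta> + \<Lambda> \<noteq> 0 \<or> \<beta> \<noteq> 0) \<and> (2 * \<Delta> - \<Lambda> \<noteq> 0 \<or> \<beta> \<noteq> 0) \<and>
       isomorphic_up_to_parity (k_alg n) M (free_conf_module parity4 (W_act n s \<Delta> \<Lambda> \<alpha> \<beta>)))"
proof -
  have s0: "s \<noteq> 0" using s_nonzero[OF s2 n1] .
  define \<Delta> where "\<Delta> = - \<theta> / cn n"
  have \<theta>: "\<theta> = - cn n * \<Delta>" using n1 by (simp add: \<Delta>_def)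
  define \<beta> where "\<beta> = 2 * s * c"
  have \<beta>: "n = 1 \<or> \<beta> = 0" using c_zero n1 by (cases "n = 1") (auto simp: \<beta>_def)
  have c\<beta>: "c = 0" if "\<beta> = 0" using that s0 by (simp add: \<beta>_def)
  consider (W) "2 * \<Delta> + \<Lambda> \<noteq> 0 \<or> \<beta> \<noteq> 0" "2 * \<Delta> - \<Lambda> \<noteq> 0 \<or> \<beta> \<noteq> 0"
    | (plus) "2 * \<Delta> + \<Lambda> = 0" "\<beta> = 0" | (minus) "2 * \<Delta> - \<Lambda> = 0" "\<beta> = 0" by blast
  then show ?thesis
  proof cases
    case W
    have "isomorphic_up_to_parity (k_alg n) M (free_conf_module parity4 (W_act n s \<Delta> \<Lambda> \<alpha> \<beta>))"
      unfolding \<Delta>_def \<beta>_def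
      using W_irreducible[OF n1 s2 \<beta> W] W_table[OF s2] E4_grade v0 unfolding \<Delta>_def \<beta>_def
      by (intro lin_ext_isomorphic[where E="E4 s" and ?h0.0=v01 and p=p]) auto
    then show ?thesis using \<beta> W by blast
  next
    case plus
    have "2 * \<theta> - cn n * \<Lambda> = - cn n * (2 * \<Delta> + \<Lambda>)" by (simp add: \<theta> algebra_simps)
    then have a: "2 * \<theta> - cn n * \<Lambda> = 0" using plus by simp
    have Q: "Q = 0" by (rule Q_zero[OF s2 c\<beta>[OF plus(2)] a])
    \<comment> \<open>For \<Delta> = 0 both degenerate conditions hold, so \<open>P\<close> and
      \<open>Q\<close> would both vanish. This is the origin of \<Delta> \<noteq> 0 in the families
      of rank two.\<close>
    have \<Delta>0: "\<Delta> \<noteq> 0"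
    proof
      assume "\<Delta> = 0"
      then have "cn n * \<Lambda> + 2 * \<theta> = 0" using plus \<theta> by simp
      then show False using P_zero[OF s2 c\<beta>[OF plus(2)]] Q P_or_Q_nonzero by blast
    qed
    have "csc (1 / s) P \<in> grade M (p + 1)" using grade_psc[OF grade_PQR(1)] by (simp add: cscale_def)
    note gr = E2_grade[OF this]
    have "isomorphic_up_to_parity (k_alg n) M (V1_mod n s \<Delta> \<alpha>)"
      using V1_irreducible[OF n1 s2 \<Delta>0, of \<alpha>] V1_table[OF s2 c\<beta>[OF plus(2)] a Q] gr v0
      unfolding V1_mod_def \<Delta>_def
      by (intro lin_ext_isomorphic[where E="E2 (csc (1 / s) P)" and ?h0.0=v0 and p=p]) auto
    then show ?thesis using \<Delta>0 by blast
  next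
    case minus
    have "cn n * \<Lambda> + 2 * \<theta> = - cn n * (2 * \<Delta> - \<Lambda>)" by (simp add: \<theta> algebra_simps)
    then have a: "cn n * \<Lambda> + 2 * \<theta> = 0" using minus by simp
    have P: "P = 0" by (rule P_zero[OF s2 c\<beta>[OF minus(2)] a])
    have \<Delta>0: "\<Delta> \<noteq> 0"
    proof
      assume "\<Delta> = 0"
      then have "2 * \<theta> - cn n * \<Lambda> = 0" using minus \<theta> by simp
      then show False using Q_zero[OF s2 c\<beta>[OF minus(2)]] P P_or_Q_nonzero by blast
    qed
    have "csc (1 / s) Q \<in> grade M (p + 1)" using grade_psc[OF grade_PQR(2)] by (simp add: cscale_def)
    note gr = E2_grade[OF this]
    have "isomorphic_up_to_parity (k_alg n) M (V2_mod n s \<Delta> \<alpha>)"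
      using V2_irreducible[OF n1 s2 \<Delta>0, of \<alpha>] V2_table[OF s2 c\<beta>[OF minus(2)] a P] gr v0
      unfolding V2_mod_def \<Delta>_def
      by (intro lin_ext_isomorphic[where E="E2 (csc (1 / s) Q)" and ?h0.0=v0 and p=p]) auto
    then show ?thesis using \<Delta>0 by blast
  qed
qed

end

lemma irreducible_classification:
  fixes M :: "('m::ab_group_add, kelem) conf_mod"
  assumes n: "n \<ge> 1" and s2: "s\<^sup>2 = - of_nat n" and M: "nontrivial_finite_irreducible (k_alg n) M"
  shows "(\<exists>\<Delta> \<alpha>. \<Delta> \<noteq> 0 \<and> isomorphic_up_to_parity (k_alg n) M (V1_mod n s \<Delta> \<alpha>)) \<or>
    (\<exists>\<Delta> \<alpha>. \<Delta> \<noteq> 0 \<and> isomorphic_up_to_parity (k_alg n) M (V2_mod n s \<Delta> \<alpha>)) \<or>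
    (\<exists>\<Delta> \<Lambda> \<alpha> \<beta>. (n = 1 \<or> \<beta> = 0) \<and> (2 * \<Delta> + \<Lambda> \<noteq> 0 \<or> \<beta> \<noteq> 0) \<and> (2 * \<Delta> - \<Lambda> \<noteq> 0 \<or> \<beta> \<noteq> 0) \<and>
       isomorphic_up_to_parity (k_alg n) M (free_conf_module parity4 (W_act n s \<Delta> \<Lambda> \<alpha> \<beta>)))"
proof -
  interpret kirreducible n M
    unfolding kirreducible_def kirreducible_axioms_def kmodule_def
    using n M unfolding nontrivial_finite_irreducible_def by blast
  obtain v p \<theta> \<Lambda> where v: "v \<noteq> 0" "v \<in> grade M p" "\<And>g k. energy g k > 0 \<Longrightarrow> mode g k v = 0"
    "mode (L 0) 1 v = csc \<theta> v" "mode (J 0) 0 v = csc \<Lambda> v"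
    by (rule highest_vector) blast
  obtain c where c: "\<And>w. mode (L n) 0 w = csc c w" using Ln_scalar by blast
  obtain \<alpha> where \<alpha>: "\<And>w. mode (L 0) 0 w = csc (- cn n) (D w + csc \<alpha> w)" using L0_scalar by blast
  interpret khighest n M v p \<theta> \<Lambda> c \<alpha> by unfold_locales (use v c \<alpha> in auto)
  show ?thesis by (rule classification[OF s2])
qed

theorem corollary5p5:
  fixes n :: nat and s :: complex
  assumes "n \<ge> 1" and "s\<^sup>2 = - of_nat n"
  shows "(n > 1 \<longrightarrow>
      (\<forall>\<Delta> \<alpha>. \<Delta> \<noteq> 0 \<longrightarrow> nontrivial_finite_irreducible (k_alg n) (V1_mod n s \<Delta> \<alpha>)) \<and>
      (\<forall>\<Delta> \<alpha>. \<Delta> \<noteq> 0 \<longrightarrow> nontrivial_finite_irreducible (k_alg n) (V2_mod n s \<Delta> \<alpha>)) \<and>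
      (\<forall>\<Delta> \<Lambda> \<alpha>. 2 * \<Delta> + \<Lambda> \<noteq> 0 \<and> 2 * \<Delta> - \<Lambda> \<noteq> 0 \<longrightarrow>
         nontrivial_finite_irreducible (k_alg n) (V_mod n s \<Delta> \<Lambda> \<alpha>)) \<and>
      (\<forall>M :: ('m::ab_group_add, kelem) conf_mod. nontrivial_finite_irreducible (k_alg n) M \<longrightarrow>
         (\<exists>\<Delta> \<alpha>. \<Delta> \<noteq> 0 \<and> isomorphic_up_to_parity (k_alg n) M (V1_mod n s \<Delta> \<alpha>)) \<or>
         (\<exists>\<Delta> \<alpha>. \<Delta> \<noteq> 0 \<and> isomorphic_up_to_parity (k_alg n) M (V2_mod n s \<Delta> \<alpha>)) \<or>
         (\<exists>\<Delta> \<Lambda> \<alpha>. 2 * \<Delta> + \<Lambda> \<noteq> 0 \<and> 2 * \<Delta> - \<Lambda> \<noteq> 0 \<and>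
            isomorphic_up_to_parity (k_alg n) M (V_mod n s \<Delta> \<Lambda> \<alpha>)))) \<and>
    (n = 1 \<longrightarrow>
      (\<forall>\<Delta> \<alpha>. \<Delta> \<noteq> 0 \<longrightarrow> nontrivial_finite_irreducible (k_alg n) (V1_mod n s \<Delta> \<alpha>)) \<and>
      (\<forall>\<Delta> \<alpha>. \<Delta> \<noteq> 0 \<longrightarrow> nontrivial_finite_irreducible (k_alg n) (V2_mod n s \<Delta> \<alpha>)) \<and>
      (\<forall>\<Delta> \<Lambda> \<alpha> \<beta>. (2 * \<Delta> + \<Lambda>, \<beta>) \<noteq> (0, 0) \<and> (2 * \<Delta> - \<Lambda>, \<beta>) \<noteq> (0, 0) \<longrightarrow>
         nontrivial_finite_irreducible (k_alg n) (V\<beta>_mod s \<Delta> \<Lambda> \<alpha> \<beta>)) \<and>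
      (\<forall>M :: ('m::ab_group_add, kelem) conf_mod. nontrivial_finite_irreducible (k_alg n) M \<longrightarrow>
         (\<exists>\<Delta> \<alpha>. \<Delta> \<noteq> 0 \<and> isomorphic_up_to_parity (k_alg n) M (V1_mod n s \<Delta> \<alpha>)) \<or>
         (\<exists>\<Delta> \<alpha>. \<Delta> \<noteq> 0 \<and> isomorphic_up_to_parity (k_alg n) M (V2_mod n s \<Delta> \<alpha>)) \<or>
         (\<exists>\<Delta> \<Lambda> \<alpha> \<beta>. (2 * \<Delta> + \<Lambda>, \<beta>) \<noteq> (0, 0) \<and> (2 * \<Delta> - \<Lambda>, \<beta>) \<noteq> (0, 0) \<and>
            isomorphic_up_to_parity (k_alg n) M (V\<beta>_mod s \<Delta> \<Lambda> \<alpha> \<beta>))))"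
proof (intro conjI impI allI)
  fix \<Delta> \<alpha> :: complex assume "\<Delta> \<noteq> 0"
  show "nontrivial_finite_irreducible (k_alg n) (V1_mod n s \<Delta> \<alpha>)"
    by (rule V1_irreducible) fact+
  show "nontrivial_finite_irreducible (k_alg n) (V2_mod n s \<Delta> \<alpha>)"
    by (rule V2_irreducible) fact+
  show "nontrivial_finite_irreducible (k_alg n) (V1_mod n s \<Delta> \<alpha>)"
    by (rule V1_irreducible) fact+
  show "nontrivial_finite_irreducible (k_alg n) (V2_mod n s \<Delta> \<alpha>)"
    by (rule V2_irreducible) fact+
next
  fix \<Delta> \<Lambda> \<alpha> :: complex assume "2 * \<Delta> + \<Lambda> \<noteq> 0 \<and> 2 * \<Delta> - \<Lambda> \<noteq> 0"
  then show "nontrivial_finite_irreducible (k_alg n) (V_mod n s \<Delta> \<Lambda> \<alpha>)"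
    unfolding V_mod_W by (intro W_irreducible assms) auto
next
  fix M :: "('m, kelem) conf_mod"
  assume n: "n > 1" and M: "nontrivial_finite_irreducible (k_alg n) M"
  show "(\<exists>\<Delta> \<alpha>. \<Delta> \<noteq> 0 \<and> isomorphic_up_to_parity (k_alg n) M (V1_mod n s \<Delta> \<alpha>)) \<or>
         (\<exists>\<Delta> \<alpha>. \<Delta> \<noteq> 0 \<and> isomorphic_up_to_parity (k_alg n) M (V2_mod n s \<Delta> \<alpha>)) \<or>
         (\<exists>\<Delta> \<Lambda> \<alpha>. 2 * \<Delta> + \<Lambda> \<noteq> 0 \<and> 2 * \<Delta> - \<Lambda> \<noteq> 0 \<and>
            isomorphic_up_to_parity (k_alg n) M (V_mod n s \<Delta> \<Lambda> \<alpha>))"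
    using irreducible_classification[OF assms M] n unfolding V_mod_W by auto
next
  fix \<Delta> \<Lambda> \<alpha> \<beta> :: complex
  assume n: "n = 1" and "(2 * \<Delta> + \<Lambda>, \<beta>) \<noteq> (0, 0) \<and> (2 * \<Delta> - \<Lambda>, \<beta>) \<noteq> (0, 0)"
  then show "nontrivial_finite_irreducible (k_alg n) (V\<beta>_mod s \<Delta> \<Lambda> \<alpha> \<beta>)"
    using assms unfolding V\<beta>_mod_W n by (intro W_irreducible) auto
next
  fix M :: "('m, kelem) conf_mod"
  assume n: "n = 1" and M: "nontrivial_finite_irreducible (k_alg n) M"
  show "(\<exists>\<Delta> \<alpha>. \<Delta> \<noteq> 0 \<and> isomorphic_up_to_parity (k_alg n) M (V1_mod n s \<Delta> \<alpha>)) \<or>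
         (\<exists>\<Delta> \<alpha>. \<Delta> \<noteq> 0 \<and> isomorphic_up_to_parity (k_alg n) M (V2_mod n s \<Delta> \<alpha>)) \<or>
         (\<exists>\<Delta> \<Lambda> \<alpha> \<beta>. (2 * \<Delta> + \<Lambda>, \<beta>) \<noteq> (0, 0) \<and> (2 * \<Delta> - \<Lambda>, \<beta>) \<noteq> (0, 0) \<and>
            isomorphic_up_to_parity (k_alg n) M (V\<beta>_mod s \<Delta> \<Lambda> \<alpha> \<beta>))"
    using irreducible_classification[OF assms M] unfolding V\<beta>_mod_W n by auto
qed

end
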